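(* Let $\Omega$, $B$, $\phi$, $\epsilon>0$, $D$, $d$, $b$ and $m$ be as in the context; in particular $m-\frac12\nabla\cdot b\ge 0$. Consider the bilinear form on $H^1_0(B)$ $$a(u,v) := \int_B D\,\nabla(\phi u)\cdot\left[\nabla(\phi v)+v\nabla\phi\right]+\frac{D}{\epsilon^{2}}(1-\phi)^2\,uv+\frac{D}{4}|\nabla\phi|^2\,uv+\phi\,\big(b\cdot\nabla(\phi u)\big)\,v+\phi^2 m\,uv\;dx .$$ Then $a$ is coercive: there is a constant $C>0$ such that $a(u,u)\ge C\|u\|^2$ for all $u\in H^1_0(B)$, with respect to the norm $$\|u\|^2 := \int_B \phi^2|\nabla u|^2+\epsilon^{-2}(1-\phi)^2|u|^2\;dx .$$
   Context: $\Omega\subset\mathbb{R}^n$ is a sufficiently smooth bounded domain, and $B\supset\Omega$ is a larger bounded domain. $r$ is the signed distance function of $\Omega$ (negative in $\Omega$, positive outside, $|\nabla r|=1$ almost everywhere). For a fixed parameter $\epsilon>0$ the phase-field function is $$\phi(x)=\tfrac12\left(1-\tanh\left(\tfrac{3r(x)}{\epsilon}\right)\right),\quad x\in B,$$ so $\phi$ takes values in $(0,1)$ and $\nabla\phi=-\frac{6}{\epsilon}\phi(1-\phi)\nabla r$. $D:B\to\mathbb{R}$ is a bounded scalar function with $D(x)\ge d>0$ for a constant $d$. $b:B\to\mathbb{R}^n$ is a given velocity field with $b\in W^{1,\infty}(B)^n$ and $m\in L^\infty(B)$ is a given scalar function, satisfying $m-\frac12\nabla\cdot b\ge0$ in $B$.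 *)

theory Defs
  imports "HOL-Analysis.Analysis"
begin

text \<open>Functions on \<open>B\<close> are total functions whose values outside \<open>B\<close> are never used.\<close>

section \<open>Smooth functions and domains\<close>

text \<open>Meant for open \<open>S\<close>: all partial derivatives up to order \<open>k\<close> exist and are continuous.\<close>

primrec Ck_on :: "nat \<Rightarrow> ('a::euclidean_space \<Rightarrow> real) \<Rightarrow> 'a set \<Rightarrow> bool" where
  "Ck_on 0 f S \<longleftrightarrow> continuous_on S f"
| "Ck_on (Suc k) f S \<longleftrightarrow> f differentiable_on S \<and>
     (\<forall>i\<in>Basis. Ck_on k (\<lambda>x. frechet_derivative f (at x) i) S)"

definition bounded_domain :: "'a::euclidean_space set \<Rightarrow> bool" where
  "bounded_domain S \<longleftrightarrow> open S \<and> connected S \<and> S \<noteq> {} \<and> bounded S"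

text \<open>Near each boundary point, \<open>S\<close> is the sublevel set of a \<open>C\<^sup>k\<close> function with nonvanishing
  gradient, so that \<open>S\<close> lies locally on one side of its boundary.\<close>

definition Ck_boundary :: "nat \<Rightarrow> 'a::euclidean_space set \<Rightarrow> bool" where
  "Ck_boundary k S \<longleftrightarrow> (\<forall>p\<in>frontier S. \<exists>U \<rho>. open U \<and> p \<in> U \<and> Ck_on k \<rho> U \<and>
     (\<forall>x\<in>U. \<exists>i\<in>Basis. frechet_derivative \<rho> (at x) i \<noteq> 0) \<and>
     S \<inter> U = {x \<in> U. \<rho> x < 0})"

definition signed_distance :: "'a::euclidean_space set \<Rightarrow> 'a \<Rightarrow> real" where
  "signed_distance S x =
     (if x \<in> S then - infdist x (frontier S) else infdist x (frontier S))"

definition phase_field :: "real \<Rightarrow> 'a::euclidean_space set \<Rightarrow> 'a \<Rightarrow> real" where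
  "phase_field \<epsilon> S x = 1/2 * (1 - tanh (3 * signed_distance S x / \<epsilon>))"


section \<open>Weak derivatives and Sobolev spaces\<close>

definition test_functions :: "'a::euclidean_space set \<Rightarrow> ('a \<Rightarrow> real) set" where
  "test_functions B = {\<psi>. (\<forall>k. Ck_on k \<psi> UNIV) \<and>
     compact (closure {x. \<psi> x \<noteq> 0}) \<and> closure {x. \<psi> x \<noteq> 0} \<subseteq> B}"

definition locally_integrable ::
    "'a::euclidean_space set \<Rightarrow> ('a \<Rightarrow> 'b::euclidean_space) \<Rightarrow> bool" where
  "locally_integrable B f \<longleftrightarrow> (\<forall>K. compact K \<longrightarrow> K \<subseteq> B \<longrightarrow> integrable (lebesgue_on K) f)"

definition is_weak_grad ::
    "'a::euclidean_space set \<Rightarrow> ('a \<Rightarrow> real) \<Rightarrow> ('a \<Rightarrow> 'a) \<Rightarrow> bool" where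
  "is_weak_grad B f g \<longleftrightarrow> locally_integrable B f \<and> locally_integrable B g \<and>
     (\<forall>\<psi>\<in>test_functions B. \<forall>i\<in>Basis.
        (LINT x|lebesgue_on B. f x * frechet_derivative \<psi> (at x) i) =
        - (LINT x|lebesgue_on B. (g x \<bullet> i) * \<psi> x))"

text \<open>The weak gradient is unique up to null sets; \<open>weak_grad\<close> picks a representative and is
  unspecified if there is none.\<close>

definition weak_grad :: "'a::euclidean_space set \<Rightarrow> ('a \<Rightarrow> real) \<Rightarrow> 'a \<Rightarrow> 'a" where
  "weak_grad B f = (SOME g. is_weak_grad B f g)"

definition weak_div :: "'a::euclidean_space set \<Rightarrow> ('a \<Rightarrow> 'a) \<Rightarrow> 'a \<Rightarrow> real" where
  "weak_div B b x = (\<Sum>i\<in>Basis. weak_grad B (\<lambda>y. b y \<bullet> i) x \<bullet> i)"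

definition L2 :: "'a::euclidean_space set \<Rightarrow> ('a \<Rightarrow> 'b::euclidean_space) set" where
  "L2 B = {f. f \<in> borel_measurable (lebesgue_on B) \<and>
     integrable (lebesgue_on B) (\<lambda>x. (norm (f x))\<^sup>2)}"

definition Linf :: "'a::euclidean_space set \<Rightarrow> ('a \<Rightarrow> 'b::euclidean_space) set" where
  "Linf B = {f. f \<in> borel_measurable (lebesgue_on B) \<and>
     (\<exists>M. AE x in lebesgue_on B. norm (f x) \<le> M)}"

definition W1inf :: "'a::euclidean_space set \<Rightarrow> ('a \<Rightarrow> real) set" where
  "W1inf B = {f \<in> Linf B. \<exists>g \<in> Linf B. is_weak_grad B f g}"

definition H1 :: "'a::euclidean_space set \<Rightarrow> ('a \<Rightarrow> real) set" where
  "H1 B = {u \<in> L2 B. \<exists>g \<in> L2 B. is_weak_grad B u g}"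

definition H1_norm :: "'a::euclidean_space set \<Rightarrow> ('a \<Rightarrow> real) \<Rightarrow> real" where
  "H1_norm B u = sqrt (LINT x|lebesgue_on B. (u x)\<^sup>2 + (norm (weak_grad B u x))\<^sup>2)"

text \<open>The closure of the test functions in \<open>H1\<close>.\<close>

definition H10 :: "'a::euclidean_space set \<Rightarrow> ('a \<Rightarrow> real) set" where
  "H10 B = {u \<in> H1 B. \<exists>\<psi>. (\<forall>k. \<psi> k \<in> test_functions B) \<and>
     (\<lambda>k::nat. H1_norm B (\<lambda>x. \<psi> k x - u x)) \<longlonglongrightarrow> 0}"


section \<open>The bilinear form and the weighted norm\<close>

definition a_form ::
    "'a::euclidean_space set \<Rightarrow> real \<Rightarrow> ('a \<Rightarrow> real) \<Rightarrow> ('a \<Rightarrow> real) \<Rightarrow> ('a \<Rightarrow> 'a) \<Rightarrow> ('a \<Rightarrow> real)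
      \<Rightarrow> ('a \<Rightarrow> real) \<Rightarrow> ('a \<Rightarrow> real) \<Rightarrow> real" where
  "a_form B \<epsilon> \<phi> D b m u v = (LINT x|lebesgue_on B.
       D x * (weak_grad B (\<lambda>y. \<phi> y * u y) x \<bullet>
              (weak_grad B (\<lambda>y. \<phi> y * v y) x + v x *\<^sub>R weak_grad B \<phi> x))
     + D x / \<epsilon>\<^sup>2 * (1 - \<phi> x)\<^sup>2 * u x * v x
     + D x / 4 * (norm (weak_grad B \<phi> x))\<^sup>2 * u x * v x
     + \<phi> x * (b x \<bullet> weak_grad B (\<lambda>y. \<phi> y * u y) x) * v x
     + (\<phi> x)\<^sup>2 * m x * u x * v x)"

definition phase_norm ::
    "'a::euclidean_space set \<Rightarrow> real \<Rightarrow> ('a \<Rightarrow> real) \<Rightarrow> ('a \<Rightarrow> real) \<Rightarrow> real" where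
  "phase_norm B \<epsilon> \<phi> u = sqrt (LINT x|lebesgue_on B.
       (\<phi> x)\<^sup>2 * (norm (weak_grad B u x))\<^sup>2 + 1 / \<epsilon>\<^sup>2 * (1 - \<phi> x)\<^sup>2 * \<bar>u x\<bar>\<^sup>2)"

end

theory Submission
  imports Defs "HOL-Computational_Algebra.Polynomial"
begin

text \<open>
  Write \<open>w = \<phi> u\<close>, so that \<open>\<nabla>w = \<phi> \<nabla>u + u \<nabla>\<phi>\<close>. The term \<open>D/4 |\<nabla>\<phi>|\<^sup>2 u\<^sup>2\<close> completes a square and
  turns the diffusive part of \<open>a(u,u)\<close> into \<open>D |\<phi> \<nabla>u + 3/2 u \<nabla>\<phi>|\<^sup>2\<close>. Since \<open>|\<nabla>\<phi>| \<le> K (1 - \<phi>)\<close>, the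
  contribution of \<open>u \<nabla>\<phi>\<close> is absorbed by the term \<open>D/\<epsilon>\<^sup>2 (1 - \<phi>)\<^sup>2 u\<^sup>2\<close>. The convective part equals
  \<open>- 1/2 \<integral> (\<nabla>\<cdot>b) w\<^sup>2\<close> after integration by parts, so together with \<open>\<integral> m w\<^sup>2\<close> it is nonnegative.

  As \<open>\<phi>\<close> is merely Lipschitz, its weak gradient has to be constructed: the gradients of
  mollifications of \<open>\<phi>\<close> satisfy, up to vanishing errors, the pointwise bound and the product rule
  against every bounded weakly differentiable coefficient. These conditions cut out a decreasing
  sequence of convex sets of functions, and a minimising sequence for the \<open>L\<^sup>2\<close> norm along these
  sets converges almost everywhere to the weak gradient.
\<close>

section \<open>Smooth functions\<close>

text \<open>A Lipschitz constant alone bounds the gradient of \<open>\<phi>\<close> by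
  \<open>3 / \<epsilon>\<close>, which is useless deep inside the domain, where the weight
  \<open>1 - \<phi>\<close> is tiny. So the decay is carried as a local Lipschitz estimate: on a
  ball of radius \<open>\<delta>\<close> about \<open>z\<close> the constant is
  \<open>\<rho> z + L * \<delta>\<close>, with
  \<open>\<rho> = 6 / \<epsilon> * (1 - \<phi>)\<close>. Mollification respects it up to an error of
  order \<open>\<delta>\<close>, and the signed distance is never differentiated.

  Integrating the convective term by parts needs a weak derivative of
  \<open>b_i * \<phi> * \<phi>\<close>, although \<open>b_i\<close> and \<open>\<phi>\<close> are
  both merely bounded and weakly differentiable. Hence the product rule with \<open>\<phi>\<close>
  for arbitrary coefficients: it is applied twice, starting from \<open>b_i\<close>. All
  coefficients and all test functions are constraints of the same convex sets, so that a single
  limit serves them all.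

  Since \<open>weak_grad\<close> is a choice, explicit gradients can replace it only almost
  everywhere, which is what the fundamental lemma is for. Identities for members of
  \<open>H10\<close> are proved for test functions and passed to the limit in
  \<open>L2\<close>.\<close>

definition smooth :: "('a::euclidean_space \<Rightarrow> real) \<Rightarrow> bool" where
  "smooth f \<longleftrightarrow> (\<forall>k. Ck_on k f UNIV)"

lemma smoothD:
  assumes "smooth f"
  shows "f differentiable (at x)" "continuous_on UNIV f"
    and "i \<in> Basis \<Longrightarrow> smooth (\<lambda>x. frechet_derivative f (at x) i)"
proof -
  have "Ck_on (Suc 0) f UNIV" using assms unfolding smooth_def by blast
  then show "f differentiable (at x)" by (simp add: differentiable_on_def)
  have "Ck_on 0 f UNIV" using assms unfolding smooth_def by blast
  then show "continuous_on UNIV f" by simp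
  assume i: "i \<in> Basis"
  have "Ck_on (Suc k) f UNIV" for k using assms unfolding smooth_def by blast
  then show "smooth (\<lambda>x. frechet_derivative f (at x) i)"
    using i by (simp add: smooth_def)
qed

text \<open>A family closed under partial derivatives supplies derivatives of every order by
  induction on the order. It serves constants, flat exponentials and convolutions, whose derivatives
  stay in the family.\<close>

lemma smooth_coinduct:
  assumes "f \<in> \<Phi>"
    and "\<And>f x. f \<in> \<Phi> \<Longrightarrow> f differentiable (at x)"
    and "\<And>f i. f \<in> \<Phi> \<Longrightarrow> i \<in> Basis \<Longrightarrow> (\<lambda>x. frechet_derivative f (at x) i) \<in> \<Phi>"
  shows "smooth f"
proof -
  have "Ck_on k f UNIV" if "f \<in> \<Phi>" for k f
    using that
  proof (induction k arbitrary: f)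
    case 0
    then show ?case
      using assms(2) by (auto intro!: differentiable_imp_continuous_on simp: differentiable_on_def)
  next
    case (Suc k)
    then show ?case using assms(2,3) by (auto simp: differentiable_on_def)
  qed
  then show ?thesis using assms(1) by (auto simp: smooth_def)
qed

lemma Ck_on_Suc_imp_Ck_on: "Ck_on (Suc k) f UNIV \<Longrightarrow> Ck_on k f UNIV"
proof (induction k arbitrary: f)
  case 0
  then show ?case by (auto intro: differentiable_imp_continuous_on)
next
  case (Suc k)
  then show ?case by (metis Ck_on.simps(2))
qed

lemma Ck_on_add: "Ck_on k f UNIV \<Longrightarrow> Ck_on k g UNIV \<Longrightarrow> Ck_on k (\<lambda>x. f x + g x) UNIV"
proof (induction k arbitrary: f g)
  case 0
  then show ?case by (auto intro!: continuous_intros)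
next
  case (Suc k)
  then have d: "\<And>x. f differentiable (at x)" "\<And>x. g differentiable (at x)"
    by (auto simp: differentiable_on_def)
  have "frechet_derivative (\<lambda>x. f x + g x) (at x) =
      (\<lambda>h. frechet_derivative f (at x) h + frechet_derivative g (at x) h)" for x
    using d[of x] by (intro frechet_derivative_at[symmetric] has_derivative_add)
      (auto simp: frechet_derivative_works)
  then show ?case using Suc d by (auto simp: differentiable_on_def)
qed

lemma frechet_derivative_mult:
  fixes f g :: "'a::euclidean_space \<Rightarrow> real"
  assumes "f differentiable (at x)" "g differentiable (at x)"
  shows "frechet_derivative (\<lambda>x. f x * g x) (at x) =
      (\<lambda>h. f x * frechet_derivative g (at x) h + frechet_derivative f (at x) h * g x)"
  using assms by (intro frechet_derivative_at[symmetric] has_derivative_mult)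
      (auto simp: frechet_derivative_works)

lemma Ck_on_mult: "Ck_on k f UNIV \<Longrightarrow> Ck_on k g UNIV \<Longrightarrow> Ck_on k (\<lambda>x. f x * g x) UNIV"
proof (induction k arbitrary: f g)
  case 0
  then show ?case by (auto intro!: continuous_intros)
next
  case (Suc k)
  then have d: "\<And>x. f differentiable (at x)" "\<And>x. g differentiable (at x)"
    by (auto simp: differentiable_on_def)
  \<comment> \<open>The product rule pairs each derivative with an undifferentiated factor, which is
    therefore needed at order \<open>k\<close> as well.\<close>
  have "Ck_on k f UNIV" "Ck_on k g UNIV"
    using Suc.prems Ck_on_Suc_imp_Ck_on by blast+
  then show ?case using Suc d
    by (auto simp: differentiable_on_def frechet_derivative_mult[OF d] intro!: Ck_on_add)
qed

lemma smooth_const [simp]: "smooth (\<lambda>x. c)"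
  by (rule smooth_coinduct[where \<Phi> = "range (\<lambda>c x. c)"]) auto

lemma smooth_mult: "smooth f \<Longrightarrow> smooth g \<Longrightarrow> smooth (\<lambda>x. f x * g x)"
  by (simp add: smooth_def Ck_on_mult)

lemma smooth_prod: "(\<And>i. i \<in> I \<Longrightarrow> smooth (f i)) \<Longrightarrow> smooth (\<lambda>x. \<Prod>i\<in>I. f i x)"
  by (induction I rule: infinite_finite_induct) (auto intro: smooth_mult)

lemma frechet_derivative_sum_Basis:
  fixes f :: "'a::euclidean_space \<Rightarrow> real"
  assumes "f differentiable (at x)"
  shows "frechet_derivative f (at x) h = (\<Sum>i\<in>Basis. (h \<bullet> i) * frechet_derivative f (at x) i)"
proof -
  have l: "linear (frechet_derivative f (at x))"
    using assms by (rule linear_frechet_derivative)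
  have "frechet_derivative f (at x) h = frechet_derivative f (at x) (\<Sum>i\<in>Basis. (h \<bullet> i) *\<^sub>R i)"
    by (simp add: euclidean_representation)
  also have "\<dots> = (\<Sum>i\<in>Basis. (h \<bullet> i) * frechet_derivative f (at x) i)"
    by (simp add: linear_sum[OF l] linear_cmul[OF l])
  finally show ?thesis .
qed

text \<open>This family is closed under differentiation; \<open>p = 1\<close> is the usual smooth function vanishing
  on the negative half-line.\<close>

definition flat_exp :: "real poly \<Rightarrow> real \<Rightarrow> real" where
  "flat_exp p t = (if t > 0 then poly p (1/t) * exp (-1/t) else 0)"

text \<open>In the variable s = 1/t each monomial becomes s^n exp(-s), which vanishes at
  infinity.\<close>

lemma flat_exp_tendsto_0:
  "((\<lambda>t. flat_exp p t) \<longlongrightarrow> 0) (at_right 0)"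
proof -
  have "((\<lambda>t::real. (1/t)^n * exp (-(1/t))) \<longlongrightarrow> 0) (at_right 0)" for n
  proof -
    have "((\<lambda>s::real. s^n / exp s) \<longlongrightarrow> 0) at_top"
      by (rule tendsto_power_div_exp_0)
    then have "((\<lambda>s::real. s^n * exp (-s)) \<longlongrightarrow> 0) at_top"
      by (simp add: exp_minus divide_inverse)
    moreover have "filterlim (\<lambda>t::real. 1/t) at_top (at_right 0)"
      using filterlim_inverse_at_top_right by (simp add: inverse_eq_divide)
    ultimately show ?thesis by (rule filterlim_compose)
  qed
  then have "((\<lambda>t. \<Sum>n\<le>degree p. coeff p n * ((1/t)^n * exp (-(1/t)))) \<longlongrightarrow> (\<Sum>n\<le>degree p. coeff p n * 0)) (at_right 0)"
    by (intro tendsto_intros)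
  moreover have "\<forall>\<^sub>F t in at_right (0::real). (\<Sum>n\<le>degree p. coeff p n * ((1/t)^n * exp (-(1/t)))) = flat_exp p t"
    by (auto simp: eventually_at_right_less flat_exp_def poly_altdef sum_distrib_right mult.assoc
        intro!: eventually_mono[OF eventually_at_right_less[of 0]])
  ultimately show ?thesis
    by (simp add: filterlim_cong[OF refl refl])
qed

text \<open>With s = 1/t and ds/dt = -s^2, differentiating p(s) exp(-s) gives s^2 (p(s) - p'(s))
  exp(-s); the polynomial \<open>[:0,0,1:]\<close> is s^2.\<close>

lemma flat_exp_has_field_derivative:
  "(flat_exp p has_field_derivative flat_exp ([:0,0,1:] * (p - pderiv p)) t) (at t)"
proof -
  consider "t > 0" | "t < 0" | "t = 0" by linarith
  then show ?thesis
  proof cases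
    case 1
    have "((\<lambda>t. poly p (1/t) * exp (-1/t)) has_field_derivative flat_exp ([:0,0,1:] * (p - pderiv p)) t) (at t)"
      using 1 by (auto intro!: derivative_eq_intros poly_DERIV[THEN DERIV_chain2]
          simp: flat_exp_def field_simps power2_eq_square)
    then show ?thesis
      by (rule has_field_derivative_transform_within_open[of _ _ _ "{0<..}"])
        (use 1 in \<open>auto simp: flat_exp_def\<close>)
  next
    case 2
    have "((\<lambda>t. 0) has_field_derivative flat_exp ([:0,0,1:] * (p - pderiv p)) t) (at t)"
      using 2 by (simp add: flat_exp_def)
    then show ?thesis
      by (rule has_field_derivative_transform_within_open[of _ _ _ "{..<0}"])
        (use 2 in \<open>auto simp: flat_exp_def\<close>)
  next
    case 3
    \<comment> \<open>At 0 the difference quotient is again a flat exponential: dividing by t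
      multiplies the polynomial by s = 1/t.\<close>
    have r: "((\<lambda>t. flat_exp p t / t) \<longlongrightarrow> 0) (at_right 0)"
    proof -
      have "\<forall>\<^sub>F t in at_right (0::real). flat_exp ([:0,1:] * p) t = flat_exp p t / t"
        by (intro eventually_mono[OF eventually_at_right_less[of 0]]) (auto simp: flat_exp_def)
      then show ?thesis
        using flat_exp_tendsto_0[of "[:0,1:] * p"] by (rule Lim_transform_eventually[rotated])
    qed
    have l: "((\<lambda>t. flat_exp p t / t) \<longlongrightarrow> 0) (at_left 0)"
      by (rule Lim_transform_eventually[of "\<lambda>_. 0"])
        (auto simp: flat_exp_def eventually_at_left_field intro!: exI[of _ "-1"])
    show ?thesis
      using filterlim_split_at_real[OF l r] 3 by (simp add: has_field_derivative_iff flat_exp_def)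
  qed
qed

lemma smooth_flat_exp: "smooth (\<lambda>x. flat_exp p (x \<bullet> v + c))"
proof (rule smooth_coinduct[where \<Phi> = "range (\<lambda>p x. flat_exp p (x \<bullet> v + c))"])
  have D: "((\<lambda>x. flat_exp p (x \<bullet> v + c)) has_derivative
      (\<lambda>h. flat_exp ([:0,0,1:] * (p - pderiv p)) (x \<bullet> v + c) * (h \<bullet> v))) (at x)" for p x
  proof -
    have "((\<lambda>x. x \<bullet> v + c) has_derivative (\<lambda>h. h \<bullet> v)) (at x)"
      by (auto intro!: derivative_eq_intros)
    from has_derivative_compose[OF this flat_exp_has_field_derivative[unfolded has_field_derivative_def]]
    show ?thesis .
  qed
  fix f :: "'a \<Rightarrow> real" assume "f \<in> range (\<lambda>p x. flat_exp p (x \<bullet> v + c))"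
  then obtain p where f: "f = (\<lambda>x. flat_exp p (x \<bullet> v + c))" by auto
  show "f differentiable (at x)" for x
    unfolding f using D by (rule differentiableI)
  fix i :: 'a assume "i \<in> Basis"
  \<comment> \<open>The scalar from the chain rule is absorbed into the polynomial, which keeps the
    derivative inside the family.\<close>
  have "frechet_derivative f (at x) i = flat_exp (smult (i \<bullet> v) ([:0,0,1:] * (p - pderiv p))) (x \<bullet> v + c)" for x
    unfolding f frechet_derivative_at[OF D, symmetric] by (simp add: flat_exp_def)
  then show "(\<lambda>x. frechet_derivative f (at x) i) \<in> range (\<lambda>p x. flat_exp p (x \<bullet> v + c))"
    by auto
qed auto

text \<open>The arguments are \<open>k * (x \<bullet> i - a \<bullet> i)\<close> and
  \<open>k * (b \<bullet> i - x \<bullet> i)\<close>, written in the affine form of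
  \<open>smooth_flat_exp\<close>. For positive \<open>k\<close> the product is nonzero exactly on
  the open box; a growing \<open>k\<close> sharpens it towards the indicator, because exp(-1/(k c))
  tends to 1 for c > 0.\<close>

definition box_bump :: "'a::euclidean_space \<Rightarrow> 'a \<Rightarrow> real \<Rightarrow> 'a \<Rightarrow> real" where
  "box_bump a b k x = (\<Prod>i\<in>Basis. flat_exp 1 (x \<bullet> (k *\<^sub>R i) + (- k * (a \<bullet> i))) *
     flat_exp 1 (x \<bullet> (- k *\<^sub>R i) + k * (b \<bullet> i)))"

lemma smooth_box_bump: "smooth (box_bump a b k)"
  unfolding box_bump_def by (intro smooth_prod smooth_mult smooth_flat_exp)

lemma flat_exp_1_bounds: "0 \<le> flat_exp 1 t" "flat_exp 1 t \<le> 1" "flat_exp 1 t = 0 \<longleftrightarrow> t \<le> 0"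
  by (auto simp: flat_exp_def)

lemma box_bump_bounds: "0 \<le> box_bump a b k x" "box_bump a b k x \<le> 1"
  unfolding box_bump_def
  by (auto intro!: prod_nonneg prod_le_1 mult_le_one simp: flat_exp_1_bounds)

lemma box_bump_eq_0_iff: "k > 0 \<Longrightarrow> box_bump a b k x = 0 \<longleftrightarrow> x \<notin> box a b"
proof -
  assume k: "k > 0"
  have "x \<bullet> (k *\<^sub>R i) + (- k * (a \<bullet> i)) = k * (x \<bullet> i - a \<bullet> i)"
    "x \<bullet> (- k *\<^sub>R i) + k * (b \<bullet> i) = k * (b \<bullet> i - x \<bullet> i)" for i
    by (auto simp: algebra_simps)
  then show ?thesis using k
    by (auto simp: box_bump_def prod_zero_iff flat_exp_1_bounds mem_box mult_le_0_iff not_less not_le)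
qed

lemma box_bump_tendsto: "(\<lambda>n. box_bump a b (real n) x) \<longlonglongrightarrow> indicator (box a b) x"
proof (cases "x \<in> box a b")
  case False
  have "\<forall>\<^sub>F n in sequentially. box_bump a b (real n) x = 0"
    using eventually_gt_at_top[of 0] by eventually_elim (use False in \<open>simp add: box_bump_eq_0_iff\<close>)
  then show ?thesis using False by (simp add: tendsto_eventually)
next
  case True
  have lim: "(\<lambda>n. flat_exp 1 (real n * c)) \<longlonglongrightarrow> 1" if "c > 0" for c
  proof -
    have "(\<lambda>n. exp (-(1/c * (1 / real n)))) \<longlonglongrightarrow> exp (-(1/c * 0))"
      by (intro tendsto_intros lim_1_over_n)
    moreover have "\<forall>\<^sub>F n in sequentially. exp (-(1/c * (1 / real n))) = flat_exp 1 (real n * c)"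
      using eventually_gt_at_top[of 0]
      by eventually_elim (use that in \<open>simp add: flat_exp_def field_simps\<close>)
    ultimately show ?thesis by (simp add: Lim_transform_eventually)
  qed
  have eq: "x \<bullet> (real n *\<^sub>R i) + (- real n * (a \<bullet> i)) = real n * (x \<bullet> i - a \<bullet> i)"
    "x \<bullet> (- real n *\<^sub>R i) + real n * (b \<bullet> i) = real n * (b \<bullet> i - x \<bullet> i)" for i n
    by (auto simp: algebra_simps)
  have "(\<lambda>n. box_bump a b (real n) x) \<longlonglongrightarrow> (\<Prod>i\<in>(Basis::'a set). 1 * 1)"
    unfolding box_bump_def eq
    by (intro tendsto_prod tendsto_mult lim) (use True in \<open>auto simp: mem_box\<close>)
  then show ?thesis using True by simp
qed

section \<open>Test functions and the fundamental lemma\<close>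

lemma test_functions_iff:
  "\<psi> \<in> test_functions B \<longleftrightarrow> smooth \<psi> \<and> compact (closure {x. \<psi> x \<noteq> 0}) \<and> closure {x. \<psi> x \<noteq> 0} \<subseteq> B"
  by (simp add: test_functions_def smooth_def)

lemma test_functions_smooth: "\<psi> \<in> test_functions B \<Longrightarrow> smooth \<psi>"
  by (simp add: test_functions_iff)

lemma test_functions_zero: "\<psi> \<in> test_functions B \<Longrightarrow> x \<notin> B \<Longrightarrow> \<psi> x = 0"
  using closure_subset[of "{x. \<psi> x \<noteq> 0}"] by (auto simp: test_functions_iff)

lemma test_functions_support_subset:
  assumes "\<psi> \<in> test_functions B" "smooth \<eta>" "{x. \<eta> x \<noteq> 0} \<subseteq> closure {x. \<psi> x \<noteq> 0}"
  shows "\<eta> \<in> test_functions B"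
proof -
  have "closure {x. \<eta> x \<noteq> 0} \<subseteq> closure {x. \<psi> x \<noteq> 0}"
    using assms(3) by (simp add: closure_minimal)
  then show ?thesis
    using assms closed_closure compact_Int_closed[of "closure {x. \<psi> x \<noteq> 0}" "closure {x. \<eta> x \<noteq> 0}"]
    by (auto simp: test_functions_iff Int_absorb1)
qed

lemma test_functions_smooth_mult:
  assumes "\<psi> \<in> test_functions B" "smooth f"
  shows "(\<lambda>x. f x * \<psi> x) \<in> test_functions B"
  using assms(1)
  by (rule test_functions_support_subset)
    (use assms closure_subset[of "{x. \<psi> x \<noteq> 0}"] in \<open>auto intro: smooth_mult simp: test_functions_iff\<close>)

lemma test_functions_mult:
  "\<psi> \<in> test_functions B \<Longrightarrow> \<eta> \<in> test_functions B \<Longrightarrow> (\<lambda>x. \<eta> x * \<psi> x) \<in> test_functions B"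
  by (simp add: test_functions_smooth test_functions_smooth_mult)

lemma test_functions_partial:
  assumes "\<psi> \<in> test_functions B" "i \<in> Basis"
  shows "(\<lambda>x. frechet_derivative \<psi> (at x) i) \<in> test_functions B"
proof (rule test_functions_support_subset[OF assms(1)])
  show "smooth (\<lambda>x. frechet_derivative \<psi> (at x) i)"
    using assms by (simp add: test_functions_smooth smoothD)
  have "frechet_derivative \<psi> (at x) i = 0" if "x \<notin> closure {x. \<psi> x \<noteq> 0}" for x
  proof -
    \<comment> \<open>Off the closed support the function vanishes in a whole neighbourhood, hence
      so does its derivative.\<close>
    have "(\<psi> has_derivative (\<lambda>h. 0)) (at x)"
      by (rule has_derivative_transform_within_open[where f = "\<lambda>_. 0" and s = "- closure {x. \<psi> x \<noteq> 0}"])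
        (use that closure_subset[of "{x. \<psi> x \<noteq> 0}"] in auto)
    then show ?thesis by (simp add: frechet_derivative_at[symmetric])
  qed
  then show "{x. frechet_derivative \<psi> (at x) i \<noteq> 0} \<subseteq> closure {x. \<psi> x \<noteq> 0}" by blast
qed

lemma test_functions_UNIV: "\<psi> \<in> test_functions B \<Longrightarrow> \<psi> \<in> test_functions UNIV"
  by (simp add: test_functions_iff)

lemma box_bump_test:
  assumes "closure (box a b) \<subseteq> B" "k > 0"
  shows "box_bump a b k \<in> test_functions B"
  using assms by (simp add: test_functions_iff smooth_box_bump box_bump_eq_0_iff compact_closure bounded_box)

lemma test_functions_bounded:
  assumes "\<psi> \<in> test_functions B"
  obtains C where "C \<ge> 0" "\<And>x. \<bar>\<psi> x\<bar> \<le> C"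
proof -
  have "compact (\<psi> ` closure {x. \<psi> x \<noteq> 0})"
    using assms by (intro compact_continuous_image)
      (auto simp: test_functions_iff intro: continuous_on_subset[OF smoothD(2)])
  then obtain C where C: "\<And>x. x \<in> closure {x. \<psi> x \<noteq> 0} \<Longrightarrow> \<bar>\<psi> x\<bar> \<le> C" "C > 0"
    by (fastforce dest!: compact_imp_bounded simp: bounded_pos)
  have "\<bar>\<psi> x\<bar> \<le> C" for x
    using C closure_subset[of "{x. \<psi> x \<noteq> 0}"] by (cases "\<psi> x = 0") auto
  then show ?thesis using that[of C] C(2) by simp
qed

text \<open>The partial derivatives are test functions themselves, hence bounded; the sum of their
  bounds controls all directions, and the mean value inequality makes it a Lipschitz
  constant.\<close>

lemma test_functions_derivative_bounded:
  assumes "\<psi> \<in> test_functions B"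
  obtains C where "C \<ge> 0" "\<And>x h. \<bar>frechet_derivative \<psi> (at x) h\<bar> \<le> C * norm h"
    and "\<And>x y. \<bar>\<psi> x - \<psi> y\<bar> \<le> C * norm (x - y)"
proof -
  have "\<forall>i\<in>Basis. \<exists>C\<ge>0. \<forall>x. \<bar>frechet_derivative \<psi> (at x) i\<bar> \<le> C"
    using test_functions_bounded[OF test_functions_partial[OF assms]] by metis
  then obtain C where C: "\<And>i. i \<in> Basis \<Longrightarrow> C i \<ge> 0"
    "\<And>i x. i \<in> Basis \<Longrightarrow> \<bar>frechet_derivative \<psi> (at x) i\<bar> \<le> C i" by metis
  have d: "\<psi> differentiable (at x)" for x
    using assms test_functions_smooth smoothD(1) by blast
  have 1: "\<bar>frechet_derivative \<psi> (at x) h\<bar> \<le> (\<Sum>i\<in>Basis. C i) * norm h" for x h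
  proof -
    have "\<bar>frechet_derivative \<psi> (at x) h\<bar> \<le> (\<Sum>i\<in>Basis. \<bar>(h \<bullet> i) * frechet_derivative \<psi> (at x) i\<bar>)"
      by (subst frechet_derivative_sum_Basis[OF d]) (rule sum_abs)
    also have "\<dots> \<le> (\<Sum>i\<in>Basis. norm h * C i)"
      using C by (intro sum_mono) (auto simp: abs_mult Basis_le_norm intro!: mult_mono)
    finally show ?thesis by (simp add: sum_distrib_left mult.commute)
  qed
  have 2: "norm (\<psi> x - \<psi> y) \<le> (\<Sum>i\<in>Basis. C i) * norm (x - y)" for x y
    by (rule differentiable_bound[of UNIV \<psi> "\<lambda>x. frechet_derivative \<psi> (at x)"])
      (use d 1 in \<open>auto simp: frechet_derivative_works[symmetric] intro!: onorm_le\<close>)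
  show ?thesis using C 1 2 by (intro that[of "\<Sum>i\<in>Basis. C i"]) (auto intro: sum_nonneg)
qed

lemma test_functions_borel [measurable_dest]: "\<psi> \<in> test_functions B \<Longrightarrow> \<psi> \<in> borel_measurable borel"
  using test_functions_smooth smoothD(2) borel_measurable_continuous_onI by blast

lemma borel_imp_measurable_lebesgue_on:
  "f \<in> borel_measurable borel \<Longrightarrow> f \<in> borel_measurable (lebesgue_on S)"
  by (intro measurable_restrict_space1 measurable_completion) simp

lemma test_functions_measurable: "\<psi> \<in> test_functions B \<Longrightarrow> \<psi> \<in> borel_measurable (lebesgue_on S)"
  by (intro borel_imp_measurable_lebesgue_on test_functions_borel)

section \<open>Integrals of compactly supported functions and affine invariance of Lebesgue
  measure\<close>

lemma integral_lebesgue_on_cong_zero: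
  fixes f :: "'a::euclidean_space \<Rightarrow> 'b::euclidean_space"
  assumes "S \<in> sets lebesgue" "T \<in> sets lebesgue"
    and "\<And>x. x \<in> S - T \<Longrightarrow> f x = 0" "\<And>x. x \<in> T - S \<Longrightarrow> f x = 0"
  shows "(LINT x|lebesgue_on S. f x) = (LINT x|lebesgue_on T. f x)"
proof -
  have "(\<lambda>x. indicator S x *\<^sub>R f x) = (\<lambda>x. indicator T x *\<^sub>R f x)"
    using assms by (auto simp: fun_eq_iff indicator_def)
  then show ?thesis using assms by (simp add: integral_restrict_space)
qed

lemma integral_lebesgue_on_eq_lborel:
  fixes f :: "'a::euclidean_space \<Rightarrow> real"
  assumes "S \<in> sets lebesgue" "f \<in> borel_measurable borel" "\<And>x. x \<notin> S \<Longrightarrow> f x = 0"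
  shows "(LINT x|lebesgue_on S. f x) = (LINT x|lborel. f x)"
proof -
  have "(LINT x|lebesgue_on S. f x) = (LINT x|lebesgue_on UNIV. f x)"
    using assms by (intro integral_lebesgue_on_cong_zero) auto
  also have "\<dots> = (LINT x|lebesgue. f x)" by (simp add: integral_restrict_space)
  finally show ?thesis using assms by (simp add: integral_completion)
qed

text \<open>The case \<open>c = 1\<close> is translation invariance; \<open>c = -1\<close> is the
  reflection that swaps the two factors of a convolution.\<close>

lemma lborel_integral_affine:
  fixes f :: "'a::euclidean_space \<Rightarrow> real"
  assumes [measurable]: "f \<in> borel_measurable borel" and c: "\<bar>c\<bar> = 1"
  shows "(LINT x|lborel. f (t + c *\<^sub>R x)) = (LINT x|lborel. f x)"
proof -
  have "lborel = density (distr lborel borel (\<lambda>x::'a. t + c *\<^sub>R x)) (\<lambda>_. 1)"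
    using lborel_affine[of c t] c by auto
  then have "lborel = distr lborel borel (\<lambda>x::'a. t + c *\<^sub>R x)"
    by (simp add: density_1)
  then have "(LINT x|lborel. f x) = (LINT x|distr lborel borel (\<lambda>x. t + c *\<^sub>R x). f x)" by metis
  also have "\<dots> = (LINT x|lborel. f (t + c *\<^sub>R x))"
    by (subst integral_distr) auto
  finally show ?thesis by simp
qed

lemma test_functions_support_cball:
  assumes "\<psi> \<in> test_functions B"
  obtains R where "R > 0" "\<And>x. norm x > R \<Longrightarrow> \<psi> x = 0"
proof -
  have "bounded (closure {x. \<psi> x \<noteq> 0})"
    using assms by (auto simp: test_functions_iff compact_imp_bounded)
  then obtain R where "R > 0" "\<And>x. \<psi> x \<noteq> 0 \<Longrightarrow> norm x \<le> R"
    using closure_subset[of "{x. \<psi> x \<noteq> 0}"] unfolding bounded_pos by blast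
  then show ?thesis using that by (meson not_le)
qed

lemma test_functions_integrable:
  assumes "\<psi> \<in> test_functions B"
  shows "integrable lborel \<psi>"
proof -
  obtain R where R: "\<And>x. norm x > R \<Longrightarrow> \<psi> x = 0" using assms test_functions_support_cball by blast
  obtain C where C: "C \<ge> 0" "\<And>x. \<bar>\<psi> x\<bar> \<le> C" using assms test_functions_bounded by blast
  have "integrable lborel (\<lambda>x::'a. C * indicator (cball 0 R) x)"
    by (intro integrable_mult_right integrable_real_indicator) (auto simp: emeasure_lborel_cball_finite[simplified infinity_ennreal_def])
  then show ?thesis
    by (rule Bochner_Integration.integrable_bound)
      (use assms R C in \<open>auto simp: test_functions_borel indicator_def not_le\<close>)
qed

lemma directional_derivative_tendsto:
  fixes \<psi> :: "'a::euclidean_space \<Rightarrow> real"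
  assumes "\<psi> differentiable (at x)"
  shows "((\<lambda>t. (\<psi> (x + t *\<^sub>R i) - \<psi> x) / t) \<longlongrightarrow> frechet_derivative \<psi> (at x) i) (at 0)"
proof -
  have d: "(\<psi> has_derivative frechet_derivative \<psi> (at x)) (at x)"
    using assms by (simp only: frechet_derivative_works)
  have "((\<lambda>t. x + t *\<^sub>R i) has_derivative (\<lambda>t. t *\<^sub>R i)) (at 0)"
    by (auto intro!: derivative_eq_intros)
  from has_derivative_compose[OF this, of \<psi>] d
  have "((\<lambda>t. \<psi> (x + t *\<^sub>R i)) has_derivative (\<lambda>t. frechet_derivative \<psi> (at x) (t *\<^sub>R i))) (at 0)"
    by simp
  then have "((\<lambda>t. \<psi> (x + t *\<^sub>R i)) has_field_derivative frechet_derivative \<psi> (at x) i) (at 0)"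
    using linear_cmul[OF has_derivative_linear[OF d]]
    by (simp add: has_field_derivative_def mult_commute_abs)
  then show ?thesis by (simp add: has_field_derivative_iff)
qed

text \<open>Translation invariance makes the integral of every difference quotient vanish.\<close>

lemma integral_test_function_partial:
  assumes \<psi>: "\<psi> \<in> test_functions UNIV" and i: "i \<in> Basis"
  shows "(LINT x|lborel. frechet_derivative \<psi> (at x) i) = 0"
proof -
  obtain R where R: "R > 0" "\<And>x. norm x > R \<Longrightarrow> \<psi> x = 0" using \<psi> test_functions_support_cball by blast
  obtain C where C: "C \<ge> 0" "\<And>x y. \<bar>\<psi> x - \<psi> y\<bar> \<le> C * norm (x - y)"
    using \<psi> test_functions_derivative_bounded by metis
  have [measurable]: "\<psi> \<in> borel_measurable borel" "(\<lambda>x. frechet_derivative \<psi> (at x) i) \<in> borel_measurable borel"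
    using \<psi> test_functions_partial[OF \<psi> i] by (auto intro: test_functions_borel)
  have int: "integrable lborel (\<lambda>x. \<psi> (y + 1 *\<^sub>R x))" for y
    using lborel_integrable_real_affine test_functions_integrable[OF \<psi>]
    by (subst lborel_affine[of 1 "-y"]) (auto simp: density_1 integrable_distr_eq)
  \<comment> \<open>These are difference quotients with step 1/(n+1); their pointwise limit is the
    partial derivative.\<close>
  define s where "s n x = real (Suc n) * (\<psi> (x + (1 / real (Suc n)) *\<^sub>R i) - \<psi> x)" for n x
  have "(\<lambda>n. LINT x|lborel. s n x) \<longlonglongrightarrow> (LINT x|lborel. frechet_derivative \<psi> (at x) i)"
  proof (rule integral_dominated_convergence)
    \<comment> \<open>Steps have length at most 1, so every quotient vanishes outside the ball of
      radius \<open>R + 1\<close>; the Lipschitz constant bounds it inside.\<close>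
    show "integrable lborel (\<lambda>x::'a. C * indicator (cball 0 (R + 1)) x)"
      by (intro integrable_mult_right integrable_real_indicator) (auto simp: emeasure_lborel_cball_finite[simplified infinity_ennreal_def])
    show "AE x in lborel. (\<lambda>n. s n x) \<longlonglongrightarrow> frechet_derivative \<psi> (at x) i"
    proof (rule AE_I2)
      fix x
      have "((\<lambda>t. (\<psi> (x + t *\<^sub>R i) - \<psi> x) / t) \<longlongrightarrow> frechet_derivative \<psi> (at x) i) (at 0)"
        by (intro directional_derivative_tendsto smoothD(1) test_functions_smooth[OF \<psi>])
      moreover have "filterlim (\<lambda>n. 1 / real (Suc n)) (at 0) sequentially"
        unfolding filterlim_at using LIMSEQ_inverse_real_of_nat by (auto simp: inverse_eq_divide)
      ultimately have "(\<lambda>n. (\<psi> (x + (1 / real (Suc n)) *\<^sub>R i) - \<psi> x) / (1 / real (Suc n))) \<longlonglongrightarrow> frechet_derivative \<psi> (at x) i"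
        by (rule filterlim_compose)
      then show "(\<lambda>n. s n x) \<longlonglongrightarrow> frechet_derivative \<psi> (at x) i"
        by (simp add: s_def mult.commute del: of_nat_Suc)
    qed
    show "AE x in lborel. norm (s n x) \<le> C * indicator (cball 0 (R + 1)) x" for n
    proof (rule AE_I2)
      fix x
      let ?y = "x + (1 / real (Suc n)) *\<^sub>R i"
      have ni: "norm ((1 / real (Suc n)) *\<^sub>R i) = 1 / real (Suc n)" using i by simp
      have "\<bar>\<psi> ?y - \<psi> x\<bar> \<le> C * norm (?y - x)" by (rule C)
      then have "\<bar>\<psi> ?y - \<psi> x\<bar> \<le> C * (1 / real (Suc n))"
        using ni by simp
      then have "real (Suc n) * \<bar>\<psi> ?y - \<psi> x\<bar> \<le> C"
        by (simp add: pos_le_divide_eq mult.commute del: of_nat_Suc)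
      then have "norm (s n x) \<le> C"
        by (simp only: s_def real_norm_def abs_mult abs_of_nat)
      moreover have "s n x = 0" if "norm x > R + 1"
      proof -
        have "norm x \<le> norm ?y + norm ((1 / real (Suc n)) *\<^sub>R i)"
          using norm_triangle_ineq4[of ?y "(1 / real (Suc n)) *\<^sub>R i"] by simp
        moreover have "1 / real (Suc n) \<le> 1" by simp
        ultimately have "norm ?y > R" unfolding ni using that by linarith
        then show ?thesis using that R by (simp add: s_def)
      qed
      ultimately show "norm (s n x) \<le> C * indicator (cball 0 (R + 1)) x"
        by (auto simp: indicator_def not_le)
    qed
  qed (auto simp: s_def)
  moreover have "(LINT x|lborel. s n x) = 0" for n
  proof -
    let ?h = "(1 / real (Suc n)) *\<^sub>R i"
    have "(LINT x|lborel. \<psi> (x + ?h)) = (LINT x|lborel. \<psi> x)"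
      using lborel_integral_affine[of \<psi> 1 ?h] by (simp add: add.commute)
    moreover have "integrable lborel (\<lambda>x. \<psi> (x + ?h))"
      using int[of ?h] by (simp add: add.commute)
    ultimately show ?thesis
      unfolding s_def using test_functions_integrable[OF \<psi>] by simp
  qed
  ultimately show ?thesis by (simp add: LIMSEQ_const_iff)
qed

text \<open>Open boxes form an intersection-stable generator of the Borel sets, so a Dynkin argument
  extends the vanishing to Borel sets. A Lebesgue set is Borel up to a null set, and a density whose
  integral vanishes on all measurable sets is zero almost everywhere.\<close>

lemma integral_box_zero_imp_AE_zero:
  fixes h :: "'a::euclidean_space \<Rightarrow> real"
  assumes h: "integrable (lebesgue_on (cbox c d)) h"
    and box: "\<And>a b. box a b \<subseteq> box c d \<Longrightarrow> (LINT x|lebesgue_on (cbox c d). indicator (box a b) x * h x) = 0"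
  shows "AE x in lebesgue_on (cbox c d). h x = 0"
proof -
  let ?M = "lebesgue_on (cbox c d)"
  have [measurable]: "A \<inter> cbox c d \<in> sets ?M" if "A \<in> sets borel" for A
    using that by (subst sets_restrict_space_iff) auto
  have fr: "AE x in ?M. x \<in> box c d"
  proof -
    have "AE x in lebesgue. x \<notin> cbox c d - box c d"
      using negligible_frontier_interval negligible_iff_null_sets AE_not_in by blast
    then show ?thesis by (auto simp: AE_restrict_space_iff elim!: eventually_mono)
  qed
  have int: "integrable ?M (\<lambda>x. indicator A x * h x)" if "A \<in> sets borel" for A
  proof -
    have "integrable ?M (\<lambda>x. indicator (A \<inter> cbox c d) x *\<^sub>R h x)"
      using that by (intro integrable_mult_indicator h) auto
    then show ?thesis
      by (rule Bochner_Integration.integrable_cong[THEN iffD1, rotated 2]) (auto simp: indicator_def)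
  qed
  \<comment> \<open>The complement step of the Dynkin argument needs the integral over the whole
    closed box, whose boundary is negligible.\<close>
  have total: "(LINT x|?M. h x) = 0"
  proof -
    have "(LINT x|?M. h x) = (LINT x|?M. indicator (box c d) x * h x)"
      using h int[of "box c d"] fr
      by (intro integral_cong_AE) (auto simp: indicator_def elim!: eventually_mono)
    then show ?thesis using box[of c d] by simp
  qed
  have borel: "(LINT x|?M. indicator A x * h x) = 0" if "A \<in> sets borel" for A
  proof -
    have "Int_stable (range (\<lambda>(a, b). box a b :: 'a set))"
      by (auto simp: Int_stable_def box_Int_box)
    moreover have "range (\<lambda>(a, b). box a b :: 'a set) \<subseteq> Pow UNIV" by simp
    moreover have "A \<in> sigma_sets UNIV (range (\<lambda>(a, b). box a b :: 'a set))"
      using that borel_eq_box by (metis sets_measure_of top_greatest Pow_UNIV)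
    ultimately show ?thesis
    proof (induction rule: sigma_sets_induct_disjoint)
      case (basic A)
      then obtain a b where A: "A = box a b" by auto
      have "(LINT x|?M. indicator A x * h x) = (LINT x|?M. indicator (A \<inter> box c d) x * h x)"
        using int[of A] int[of "A \<inter> box c d"] A fr
        by (intro integral_cong_AE) (auto simp: indicator_def elim!: eventually_mono)
      \<comment> \<open>The coordinatewise maximum and minimum are the corners of the intersection
        with \<open>box c d\<close>, to which the hypothesis applies.\<close>
      also have "\<dots> = 0"
        using box[of "\<Sum>i\<in>Basis. max (a\<bullet>i) (c\<bullet>i) *\<^sub>R i" "\<Sum>i\<in>Basis. min (b\<bullet>i) (d\<bullet>i) *\<^sub>R i"]
        by (simp add: A flip: box_Int_box)
      finally show ?case .
    next
      case empty
      then show ?case by simp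
    next
      case (compl A)
      have A: "A \<in> sets borel"
        using compl(1) borel_eq_box by (metis sets_measure_of top_greatest Pow_UNIV)
      have "(LINT x|?M. indicator (UNIV - A) x * h x) = (LINT x|?M. h x - indicator A x * h x)"
        by (intro Bochner_Integration.integral_cong) (auto simp: indicator_def)
      also have "\<dots> = 0" using compl total int[OF A] h by simp
      finally show ?case .
    next
      case (union A)
      have A: "A i \<in> sets borel" for i
        using union(2) borel_eq_box by (metis sets_measure_of top_greatest Pow_UNIV range_subsetD)
      have eq: "(LINT x|?M. indicator B x * h x) = (LINT x:(B \<inter> cbox c d)|?M. h x)" for B
        unfolding set_lebesgue_integral_def by (intro Bochner_Integration.integral_cong) (auto simp: indicator_def)
      have "(LINT x:(\<Union>i. A i \<inter> cbox c d)|?M. h x) = (\<Sum>i. (LINT x:(A i \<inter> cbox c d)|?M. h x))"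
      proof (rule lebesgue_integral_countable_add)
        show "set_integrable ?M (\<Union>i. A i \<inter> cbox c d) h"
          unfolding set_integrable_def using A h
          by (intro integrable_mult_indicator sets.countable_UN) auto
      qed (use A union(1) in \<open>auto simp: disjoint_family_on_def\<close>)
      then show ?case unfolding eq using union(3) by (simp add: eq)
    qed
  qed
  show ?thesis
  proof (rule density_unique_real)
    fix A assume "A \<in> sets ?M"
    then have A: "A \<in> sets lebesgue" "A \<subseteq> cbox c d" by (auto simp: sets_restrict_space)
    \<comment> \<open>The F-sigma part is Borel, and the null part does not change the
      integral.\<close>
    obtain C T where C: "fsigma C" "T \<in> null_sets lebesgue" "C \<union> T = A" "disjnt C T"
      using lebesgue_set_almost_fsigma[OF A(1)] .
    have Cb: "C \<in> sets borel" using C(1) by (auto elim!: fsigma.cases)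
    have "AE x in lebesgue. x \<notin> T" using C(2) by (rule AE_not_in)
    then have "AE x in ?M. x \<notin> T" by (auto simp: AE_restrict_space_iff elim!: eventually_mono)
    then have "(LINT x|?M. indicator A x *\<^sub>R h x) = (LINT x|?M. indicator C x * h x)"
      using int[OF Cb] h \<open>A \<in> sets ?M\<close> C(3)
      by (intro integral_cong_AE) (auto simp: indicator_def elim!: eventually_mono)
    then show "(LINT x:A|?M. h x) = (LINT x:A|?M. 0)"
      using borel[OF Cb] by (simp add: set_lebesgue_integral_def)
  qed (use h in auto)
qed

text \<open>The product lives on the compact support of \<open>\<psi>\<close>, where
  \<open>h\<close> is integrable and \<open>\<psi>\<close> bounded; extension by zero then reaches
  \<open>B\<close>.\<close>

lemma locally_integrable_test_mult:
  fixes h :: "'a::euclidean_space \<Rightarrow> real"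
  assumes h: "locally_integrable B h" and \<psi>: "\<psi> \<in> test_functions B" and B: "B \<in> sets lebesgue"
  shows "integrable (lebesgue_on B) (\<lambda>x. h x * \<psi> x)"
proof -
  let ?K = "closure {x. \<psi> x \<noteq> 0}"
  have K: "compact ?K" "?K \<subseteq> B" using \<psi> by (auto simp: test_functions_iff)
  obtain C where C: "\<And>x. \<bar>\<psi> x\<bar> \<le> C" using \<psi> test_functions_bounded by metis
  have hK: "integrable (lebesgue_on ?K) h" using h K by (auto simp: locally_integrable_def)
  have "integrable (lebesgue_on ?K) (\<lambda>x. h x * \<psi> x)"
    by (rule Bochner_Integration.integrable_bound[of _ "\<lambda>x. C * h x"])
      (use hK test_functions_measurable[OF \<psi>] in
        \<open>auto simp: abs_mult mult.commute intro!: AE_I2 mult_right_mono order_trans[OF C abs_ge_self]\<close>)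
  then have "integrable lebesgue (\<lambda>x. indicator ?K x *\<^sub>R (h x * \<psi> x))"
    by (subst (asm) integrable_restrict_space) auto
  moreover have "(\<lambda>x. indicator ?K x *\<^sub>R (h x * \<psi> x)) = (\<lambda>x. indicator B x *\<^sub>R (h x * \<psi> x))"
    using closure_subset[of "{x. \<psi> x \<noteq> 0}"] K by (auto simp: indicator_def fun_eq_iff)
  ultimately show ?thesis using B by (subst integrable_restrict_space) auto
qed

text \<open>An open set is a countable union of closed boxes. In each of them, smooth bumps converge
  to indicators of open subboxes, and dominated convergence carries the hypothesis over to these
  indicators.\<close>

lemma fundamental_lemma:
  fixes h :: "'a::euclidean_space \<Rightarrow> real"
  assumes B: "open B" and h: "locally_integrable B h"
    and z: "\<And>\<psi>. \<psi> \<in> test_functions B \<Longrightarrow> (LINT x|lebesgue_on B. h x * \<psi> x) = 0"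
  shows "AE x in lebesgue_on B. h x = 0"
proof -
  have Bs: "B \<in> sets lebesgue" using B by simp
  obtain \<D> where D: "countable \<D>" "\<D> \<subseteq> Pow B" "\<And>X. X \<in> \<D> \<Longrightarrow> \<exists>a b. X = cbox a b" "\<Union>\<D> = B"
    using open_countable_Union_open_cbox[OF B] by metis
  have "AE x in lebesgue. x \<in> X \<longrightarrow> h x = 0" if X: "X \<in> \<D>" for X
  proof -
    obtain c d where cd: "X = cbox c d" using D(3) X by metis
    have XB: "cbox c d \<subseteq> B" using D(2) X cd by auto
    let ?M = "lebesgue_on (cbox c d)"
    have hX: "integrable ?M h" using h XB by (auto simp: locally_integrable_def)
    have "AE x in ?M. h x = 0"
    proof (rule integral_box_zero_imp_AE_zero[OF hX])
      fix a b assume ab: "box a b \<subseteq> box c d"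
      \<comment> \<open>The subbox may touch the boundary of \<open>cbox c d\<close>, but its
        closure still lies in \<open>B\<close>, which is all that makes its bumps test functions on
        \<open>B\<close>.\<close>
      have cl: "closure (box a b) \<subseteq> B"
        using ab XB box_subset_cbox[of c d] closure_minimal[of "box a b" "cbox c d"] by auto
      have "(\<lambda>n. LINT x|?M. box_bump a b (real (Suc n)) x * h x) \<longlonglongrightarrow> (LINT x|?M. indicator (box a b) x * h x)"
      proof (rule integral_dominated_convergence)
        show "integrable ?M (\<lambda>x. \<bar>h x\<bar>)" using hX by simp
        show "(\<lambda>x. box_bump a b (real (Suc n)) x * h x) \<in> borel_measurable ?M" for n
          using hX by (intro borel_measurable_times test_functions_measurable[OF box_bump_test[OF cl]] borel_measurable_integrable) auto
        show "(\<lambda>x. indicator (box a b) x * h x) \<in> borel_measurable ?M"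
          using borel_measurable_integrable[OF hX]
          by (intro borel_measurable_times[OF borel_imp_measurable_lebesgue_on]) auto
        show "AE x in ?M. norm (box_bump a b (real (Suc n)) x * h x) \<le> \<bar>h x\<bar>" for n
          by (auto simp: abs_mult box_bump_bounds intro!: mult_left_le_one_le)
        show "AE x in ?M. (\<lambda>n. box_bump a b (real (Suc n)) x * h x) \<longlonglongrightarrow> indicator (box a b) x * h x"
          by (intro AE_I2 tendsto_mult tendsto_const LIMSEQ_Suc[OF box_bump_tendsto])
      qed
      moreover have "(LINT x|?M. box_bump a b (real (Suc n)) x * h x) = 0" for n
      proof -
        have "(LINT x|?M. box_bump a b (real (Suc n)) x * h x) = (LINT x|lebesgue_on B. box_bump a b (real (Suc n)) x * h x)"
          using XB ab box_subset_cbox[of c d] Bs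
          by (intro integral_lebesgue_on_cong_zero) (auto simp: box_bump_eq_0_iff)
        then show ?thesis using z[OF box_bump_test[OF cl, of "real (Suc n)"]] by (simp add: mult.commute)
      qed
      ultimately show "(LINT x|?M. indicator (box a b) x * h x) = 0"
        by (simp add: LIMSEQ_const_iff)
    qed
    then show ?thesis by (simp add: AE_restrict_space_iff cd)
  qed
  then have "AE x in lebesgue. \<forall>X\<in>\<D>. x \<in> X \<longrightarrow> h x = 0"
    by (intro AE_ball_countable' D(1))
  then show ?thesis
    using Bs D(4) by (auto simp: AE_restrict_space_iff elim!: eventually_mono)
qed

section \<open>Uniqueness of weak gradients\<close>

lemma locally_integrable_inner:
  "locally_integrable B g \<Longrightarrow> locally_integrable B (\<lambda>x. g x \<bullet> i)"
  by (simp add: locally_integrable_def)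

lemma is_weak_grad_unique:
  fixes f :: "'a::euclidean_space \<Rightarrow> real"
  assumes B: "open B" and g: "is_weak_grad B f g" and g': "is_weak_grad B f g'"
  shows "AE x in lebesgue_on B. g x = g' x"
proof -
  have Bs: "B \<in> sets lebesgue" using B by simp
  have "AE x in lebesgue_on B. g x \<bullet> i = g' x \<bullet> i" if i: "i \<in> Basis" for i
  proof -
    have l: "locally_integrable B (\<lambda>x. g x \<bullet> i)" "locally_integrable B (\<lambda>x. g' x \<bullet> i)"
      using g g' by (auto simp: is_weak_grad_def locally_integrable_inner)
    have "AE x in lebesgue_on B. g x \<bullet> i - g' x \<bullet> i = 0"
    proof (rule fundamental_lemma[OF B])
      show "locally_integrable B (\<lambda>x. g x \<bullet> i - g' x \<bullet> i)"
        using l by (simp add: locally_integrable_def)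
      fix \<psi> assume \<psi>: "\<psi> \<in> test_functions B"
      have "(LINT x|lebesgue_on B. (g x \<bullet> i) * \<psi> x) = (LINT x|lebesgue_on B. (g' x \<bullet> i) * \<psi> x)"
        using g g' \<psi> i by (force simp: is_weak_grad_def)
      then show "(LINT x|lebesgue_on B. (g x \<bullet> i - g' x \<bullet> i) * \<psi> x) = 0"
        using locally_integrable_test_mult[OF l(1) \<psi> Bs] locally_integrable_test_mult[OF l(2) \<psi> Bs]
        by (simp add: left_diff_distrib)
    qed
    then show ?thesis by simp
  qed
  then have "AE x in lebesgue_on B. \<forall>i\<in>Basis. g x \<bullet> i = g' x \<bullet> i"
    by (intro AE_finite_allI) auto
  then show ?thesis by eventually_elim (rule euclidean_eqI, blast)
qed

text \<open>This is the bridge from the chosen representative to explicit candidates: once any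
  candidate is verified, \<open>weak_grad\<close> is a weak gradient and agrees with it almost
  everywhere.\<close>

lemma weak_grad_AE_eq:
  assumes "open B" "is_weak_grad B f g"
  shows "is_weak_grad B f (weak_grad B f)" "AE x in lebesgue_on B. weak_grad B f x = g x"
proof -
  show *: "is_weak_grad B f (weak_grad B f)"
    unfolding weak_grad_def by (rule someI[of "is_weak_grad B f", OF assms(2)])
  show "AE x in lebesgue_on B. weak_grad B f x = g x"
    using is_weak_grad_unique[OF assms(1) * assms(2)] .
qed

section \<open>Mollification\<close>

definition convol :: "('a::euclidean_space \<Rightarrow> real) \<Rightarrow> ('a \<Rightarrow> real) \<Rightarrow> 'a \<Rightarrow> real" where
  "convol F \<eta> x = (LINT y|lborel. F y * \<eta> (x - y))"

lemma integrable_mult_bounded: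
  fixes F :: "'a \<Rightarrow> real"
  assumes F: "integrable M F" and g: "g \<in> borel_measurable M" and b: "\<And>y. \<bar>g y\<bar> \<le> C"
  shows "integrable M (\<lambda>y. F y * g y)"
proof (rule Bochner_Integration.integrable_bound)
  show "integrable M (\<lambda>y. C * F y)" using F by simp
  show "(\<lambda>y. F y * g y) \<in> borel_measurable M" using F g by simp
  have "\<bar>F y * g y\<bar> \<le> \<bar>C * F y\<bar>" for y
    using mult_right_mono[OF b[of y], of "\<bar>F y\<bar>"] order_trans[OF abs_ge_zero b[of y]]
    by (simp add: abs_mult mult.commute)
  then show "AE y in M. norm (F y * g y) \<le> norm (C * F y)" by simp
qed

text \<open>Differentiation under the integral sign, with all smoothness taken from the kernel. The
  remainder quotients of the kernel are uniformly bounded and tend to 0 pointwise, so dominated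
  convergence applies along any sequence approaching \<open>x\<close>.\<close>

lemma convol_has_derivative:
  fixes F :: "'a::euclidean_space \<Rightarrow> real"
  assumes F: "integrable lborel F" and \<eta>: "\<eta> \<in> test_functions UNIV"
  shows "(convol F \<eta> has_derivative
     (\<lambda>h. LINT y|lborel. F y * frechet_derivative \<eta> (at (x - y)) h)) (at x)"
proof -
  let ?D = "\<lambda>z. frechet_derivative \<eta> (at z)"
  have diff: "\<eta> differentiable (at z)" for z
    using \<eta> test_functions_smooth smoothD(1) by blast
  obtain C where C: "C \<ge> 0" "\<And>z h. \<bar>?D z h\<bar> \<le> C * norm h" "\<And>y z. \<bar>\<eta> y - \<eta> z\<bar> \<le> C * norm (y - z)"
    using test_functions_derivative_bounded[OF \<eta>] by metis
  obtain C0 where C0: "\<And>z. \<bar>\<eta> z\<bar> \<le> C0" using test_functions_bounded[OF \<eta>] by metis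
  have [measurable]: "F \<in> borel_measurable borel" using F by auto
  have [measurable]: "\<eta> \<in> borel_measurable borel" using \<eta> by (rule test_functions_borel)
  have "(\<lambda>z. ?D z h) = (\<lambda>z. \<Sum>i\<in>Basis. (h \<bullet> i) * ?D z i)" for h
    using frechet_derivative_sum_Basis[OF diff] by blast
  moreover have "(\<lambda>z. \<Sum>i\<in>Basis. (h \<bullet> i) * ?D z i) \<in> borel_measurable borel" for h
    using test_functions_borel[OF test_functions_partial[OF \<eta>]]
    by (intro borel_measurable_sum borel_measurable_times) auto
  ultimately have [measurable]: "(\<lambda>z. ?D z h) \<in> borel_measurable borel" for h by simp
  have i1: "integrable lborel (\<lambda>y. F y * \<eta> (z - y))" for z
    by (rule integrable_mult_bounded[OF F]) (use C0 in auto)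
  have i2: "integrable lborel (\<lambda>y. F y * ?D (z - y) h)" for z h
    by (rule integrable_mult_bounded[OF F]) (use C in auto)
  have lin: "linear (?D z)" for z using diff by (rule linear_frechet_derivative)
  let ?f' = "\<lambda>h. LINT y|lborel. F y * ?D (x - y) h"
  have "linear ?f'"
    by (rule linearI) (auto simp: linear_add[OF lin] linear_cmul[OF lin] i2 ring_distribs mult.left_commute)
  then have bl: "bounded_linear ?f'" by (simp add: linear_conv_bounded_linear)
  have "((\<lambda>z. norm ((convol F \<eta> z - convol F \<eta> x) - ?f' (z - x)) / norm (z - x)) \<longlongrightarrow> 0) (at x)"
    unfolding tendsto_at_iff_sequentially comp_def
  proof (intro allI impI)
    fix X assume X: "\<forall>i. X i \<in> UNIV - {x}" "X \<longlonglongrightarrow> x"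
    define s where "s n y = \<bar>F y\<bar> * (\<bar>\<eta> (X n - y) - \<eta> (x - y) - ?D (x - y) (X n - x)\<bar> / norm (X n - x))" for n y
    \<comment> \<open>One \<open>C\<close> comes from the Lipschitz bound on the increment, the
      other from the bound on the linear term.\<close>
    have bnd: "\<bar>\<eta> (X n - y) - \<eta> (x - y) - ?D (x - y) (X n - x)\<bar> / norm (X n - x) \<le> 2 * C" for n y
    proof -
      have "\<bar>\<eta> (X n - y) - \<eta> (x - y) - ?D (x - y) (X n - x)\<bar> \<le> C * norm (X n - x) + C * norm (X n - x)"
        using C(2)[of "x - y" "X n - x"] C(3)[of "X n - y" "x - y"] by simp
      moreover have "norm (X n - x) > 0" using X by auto
      ultimately show ?thesis by (simp add: divide_le_eq algebra_simps)
    qed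
    have sm [measurable]: "s n \<in> borel_measurable lborel" for n unfolding s_def by measurable
    have si: "integrable lborel (s n)" for n
      unfolding s_def by (rule integrable_mult_bounded[of _ _ _ "2 * C"]) (use F bnd in auto)
    have "(\<lambda>n. LINT y|lborel. s n y) \<longlonglongrightarrow> integral\<^sup>L lborel (\<lambda>y::'a. 0::real)"
    proof (rule integral_dominated_convergence)
      show "integrable lborel (\<lambda>y. \<bar>F y\<bar> * (2 * C))" using F by simp
      show "AE y in lborel. norm (s n y) \<le> \<bar>F y\<bar> * (2 * C)" for n
        using mult_left_mono[OF bnd, of "\<bar>F _\<bar>"] by (auto simp: s_def abs_mult intro!: AE_I2)
      show "AE y in lborel. (\<lambda>n. s n y) \<longlonglongrightarrow> 0"
      proof (rule AE_I2)
        fix y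
        have "((\<lambda>z. norm (\<eta> z - \<eta> (x - y) - ?D (x - y) (z - (x - y))) / norm (z - (x - y))) \<longlongrightarrow> 0) (at (x - y))"
          using diff[of "x - y"] by (simp add: frechet_derivative_works has_derivative_iff_norm)
        moreover have "(\<lambda>n. X n - y) \<longlonglongrightarrow> x - y" using X by (intro tendsto_intros)
        moreover have "\<forall>n. X n - y \<in> UNIV - {x - y}" using X by auto
        ultimately have "(\<lambda>n. norm (\<eta> (X n - y) - \<eta> (x - y) - ?D (x - y) (X n - y - (x - y))) / norm (X n - y - (x - y))) \<longlonglongrightarrow> 0"
          unfolding tendsto_at_iff_sequentially comp_def
          by (auto dest!: spec[of _ "\<lambda>n. X n - y"])
        then have "(\<lambda>n. \<bar>F y\<bar> * (norm (\<eta> (X n - y) - \<eta> (x - y) - ?D (x - y) (X n - x)) / norm (X n - x))) \<longlonglongrightarrow> \<bar>F y\<bar> * 0"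
          by (intro tendsto_mult tendsto_const) simp
        then show "(\<lambda>n. s n y) \<longlonglongrightarrow> 0" by (simp add: s_def)
      qed
    qed (auto intro: sm)
    then have lim: "(\<lambda>n. LINT y|lborel. s n y) \<longlonglongrightarrow> 0" by simp
    have le: "norm ((convol F \<eta> (X n) - convol F \<eta> x) - ?f' (X n - x)) / norm (X n - x) \<le> (LINT y|lborel. s n y)" for n
    proof -
      have pos: "norm (X n - x) > 0" using X by auto
      let ?g = "\<lambda>y. F y * (\<eta> (X n - y) - \<eta> (x - y) - ?D (x - y) (X n - x))"
      have "(convol F \<eta> (X n) - convol F \<eta> x) - ?f' (X n - x) = (LINT y|lborel. ?g y)"
        unfolding convol_def using i1 i2 by (simp add: right_diff_distrib)
      moreover have "(LINT y|lborel. norm (?g y)) = (LINT y|lborel. norm (X n - x) * s n y)"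
        using pos by (intro Bochner_Integration.integral_cong) (auto simp: s_def abs_mult)
      then have "norm (LINT y|lborel. ?g y) \<le> norm (X n - x) * (LINT y|lborel. s n y)"
        using integral_norm_bound[of lborel ?g] by (simp only: integral_mult_right_zero)
      ultimately show ?thesis using pos by (simp only: pos_divide_le_eq mult.commute)
    qed
    show "(\<lambda>n. norm ((convol F \<eta> (X n) - convol F \<eta> x) - ?f' (X n - x)) / norm (X n - x)) \<longlonglongrightarrow> 0"
      by (rule tendsto_sandwich[OF _ _ tendsto_const lim]) (use le in auto)
  qed
  then show ?thesis using bl by (simp add: has_derivative_iff_norm)
qed

text \<open>Each derivative falls on the kernel and produces another test function, so the
  convolutions of \<open>F\<close> with all test functions form a closed family.\<close>

lemma smooth_convol:
  fixes F :: "'a::euclidean_space \<Rightarrow> real"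
  assumes F: "integrable lborel F" and \<eta>: "\<eta> \<in> test_functions UNIV"
  shows "smooth (convol F \<eta>)"
proof (rule smooth_coinduct[where \<Phi> = "convol F ` test_functions UNIV"])
  fix f assume "f \<in> convol F ` test_functions UNIV"
  then obtain \<eta> where \<eta>: "\<eta> \<in> test_functions UNIV" and f: "f = convol F \<eta>" by auto
  note D = convol_has_derivative[OF F \<eta>, folded f]
  show "f differentiable (at x)" for x using D by (rule differentiableI)
  fix i :: 'a assume i: "i \<in> Basis"
  have "(\<lambda>x. frechet_derivative f (at x) i) = convol F (\<lambda>x. frechet_derivative \<eta> (at x) i)"
    by (simp add: frechet_derivative_at[OF D, symmetric] convol_def fun_eq_iff)
  then show "(\<lambda>x. frechet_derivative f (at x) i) \<in> convol F ` test_functions UNIV"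
    using test_functions_partial[OF \<eta> i] by blast
qed (use \<eta> in auto)

lemma mollifier_exists:
  assumes "\<delta> > 0"
  obtains \<eta> :: "'a::euclidean_space \<Rightarrow> real" where "\<eta> \<in> test_functions UNIV" "\<And>x. \<eta> x \<ge> 0"
    "(LINT x|lborel. \<eta> x) = 1" "\<And>x. \<eta> x \<noteq> 0 \<Longrightarrow> norm x \<le> \<delta>"
proof -
  \<comment> \<open>A box of half-side \<open>\<delta> / DIM('a)\<close> has l1-radius
    \<open>\<delta>\<close>, hence lies in the Euclidean ball of that radius.\<close>
  define c where "c = \<delta> / real DIM('a)"
  have c: "c > 0" using assms by (simp add: c_def)
  define \<beta> where "\<beta> = box_bump (- c *\<^sub>R One) (c *\<^sub>R One :: 'a) 1"
  have t: "\<beta> \<in> test_functions UNIV" unfolding \<beta>_def by (rule box_bump_test) auto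
  have nz: "\<beta> x \<noteq> 0 \<longleftrightarrow> x \<in> box (- c *\<^sub>R One) (c *\<^sub>R One)" for x
    by (simp add: \<beta>_def box_bump_eq_0_iff)
  have nn: "\<beta> x \<ge> 0" for x by (simp add: \<beta>_def box_bump_bounds)
  have small: "norm x \<le> \<delta>" if "\<beta> x \<noteq> 0" for x
  proof -
    have "\<bar>x \<bullet> i\<bar> \<le> c" if "i \<in> Basis" for i
      using \<open>\<beta> x \<noteq> 0\<close> that unfolding nz mem_box by (force simp: abs_le_iff)
    then have "(\<Sum>i\<in>Basis. \<bar>x \<bullet> i\<bar>) \<le> (\<Sum>i\<in>(Basis::'a set). c)" by (intro sum_mono)
    then show ?thesis using norm_le_l1[of x] by (simp add: c_def)
  qed
  let ?I = "LINT x|lborel. \<beta> x"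
  have "?I \<noteq> 0"
  proof
    assume "?I = 0"
    then have "AE x in lborel. \<beta> x = 0"
      using integral_nonneg_eq_0_iff_AE[OF test_functions_integrable[OF t]] nn by simp
    then have "AE x in lborel. x \<notin> box (- c *\<^sub>R One) (c *\<^sub>R One :: 'a)"
      using nz by auto
    then have "emeasure lborel (box (- c *\<^sub>R One) (c *\<^sub>R One :: 'a)) = 0"
      by (subst (asm) AE_iff_measurable[OF _ refl]) (auto simp: Collect_mem_eq)
    moreover have "(\<Prod>i\<in>Basis. (c *\<^sub>R One - (- c *\<^sub>R One) :: 'a) \<bullet> i) = (\<Prod>i\<in>(Basis::'a set). 2 * c)"
      by (intro prod.cong) (auto simp: inner_diff_left inner_add_left)
    then have "emeasure lborel (box (- c *\<^sub>R One) (c *\<^sub>R One :: 'a)) = (2 * c) ^ DIM('a)"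
      using c by (subst emeasure_lborel_box) auto
    ultimately show False using c by simp
  qed
  then have I: "?I > 0" using nn by (simp add: order.not_eq_order_implies_strict integral_nonneg_AE)
  show ?thesis
  proof
    show "(\<lambda>x. (1 / ?I) * \<beta> x) \<in> test_functions UNIV"
      by (rule test_functions_smooth_mult[OF t]) simp
  qed (use I nn small in auto)
qed

text \<open>Averaging does not increase Lipschitz constants, and the average near \<open>x\<close>
  sees \<open>f\<close> only near \<open>x\<close>. The last conclusion is therefore local:
  \<open>M\<close> may depend on the point. The radius is doubled because both the increment and the
  kernel may move the argument by \<open>\<delta>\<close>.\<close>

lemma mollify_Lipschitz:
  fixes f :: "'a::euclidean_space \<Rightarrow> real"
  assumes S: "bounded S" and lip: "\<And>x y. \<bar>f x - f y\<bar> \<le> L * norm (x - y)" and \<delta>: "\<delta> > 0"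
  obtains f\<delta> where "smooth f\<delta>" "\<And>x. x \<in> S \<Longrightarrow> \<bar>f\<delta> x - f x\<bar> \<le> L * \<delta>"
    "\<And>x M i. x \<in> S \<Longrightarrow> i \<in> Basis \<Longrightarrow>
       (\<And>y z. y \<in> cball x (2*\<delta>) \<Longrightarrow> z \<in> cball x (2*\<delta>) \<Longrightarrow> \<bar>f y - f z\<bar> \<le> M * norm (y - z)) \<Longrightarrow>
       \<bar>frechet_derivative f\<delta> (at x) i\<bar> \<le> M"
proof -
  obtain \<eta> :: "'a \<Rightarrow> real" where \<eta>: "\<eta> \<in> test_functions UNIV" "\<And>x. \<eta> x \<ge> 0"
    "(LINT x|lborel. \<eta> x) = 1" "\<And>x. \<eta> x \<noteq> 0 \<Longrightarrow> norm x \<le> \<delta>"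
    using mollifier_exists[OF \<delta>] by metis
  have L: "L \<ge> 0" using lip[of "SOME i. i \<in> Basis" 0] norm_some_Basis[where 'a='a] by simp
  obtain R where R: "\<And>x. x \<in> S \<Longrightarrow> norm x \<le> R" using S by (auto simp: bounded_iff)
  have cont: "continuous_on UNIV f"
  proof (rule lipschitz_on_continuous_on)
    show "L-lipschitz_on UNIV f"
      by (rule lipschitz_onI) (use lip L in \<open>auto simp: dist_norm\<close>)
  qed
  then have [measurable]: "f \<in> borel_measurable borel" by (rule borel_measurable_continuous_onI)
  have [measurable]: "\<eta> \<in> borel_measurable borel" using \<eta>(1) by (rule test_functions_borel)
  \<comment> \<open>The cut-off makes \<open>f\<close> integrable. Its radius leaves
    \<open>f\<close> unchanged wherever the kernel reaches from points at distance at most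
    \<open>\<delta>\<close> from \<open>S\<close>.\<close>
  define F where "F = (\<lambda>y. indicator (cball 0 (R + 2 * \<delta>)) y *\<^sub>R f y)"
  have F: "integrable lborel F"
    unfolding F_def by (rule borel_integrable_compact) (use cont continuous_on_subset in auto)
  have [measurable]: "F \<in> borel_measurable borel" using F by auto
  define g where "g = convol F \<eta>"
  \<comment> \<open>Reflecting the integration variable moves the shift from the kernel to
    \<open>f\<close>, where the Lipschitz bound can be used.\<close>
  have g: "g z = (LINT y|lborel. f (z - y) * \<eta> y)" if "norm z \<le> R + \<delta>" for z
  proof -
    have "g z = (LINT y|lborel. F (z + (-1) *\<^sub>R y) * \<eta> (z - (z + (-1) *\<^sub>R y)))"
      unfolding g_def convol_def
      by (rule lborel_integral_affine[symmetric]) auto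
    also have "\<dots> = (LINT y|lborel. f (z - y) * \<eta> y)"
    proof (rule Bochner_Integration.integral_cong)
      fix y
      have "norm (z - y) \<le> R + 2 * \<delta>" if "\<eta> y \<noteq> 0"
        using \<eta>(4)[OF that] \<open>norm z \<le> R + \<delta>\<close> norm_triangle_ineq4[of z y] by linarith
      then show "F (z + (-1) *\<^sub>R y) * \<eta> (z - (z + (-1) *\<^sub>R y)) = f (z - y) * \<eta> y"
        by (auto simp: F_def indicator_def)
    qed simp
    finally show ?thesis .
  qed
  have int: "integrable lborel (\<lambda>y. f (z - y) * \<eta> y)" for z
  proof (rule Bochner_Integration.integrable_bound)
    show "integrable lborel (\<lambda>y. (\<bar>f z\<bar> + L * \<delta>) * \<eta> y)"
      using test_functions_integrable[OF \<eta>(1)] by simp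
    have "\<bar>f (z - y)\<bar> * \<eta> y \<le> (\<bar>f z\<bar> + L * \<delta>) * \<eta> y" for y
    proof (cases "\<eta> y = 0")
      case False
      have "\<bar>f (z - y) - f z\<bar> \<le> L * norm y" using lip[of "z - y" z] by simp
      also have "\<dots> \<le> L * \<delta>" using \<eta>(4)[OF False] L by (rule mult_left_mono)
      finally show ?thesis using \<eta>(2)[of y] by (intro mult_right_mono) auto
    qed simp
    then show "AE y in lborel. norm (f (z - y) * \<eta> y) \<le> norm ((\<bar>f z\<bar> + L * \<delta>) * \<eta> y)"
      using \<eta>(2) L \<delta> by (auto simp: abs_mult)
  qed simp
  \<comment> \<open>The kernel is a probability density supported in the
    \<open>\<delta>\<close>-ball. If the product is not integrable, its integral is 0 by convention,
    and \<open>A\<close> is nonnegative.\<close>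
  have est: "\<bar>LINT y|lborel. h y * \<eta> y\<bar> \<le> A"
    if h: "\<And>y. norm y \<le> \<delta> \<Longrightarrow> \<bar>h y\<bar> \<le> A" for h A
  proof (cases "integrable lborel (\<lambda>y. h y * \<eta> y)")
    case False
    have "0 \<le> A" using h[of 0] \<delta> by fastforce
    then show ?thesis using not_integrable_integral_eq[OF False] by simp
  next
    case True
    have "\<bar>LINT y|lborel. h y * \<eta> y\<bar> \<le> (LINT y|lborel. \<bar>h y * \<eta> y\<bar>)" by (rule integral_abs_bound)
    also have "\<dots> \<le> (LINT y|lborel. A * \<eta> y)"
    proof (rule integral_mono)
      fix y
      show "\<bar>h y * \<eta> y\<bar> \<le> A * \<eta> y"
        using h[of y] \<eta>(2)[of y] \<eta>(4)[of y] by (cases "\<eta> y = 0") (auto simp: abs_mult)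
    qed (use True test_functions_integrable[OF \<eta>(1)] in auto)
    also have "\<dots> = A" using \<eta>(3) by simp
    finally show ?thesis .
  qed
  have sg: "smooth g" unfolding g_def using F \<eta>(1) by (rule smooth_convol)
  show ?thesis
  proof
    show "smooth g" by (rule sg)
  next
    fix x assume x: "x \<in> S"
    have "g x - f x = (LINT y|lborel. f (x - y) * \<eta> y) - (LINT y|lborel. f x * \<eta> y)"
      using g[of x] R[OF x] \<delta> \<eta>(3) by simp
    also have "\<dots> = (LINT y|lborel. (f (x - y) - f x) * \<eta> y)"
      using int[of x] test_functions_integrable[OF \<eta>(1)] by (simp add: left_diff_distrib)
    also have "\<bar>\<dots>\<bar> \<le> L * \<delta>"
    proof (rule est)
      fix y :: 'a assume "norm y \<le> \<delta>"
      then show "\<bar>f (x - y) - f x\<bar> \<le> L * \<delta>"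
        using lip[of "x - y" x] mult_left_mono[OF _ L, of "norm y" \<delta>] by simp
    qed
    finally show "\<bar>g x - f x\<bar> \<le> L * \<delta>" .
  next
    fix x M and i :: 'a
    assume x: "x \<in> S" and i: "i \<in> Basis"
      and M: "\<And>y z. y \<in> cball x (2*\<delta>) \<Longrightarrow> z \<in> cball x (2*\<delta>) \<Longrightarrow> \<bar>f y - f z\<bar> \<le> M * norm (y - z)"
    \<comment> \<open>Both shifted points stay within \<open>2 * \<delta>\<close> of
      \<open>x\<close>, and the shift cancels in their difference.\<close>
    have loc: "\<bar>g z - g x\<bar> \<le> M * norm (z - x)" if z: "norm (z - x) \<le> \<delta>" for z
    proof -
      have "norm z \<le> R + \<delta>" using R[OF x] z norm_triangle_sub[of z x] by linarith
      then have "g z - g x = (LINT y|lborel. (f (z - y) - f (x - y)) * \<eta> y)"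
        using g[of z] g[of x] R[OF x] \<delta> int[of x] int[of z] by (simp add: left_diff_distrib)
      also have "\<bar>\<dots>\<bar> \<le> M * norm (z - x)"
      proof (rule est)
        fix y :: 'a assume y: "norm y \<le> \<delta>"
        have "norm (x - (z - y)) \<le> norm (z - x) + norm y"
          using norm_triangle_ineq4[of y "z - x"] by (simp add: algebra_simps)
        then have "z - y \<in> cball x (2*\<delta>)" "x - y \<in> cball x (2*\<delta>)"
          using y z \<delta> by (auto simp: dist_norm)
        from M[OF this] show "\<bar>f (z - y) - f (x - y)\<bar> \<le> M * norm (z - x)" by simp
      qed
      finally show ?thesis .
    qed
    have lim: "((\<lambda>t. (g (x + t *\<^sub>R i) - g x) / t) \<longlongrightarrow> frechet_derivative g (at x) i) (at 0)"
      by (intro directional_derivative_tendsto smoothD(1) sg)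
    have "\<forall>\<^sub>F t in at (0::real). \<bar>t\<bar> \<le> \<delta>"
      using \<delta> by (auto simp: eventually_at dist_norm intro!: exI[of _ \<delta>])
    moreover have "\<forall>\<^sub>F t in at (0::real). t \<noteq> 0" by (simp add: eventually_at_filter)
    ultimately have "\<forall>\<^sub>F t in at 0. norm ((g (x + t *\<^sub>R i) - g x) / t) \<le> M"
    proof eventually_elim
      case (elim t)
      have "\<bar>g (x + t *\<^sub>R i) - g x\<bar> \<le> M * \<bar>t\<bar>" using loc[of "x + t *\<^sub>R i"] i elim by simp
      then show ?case using elim by (simp add: divide_le_eq)
    qed
    from tendsto_upperbound[OF tendsto_norm[OF lim] this] show "\<bar>frechet_derivative g (at x) i\<bar> \<le> M"
      by simp
  qed
qed

section \<open>Limits along decreasing convex sets\<close>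

text \<open>A substitute for weak sequential compactness: almost minimisers of the \<open>L\<^sup>2\<close> norm over
  the sets form a Cauchy sequence by the parallelogram law.\<close>

lemma (in finite_measure) convex_sets_AE_limit:
  fixes C :: "nat \<Rightarrow> ('a \<Rightarrow> real) set"
  assumes ne: "\<And>n. C n \<noteq> {}" and dec: "\<And>n. C (Suc n) \<subseteq> C n"
    and meas: "\<And>p. p \<in> C 0 \<Longrightarrow> p \<in> borel_measurable M"
    and bd: "\<And>p x. p \<in> C 0 \<Longrightarrow> x \<in> space M \<Longrightarrow> \<bar>p x\<bar> \<le> L"
    and mid: "\<And>n p q. p \<in> C n \<Longrightarrow> q \<in> C n \<Longrightarrow> (\<lambda>x. (p x + q x) / 2) \<in> C n"
  obtains p g where "\<And>n. p n \<in> C n" "g \<in> borel_measurable M" "AE x in M. (\<lambda>n. p n x) \<longlonglongrightarrow> g x"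
proof -
  have mono: "C n \<subseteq> C m" if "m \<le> n" for m n
    using dec that by (rule lift_Suc_antimono_le)
  have C0: "p \<in> C 0" if "p \<in> C n" for p n using mono[of 0 n] that by auto
  have int: "integrable M (\<lambda>x. p x * q x)" if "p \<in> C 0" "q \<in> C 0" for p q
  proof (rule integrable_const_bound)
    show "AE x in M. norm (p x * q x) \<le> L * L"
      using bd[OF that(1)] bd[OF that(2)] by (auto simp: abs_mult intro!: AE_I2 mult_mono')
    show "(\<lambda>x. p x * q x) \<in> borel_measurable M" using meas that by simp
  qed
  define N :: "('a \<Rightarrow> real) \<Rightarrow> real" where "N p = (\<integral>x. p x * p x \<partial>M)" for p
  define a where "a n = Inf (N ` C n)" for n
  have N0: "N p \<ge> 0" for p unfolding N_def by (intro integral_nonneg_AE) auto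
  have bb: "bdd_below (N ` X)" for X using N0 by (auto intro!: bdd_belowI[of _ 0])
  have a_le: "a n \<le> N p" if "p \<in> C n" for n p
    unfolding a_def using bb that by (auto intro: cInf_lower)
  have "incseq a"
    unfolding incseq_Suc_iff a_def using dec ne bb by (intro allI cInf_superset_mono) auto
  moreover have "a n \<le> L * L * measure M (space M)" for n
  proof -
    obtain p where p: "p \<in> C n" using ne by auto
    have "N p \<le> (\<integral>x. L * L \<partial>M)"
      unfolding N_def
    proof (rule integral_mono)
      show "p x * p x \<le> L * L" if "x \<in> space M" for x
        using bd[OF C0[OF p] that] by (metis abs_ge_zero abs_mult_self_eq mult_mono')
    qed (use int C0 p in auto)
    then show ?thesis using a_le[OF p] by (simp add: mult.commute)
  qed
  ultimately obtain \<alpha> where \<alpha>: "a \<longlonglongrightarrow> \<alpha>" "\<And>n. a n \<le> \<alpha>"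
    using incseq_convergent by metis
  \<comment> \<open>Square-norm errors of order 16^(-n) make the L1 norms of the increments of order
    4^(-n), which is summable.\<close>
  define e where "e n = (1/16::real) ^ n" for n
  have e: "e n > 0" "e (Suc n) \<le> e n" for n by (auto simp: e_def)
  \<comment> \<open>The infima increase to \<open>\<alpha>\<close>, so a late set has its infimum
    within \<open>e n\<close> of \<open>\<alpha>\<close> and contains an element just as close from
    above.\<close>
  have "\<exists>s p. s \<ge> n \<and> \<alpha> - a s < e n \<and> p \<in> C s \<and> N p < \<alpha> + e n" for n
  proof -
    have "\<forall>\<^sub>F s in sequentially. a s > \<alpha> - e n"
      using order_tendstoD(1)[OF \<alpha>(1)] e by simp
    then obtain s where s: "s \<ge> n" "a s > \<alpha> - e n"
      by (metis eventually_at_top_linorder max.cobounded1 max.cobounded2)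
    have "Inf (N ` C s) < \<alpha> + e n" using \<alpha>(2)[of s] e[of n] by (simp add: a_def)
    then obtain p where "p \<in> C s" "N p < \<alpha> + e n"
      using cInf_lessD[of "N ` C s"] ne by auto
    then show ?thesis using s by (intro exI[of _ s] exI[of _ p]) auto
  qed
  then obtain s p where sp: "\<And>n. s n \<ge> n" "\<And>n. \<alpha> - a (s n) < e n" "\<And>n. p n \<in> C (s n)" "\<And>n. N (p n) < \<alpha> + e n"
    by metis
  have p0: "p n \<in> C 0" for n using C0 sp(3) by blast
  have [measurable]: "p n \<in> borel_measurable M" for n using meas p0 by blast
  let ?d = "\<lambda>n x. p (Suc n) x - p n x"
  have dint: "integrable M (\<lambda>x. ?d n x * ?d n x)" for n
    using int[OF p0 p0] by (simp add: algebra_simps)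
  have dsq: "(\<integral>x. ?d n x * ?d n x \<partial>M) \<le> 8 * e n" for n
  proof -
    \<comment> \<open>The indices \<open>s n\<close> need not increase; the earlier of the two sets
      contains both elements and hence their midpoint.\<close>
    define r where "r = min (s n) (s (Suc n))"
    have ar: "a r > \<alpha> - e n" using sp(2)[of n] sp(2)[of "Suc n"] e(2)[of n] by (auto simp: r_def min_def)
    define m where "m = (\<lambda>x. (p n x + p (Suc n) x) / 2)"
    have m: "m \<in> C r"
      using sp(3)[of n] sp(3)[of "Suc n"] mono[of r "s n"] mono[of r "s (Suc n)"]
      unfolding m_def by (intro mid) (auto simp: r_def)
    \<comment> \<open>Parallelogram law: the midpoint has square norm above
      \<open>\<alpha> - e n\<close>, while both ends lie below
      \<open>\<alpha> + e n\<close>.\<close>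
    have "(\<integral>x. ?d n x * ?d n x \<partial>M) = (\<integral>x. 2 * (p n x * p n x) + 2 * (p (Suc n) x * p (Suc n) x) - 4 * (m x * m x) \<partial>M)"
      by (intro Bochner_Integration.integral_cong) (auto simp: m_def field_simps)
    also have "\<dots> = 2 * N (p n) + 2 * N (p (Suc n)) - 4 * N m"
      unfolding N_def using int[OF p0 p0] int[OF C0[OF m] C0[OF m]] by simp
    finally show ?thesis
      using a_le[OF m] ar sp(4)[of n] sp(4)[of "Suc n"] e(2)[of n] by linarith
  qed
  have dabs: "integrable M (\<lambda>x. \<bar>?d n x\<bar>)" for n
  proof (rule integrable_const_bound[of _ "2 * L"])
    show "AE x in M. norm \<bar>?d n x\<bar> \<le> 2 * L"
      using bd[OF p0[of n]] bd[OF p0[of "Suc n"]] by (intro AE_I2) force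
  qed auto
  have d1: "(\<integral>x. \<bar>?d n x\<bar> \<partial>M) \<le> (4 + measure M (space M)) * (1/4) ^ n" for n
  proof -
    have "(\<integral>x. \<bar>?d n x\<bar> \<partial>M) \<le> (\<integral>x. (4 ^ n * (?d n x * ?d n x) + (1/4) ^ n) / 2 \<partial>M)"
    proof (rule integral_mono)
      fix x
      \<comment> \<open>Weighted arithmetic-geometric inequality, whose weights balance the two
        resulting terms at order 4^(-n).\<close>
      have "0 \<le> (2 ^ n * \<bar>?d n x\<bar> - (1/2) ^ n)\<^sup>2" by simp
      also have "\<dots> = 4 ^ n * (?d n x * ?d n x) + (1/4) ^ n - 2 * \<bar>?d n x\<bar>"
      proof -
        have "(2::real) ^ n * 2 ^ n = 4 ^ n" "(1/2::real) ^ n * (1/2) ^ n = (1/4) ^ n"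
          "(2::real) ^ n * (1/2) ^ n = 1" by (simp_all flip: power_mult_distrib)
        moreover have "(A * D - B)\<^sup>2 = (A * A) * (D * D) + B * B - 2 * (A * B) * D" for A B D :: real
          by (simp add: power2_eq_square algebra_simps)
        ultimately show ?thesis by simp
      qed
      finally show "\<bar>?d n x\<bar> \<le> (4 ^ n * (?d n x * ?d n x) + (1/4) ^ n) / 2" by simp
    qed (use dint dabs in auto)
    also have "\<dots> = (4 ^ n * (\<integral>x. ?d n x * ?d n x \<partial>M) + (1/4) ^ n * measure M (space M)) / 2"
      using dint by simp
    also have "\<dots> \<le> (4 ^ n * (8 * e n) + (1/4) ^ n * measure M (space M)) / 2"
      using dsq[of n] by (intro divide_right_mono add_right_mono mult_left_mono) auto
    also have "4 ^ n * (8 * e n) = 8 * (1/4) ^ n"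
      unfolding e_def by (simp flip: power_mult_distrib)
    finally have "(\<integral>x. \<bar>?d n x\<bar> \<partial>M) \<le> (8 * (1/4) ^ n + (1/4) ^ n * measure M (space M)) / 2" .
    moreover have "(8 * q + q * u) / 2 \<le> (4 + u) * q" if "q \<ge> 0" "u \<ge> 0" for q u :: real
      using mult_nonneg_nonneg[OF that] by (simp add: field_simps)
    ultimately show ?thesis by (rule order_trans) (auto intro: measure_nonneg)
  qed
  \<comment> \<open>The L1 norms of the increments are summable, so the increments themselves are
    absolutely summable at almost every point and the partial sums telescope to a convergent
    sequence.\<close>
  have "AE x in M. (\<Sum>n. ennreal \<bar>?d n x\<bar>) \<noteq> \<infinity>"
  proof (rule nn_integral_PInf_AE)
    have "(\<integral>\<^sup>+x. (\<Sum>n. ennreal \<bar>?d n x\<bar>) \<partial>M) = (\<Sum>n. ennreal (\<integral>x. \<bar>?d n x\<bar> \<partial>M))"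
      by (subst nn_integral_suminf) (auto simp: nn_integral_eq_integral[OF dabs])
    also have "\<dots> \<le> (\<Sum>n. ennreal ((4 + measure M (space M)) * (1/4) ^ n))"
      using d1 by (intro suminf_le ennreal_leI) auto
    also have "\<dots> < \<infinity>"
      by (subst suminf_ennreal2) (auto intro!: summable_mult summable_geometric)
    finally show "(\<integral>\<^sup>+x. (\<Sum>n. ennreal \<bar>?d n x\<bar>) \<partial>M) \<noteq> \<infinity>" by simp
  qed simp
  then have "AE x in M. (\<lambda>n. p n x) \<longlonglongrightarrow> lim (\<lambda>n. p n x)"
  proof eventually_elim
    case (elim x)
    have "summable (\<lambda>n. \<bar>?d n x\<bar>)"
      using elim by (intro summable_suminf_not_top) auto
    then have "convergent (\<lambda>n. \<Sum>k<n. ?d k x)"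
      using summable_rabs_cancel summable_iff_convergent by blast
    then have "convergent (\<lambda>n. p n x - p 0 x)"
      using sum_lessThan_telescope[of "\<lambda>n. p n x"] by simp
    then have "convergent (\<lambda>n. p n x)" by (simp add: convergent_diff_const_right_iff)
    then show ?case by (simp add: convergent_LIMSEQ_iff)
  qed
  moreover have "(\<lambda>x. lim (\<lambda>n. p n x)) \<in> borel_measurable M" by measurable
  moreover have "p n \<in> C n" for n using mono[OF sp(1)] sp(3) by blast
  ultimately show ?thesis using that by blast
qed

section \<open>Weak derivatives of Lipschitz functions\<close>

lemma Linf_bound:
  assumes "f \<in> Linf B"
  obtains M where "M \<ge> 0" "AE x in lebesgue_on B. norm (f x) \<le> M"
proof -
  obtain M where "AE x in lebesgue_on B. norm (f x) \<le> M" using assms by (auto simp: Linf_def)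
  then have "AE x in lebesgue_on B. norm (f x) \<le> max 0 M" by eventually_elim simp
  then show ?thesis by (intro that[of "max 0 M"]) auto
qed

lemma Linf_measurable: "f \<in> Linf B \<Longrightarrow> f \<in> borel_measurable (lebesgue_on B)"
  by (simp add: Linf_def)

lemma LinfI_bounded:
  "f \<in> borel_measurable (lebesgue_on B) \<Longrightarrow> (\<And>x. x \<in> B \<Longrightarrow> norm (f x) \<le> M) \<Longrightarrow> f \<in> Linf B"
  unfolding Linf_def by (auto intro!: exI[of _ M])

lemma Linf_mult:
  fixes f g :: "'a::euclidean_space \<Rightarrow> real"
  assumes "f \<in> Linf B" "g \<in> Linf B"
  shows "(\<lambda>x. f x * g x) \<in> Linf B"
proof -
  obtain M where "AE x in lebesgue_on B. norm (f x) \<le> M" using assms Linf_bound by blast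
  moreover obtain N where "AE x in lebesgue_on B. norm (g x) \<le> N" using assms Linf_bound by blast
  ultimately have "AE x in lebesgue_on B. norm (f x * g x) \<le> M * N"
    by eventually_elim (auto simp: abs_mult intro: mult_mono')
  then show ?thesis using assms by (auto simp: Linf_def)
qed

lemma Linf_add:
  fixes f g :: "'a::euclidean_space \<Rightarrow> 'b::euclidean_space"
  assumes "f \<in> Linf B" "g \<in> Linf B"
  shows "(\<lambda>x. f x + g x) \<in> Linf B"
proof -
  obtain M where "AE x in lebesgue_on B. norm (f x) \<le> M" using assms Linf_bound by blast
  moreover obtain N where "AE x in lebesgue_on B. norm (g x) \<le> N" using assms Linf_bound by blast
  ultimately have "AE x in lebesgue_on B. norm (f x + g x) \<le> M + N"
    by eventually_elim (rule norm_triangle_mono)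
  then show ?thesis using assms by (auto simp: Linf_def)
qed

lemma Linf_test: "\<psi> \<in> test_functions S \<Longrightarrow> \<psi> \<in> Linf B"
  using test_functions_bounded[of \<psi> S] test_functions_measurable[of \<psi> S B]
  by (metis LinfI_bounded real_norm_def)

lemma Linf_test_partial:
  "\<psi> \<in> test_functions S \<Longrightarrow> i \<in> Basis \<Longrightarrow> (\<lambda>x. frechet_derivative \<psi> (at x) i) \<in> Linf B"
  by (rule Linf_test[OF test_functions_partial])

text \<open>One direction and an explicit bounded derivative: in this form the product rule is an
  implication between pairs and can be iterated without appeal to a chosen gradient.\<close>

definition weak_partial ::
    "'a::euclidean_space set \<Rightarrow> 'a \<Rightarrow> ('a \<Rightarrow> real) \<Rightarrow> ('a \<Rightarrow> real) \<Rightarrow> bool" where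
  "weak_partial B i \<beta> \<gamma> \<longleftrightarrow> \<beta> \<in> Linf B \<and> \<gamma> \<in> Linf B \<and>
     (\<forall>\<eta>\<in>test_functions B. (LINT x|lebesgue_on B. \<beta> x * frechet_derivative \<eta> (at x) i) =
        - (LINT x|lebesgue_on B. \<gamma> x * \<eta> x))"

locale bounded_open_set =
  fixes B :: "'a::euclidean_space set"
  assumes open_B: "open B" and bounded_B: "bounded B"
begin

sublocale finite_measure "lebesgue_on B"
  by (intro finite_measure_lebesgue_on lmeasurable_open open_B bounded_B)

lemma sets_B: "B \<in> sets lebesgue"
  using open_B by simp

lemma Linf_integrable:
  fixes f :: "'a \<Rightarrow> real"
  assumes "f \<in> Linf B"
  shows "integrable (lebesgue_on B) f"
  using assms integrable_const_bound unfolding Linf_def by blast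

lemma Linf_const: "(\<lambda>x. c) \<in> Linf B"
  by (rule LinfI_bounded[of _ _ "norm c"]) auto

text \<open>The integral of a partial derivative of a test function vanishes. The coefficient 1 is
  the seed of the product rule: applied to it, the rule says that the other factor is itself weakly
  differentiable.\<close>

lemma weak_partial_const:
  assumes "i \<in> Basis"
  shows "weak_partial B i (\<lambda>x. c) (\<lambda>x. 0)"
  unfolding weak_partial_def
proof (intro conjI ballI Linf_const)
  fix \<eta> assume \<eta>: "\<eta> \<in> test_functions B"
  have "(LINT x|lebesgue_on B. frechet_derivative \<eta> (at x) i) = (LINT x|lborel. frechet_derivative \<eta> (at x) i)"
    using test_functions_partial[OF \<eta> assms]
    by (intro integral_lebesgue_on_eq_lborel sets_B) (auto intro: test_functions_borel test_functions_zero)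
  also have "\<dots> = 0"
    using test_functions_UNIV[OF \<eta>] assms by (rule integral_test_function_partial)
  finally show "(LINT x|lebesgue_on B. c * frechet_derivative \<eta> (at x) i) = - (LINT x|lebesgue_on B. 0 * \<eta> x)"
    by simp
qed

text \<open>The product rule holds for smooth approximations of \<open>f\<close>, whose derivatives lie in
  a decreasing sequence of convex sets.\<close>

lemma Lipschitz_weak_partial:
  fixes f \<rho> :: "'a \<Rightarrow> real"
  assumes i: "i \<in> Basis" and bd: "\<And>x. \<bar>f x\<bar> \<le> A"
    and lip: "\<And>x y. \<bar>f x - f y\<bar> \<le> L * norm (x - y)"
    and loc: "\<And>z \<delta> x y. \<delta> > 0 \<Longrightarrow> x \<in> cball z \<delta> \<Longrightarrow> y \<in> cball z \<delta> \<Longrightarrow>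
      \<bar>f x - f y\<bar> \<le> (\<rho> z + L * \<delta>) * norm (x - y)"
    and \<rho>: "\<And>x. \<rho> x \<le> R"
  obtains g where "g \<in> borel_measurable (lebesgue_on B)" "AE x in lebesgue_on B. \<bar>g x\<bar> \<le> \<rho> x"
    "\<And>\<beta> \<gamma>. weak_partial B i \<beta> \<gamma> \<Longrightarrow> weak_partial B i (\<lambda>x. \<beta> x * f x) (\<lambda>x. \<gamma> x * f x + \<beta> x * g x)"
proof -
  let ?M = "lebesgue_on B"
  have L: "L \<ge> 0" using lip[of i 0] i by simp
  have f: "f \<in> Linf B"
  proof (rule LinfI_bounded)
    have "L-lipschitz_on UNIV f"
      by (rule lipschitz_onI) (use lip L in \<open>auto simp: dist_norm\<close>)
    then show "f \<in> borel_measurable ?M"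
      by (intro borel_imp_measurable_lebesgue_on borel_measurable_continuous_onI lipschitz_on_continuous_on)
  qed (use bd in auto)
  \<comment> \<open>The product rule for \<open>g\<close> says exactly that the integral of
    \<open>\<beta> * g * \<eta>\<close> plus \<open>K \<beta> \<gamma> \<eta>\<close> is 0;
    \<open>E\<close> measures the admissible defect.\<close>
  define K where "K \<beta> \<gamma> \<eta> = (LINT x|?M. \<gamma> x * f x * \<eta> x) + (LINT x|?M. \<beta> x * f x * frechet_derivative \<eta> (at x) i)" for \<beta> \<gamma> \<eta>
  define E where "E \<beta> \<gamma> \<eta> = L * ((LINT x|?M. \<bar>\<gamma> x * \<eta> x\<bar>) + (LINT x|?M. \<bar>\<beta> x * frechet_derivative \<eta> (at x) i\<bar>))" for \<beta> \<gamma> \<eta>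
  have mid: "\<bar>(a + b) / 2 + k\<bar> \<le> c" if "\<bar>a + k\<bar> \<le> c" "\<bar>b + k\<bar> \<le> c" for a b c k :: real
    using that by (simp add: abs_le_iff field_simps)
  \<comment> \<open>Near-solutions with tolerance proportional to 1/(n+1). Every constraint bounds
    the absolute value of an affine functional of \<open>p\<close>, so midpoints satisfy it
    too.\<close>
  define C where "C n = {p \<in> borel_measurable ?M. (\<forall>x\<in>B. \<bar>p x\<bar> \<le> \<rho> x + L / real (Suc n)) \<and>
     (\<forall>\<beta> \<gamma>. weak_partial B i \<beta> \<gamma> \<longrightarrow> (\<forall>\<eta>\<in>test_functions B.
        \<bar>(LINT x|?M. \<beta> x * p x * \<eta> x) + K \<beta> \<gamma> \<eta>\<bar> \<le> E \<beta> \<gamma> \<eta> / real (Suc n)))}" for n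
  have E0: "E \<beta> \<gamma> \<eta> \<ge> 0" for \<beta> \<gamma> \<eta>
    unfolding E_def using L by (intro mult_nonneg_nonneg add_nonneg_nonneg integral_nonneg_AE) auto
  have dec: "c / real (Suc (Suc n)) \<le> c / real (Suc n)" if "c \<ge> 0" for c n
    using that by (intro divide_left_mono) auto
  have CL: "p \<in> Linf B" if "p \<in> C n" for p n
  proof (rule LinfI_bounded)
    fix x assume x: "x \<in> B"
    have "L / real (Suc n) \<le> L" using L by (simp add: divide_le_eq mult_le_cancel_left1)
    then show "norm (p x) \<le> R + L" using that x \<rho>[of x] by (force simp: C_def)
  qed (use that in \<open>auto simp: C_def\<close>)
  have int: "integrable ?M (\<lambda>x. \<beta> x * p x * \<eta> x)" if "\<beta> \<in> Linf B" "p \<in> Linf B" "\<eta> \<in> test_functions B" for \<beta> p \<eta>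
    using that by (intro Linf_integrable Linf_mult) (auto intro: Linf_test)
  have int': "integrable ?M (\<lambda>x. \<beta> x * p x * frechet_derivative \<eta> (at x) i)"
    if "\<beta> \<in> Linf B" "p \<in> Linf B" "\<eta> \<in> test_functions B" for \<beta> p \<eta>
    using that i by (intro Linf_integrable Linf_mult) (auto intro: Linf_test_partial)
  have C1: "C n \<noteq> {}" for n
  proof -
    \<comment> \<open>Mollification at scale \<open>\<delta>\<close> looks at balls of radius
      \<open>2 * \<delta>\<close>, that is 1/(n+1), which gives the tolerance
      \<open>L / real (Suc n)\<close>.\<close>
    define \<delta> where "\<delta> = 1 / (2 * real (Suc n))"
    have \<delta>: "\<delta> > 0" by (simp add: \<delta>_def)
    obtain h where h: "smooth h" "\<And>x. x \<in> B \<Longrightarrow> \<bar>h x - f x\<bar> \<le> L * \<delta>"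
      "\<And>x M i. x \<in> B \<Longrightarrow> i \<in> Basis \<Longrightarrow>
       (\<And>y z. y \<in> cball x (2*\<delta>) \<Longrightarrow> z \<in> cball x (2*\<delta>) \<Longrightarrow> \<bar>f y - f z\<bar> \<le> M * norm (y - z)) \<Longrightarrow>
       \<bar>frechet_derivative h (at x) i\<bar> \<le> M"
      using mollify_Lipschitz[OF bounded_B lip \<delta>] by metis
    let ?p = "\<lambda>x. frechet_derivative h (at x) i"
    have meas: "smooth u \<Longrightarrow> u \<in> borel_measurable ?M" for u :: "'a \<Rightarrow> real"
      by (intro borel_imp_measurable_lebesgue_on borel_measurable_continuous_onI smoothD(2))
    have pb: "\<bar>?p x\<bar> \<le> \<rho> x + L / real (Suc n)" if "x \<in> B" for x
    proof -
      have "\<bar>?p x\<bar> \<le> \<rho> x + L * (2 * \<delta>)"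
        using that i \<delta> by (intro h(3) loc) auto
      moreover have "2 * \<delta> = 1 / real (Suc n)" by (simp add: \<delta>_def del: of_nat_Suc)
      ultimately show ?thesis by simp
    qed
    have hL: "h \<in> Linf B"
    proof (rule LinfI_bounded)
      fix x assume "x \<in> B"
      then show "norm (h x) \<le> A + L * \<delta>" using h(2)[of x] bd[of x] by simp
    qed (rule meas[OF h(1)])
    have "?p \<in> C n"
      unfolding C_def
    proof (intro CollectI conjI allI impI ballI)
      show pm: "?p \<in> borel_measurable ?M" using h(1) i by (intro meas smoothD(3))
      show "\<bar>?p x\<bar> \<le> \<rho> x + L / real (Suc n)" if "x \<in> B" for x using pb that .
      fix \<beta> \<gamma> \<eta> assume wp: "weak_partial B i \<beta> \<gamma>" and \<eta>: "\<eta> \<in> test_functions B"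
      have \<beta>: "\<beta> \<in> Linf B" "\<gamma> \<in> Linf B" using wp by (auto simp: weak_partial_def)
      have L1: "L / real (Suc n) \<le> L" using L by (simp add: divide_le_eq mult_le_cancel_left1)
      have pL: "?p \<in> Linf B"
      proof (rule LinfI_bounded[OF pm])
        fix x assume "x \<in> B"
        then show "norm (?p x) \<le> R + L" using pb[of x] \<rho>[of x] L1 by simp
      qed
      have D: "frechet_derivative (\<lambda>x. h x * \<eta> x) (at x) i = h x * frechet_derivative \<eta> (at x) i + ?p x * \<eta> x" for x
        by (simp add: frechet_derivative_mult smoothD(1)[OF h(1)] smoothD(1)[OF test_functions_smooth[OF \<eta>]])
      \<comment> \<open>As \<open>h\<close> is smooth, \<open>h * \<eta>\<close> is an admissible
        test function, and its classical product rule gives the exact identity for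
        \<open>h\<close>.\<close>
      have "(LINT x|?M. \<beta> x * frechet_derivative (\<lambda>x. h x * \<eta> x) (at x) i) = - (LINT x|?M. \<gamma> x * (h x * \<eta> x))"
        using wp test_functions_smooth_mult[OF \<eta> h(1)] by (auto simp: weak_partial_def)
      then have "(LINT x|?M. \<beta> x * h x * frechet_derivative \<eta> (at x) i) + (LINT x|?M. \<beta> x * ?p x * \<eta> x)
          = - (LINT x|?M. \<gamma> x * h x * \<eta> x)"
        unfolding D using int[OF \<beta>(1) pL \<eta>] int'[OF \<beta>(1) hL \<eta>]
        by (simp add: distrib_left mult.assoc)
      then have "(LINT x|?M. \<beta> x * ?p x * \<eta> x) + K \<beta> \<gamma> \<eta> =
          ((LINT x|?M. \<gamma> x * f x * \<eta> x) - (LINT x|?M. \<gamma> x * h x * \<eta> x)) +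
          ((LINT x|?M. \<beta> x * f x * frechet_derivative \<eta> (at x) i) - (LINT x|?M. \<beta> x * h x * frechet_derivative \<eta> (at x) i))"
        by (simp add: K_def)
      also have "\<dots> = (LINT x|?M. \<gamma> x * f x * \<eta> x - \<gamma> x * h x * \<eta> x) +
          (LINT x|?M. \<beta> x * f x * frechet_derivative \<eta> (at x) i - \<beta> x * h x * frechet_derivative \<eta> (at x) i)"
        using int[OF \<beta>(2) f \<eta>] int[OF \<beta>(2) hL \<eta>] int'[OF \<beta>(1) f \<eta>] int'[OF \<beta>(1) hL \<eta>] by simp
      finally have eq: "(LINT x|?M. \<beta> x * ?p x * \<eta> x) + K \<beta> \<gamma> \<eta> =
          (LINT x|?M. \<gamma> x * f x * \<eta> x - \<gamma> x * h x * \<eta> x) +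
          (LINT x|?M. \<beta> x * f x * frechet_derivative \<eta> (at x) i - \<beta> x * h x * frechet_derivative \<eta> (at x) i)" .
      \<comment> \<open>Replacing \<open>h\<close> by \<open>f\<close> costs at most the uniform
        distance \<open>L * \<delta>\<close>.\<close>
      have est: "\<bar>LINT x|?M. u x * f x * v x - u x * h x * v x\<bar> \<le> L * \<delta> * (LINT x|?M. \<bar>u x * v x\<bar>)"
        if u: "u \<in> Linf B" and v: "v \<in> Linf B" for u v
      proof -
        have i1: "integrable ?M (\<lambda>x. u x * f x * v x - u x * h x * v x)"
          using u v f hL by (intro Bochner_Integration.integrable_diff Linf_integrable Linf_mult)
        have i2: "integrable ?M (\<lambda>x. L * \<delta> * \<bar>u x * v x\<bar>)"
          using u v by (intro integrable_mult_right integrable_abs Linf_integrable Linf_mult)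
        have "\<bar>LINT x|?M. u x * f x * v x - u x * h x * v x\<bar> \<le> (LINT x|?M. \<bar>u x * f x * v x - u x * h x * v x\<bar>)"
          by (rule integral_abs_bound)
        also have "\<dots> \<le> (LINT x|?M. L * \<delta> * \<bar>u x * v x\<bar>)"
        proof (rule integral_mono)
          fix x assume "x \<in> space ?M"
          then have "\<bar>h x - f x\<bar> * \<bar>u x * v x\<bar> \<le> L * \<delta> * \<bar>u x * v x\<bar>"
            by (intro mult_right_mono h(2)) auto
          moreover have "u x * f x * v x - u x * h x * v x = - ((h x - f x) * (u x * v x))"
            by (simp add: algebra_simps)
          ultimately show "\<bar>u x * f x * v x - u x * h x * v x\<bar> \<le> L * \<delta> * \<bar>u x * v x\<bar>"
            by (simp add: abs_mult)
        qed (use i1 i2 in auto)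
        finally show ?thesis by simp
      qed
      have "\<bar>(LINT x|?M. \<beta> x * ?p x * \<eta> x) + K \<beta> \<gamma> \<eta>\<bar> \<le>
          L * \<delta> * (LINT x|?M. \<bar>\<gamma> x * \<eta> x\<bar>) + L * \<delta> * (LINT x|?M. \<bar>\<beta> x * frechet_derivative \<eta> (at x) i\<bar>)"
        unfolding eq
        by (rule order_trans[OF abs_triangle_ineq add_mono[OF est est]])
          (use \<beta> \<eta> i in \<open>auto intro: Linf_test Linf_test_partial\<close>)
      also have "\<dots> = \<delta> * E \<beta> \<gamma> \<eta>" by (simp add: E_def algebra_simps)
      also have "\<dots> \<le> (1 / real (Suc n)) * E \<beta> \<gamma> \<eta>"
        using E0 by (intro mult_right_mono) (auto simp: \<delta>_def field_simps)
      finally show "\<bar>(LINT x|?M. \<beta> x * ?p x * \<eta> x) + K \<beta> \<gamma> \<eta>\<bar> \<le> E \<beta> \<gamma> \<eta> / real (Suc n)" by simp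
    qed
    then show ?thesis by blast
  qed
  have C2: "C (Suc n) \<subseteq> C n" for n
  proof
    fix p assume p: "p \<in> C (Suc n)"
    show "p \<in> C n"
      unfolding C_def
    proof (intro CollectI conjI allI impI ballI)
      show "p \<in> borel_measurable ?M" using p by (simp add: C_def)
      show "\<bar>p x\<bar> \<le> \<rho> x + L / real (Suc n)" if "x \<in> B" for x
        using p that dec[OF L, of n] unfolding C_def by (smt (verit, best) mem_Collect_eq)
      show "\<bar>(LINT x|?M. \<beta> x * p x * \<eta> x) + K \<beta> \<gamma> \<eta>\<bar> \<le> E \<beta> \<gamma> \<eta> / real (Suc n)"
        if "weak_partial B i \<beta> \<gamma>" "\<eta> \<in> test_functions B" for \<beta> \<gamma> \<eta>
        using p that dec[OF E0, of \<beta> \<gamma> \<eta> n] unfolding C_def by (blast intro: order_trans)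
    qed
  qed
  have C3: "p \<in> borel_measurable ?M" if "p \<in> C 0" for p using that by (simp add: C_def)
  have C4: "\<bar>p x\<bar> \<le> R + L" if "p \<in> C 0" "x \<in> space ?M" for p x
    using that \<rho>[of x] by (force simp: C_def)
  have C5: "(\<lambda>x. (p x + q x) / 2) \<in> C n" if p: "p \<in> C n" and q: "q \<in> C n" for n p q
    unfolding C_def
  proof (intro CollectI conjI allI impI ballI)
    show "(\<lambda>x. (p x + q x) / 2) \<in> borel_measurable ?M"
      using p q by (intro borel_measurable_divide borel_measurable_add borel_measurable_const Linf_measurable CL)
    show "\<bar>(p x + q x) / 2\<bar> \<le> \<rho> x + L / real (Suc n)" if "x \<in> B" for x
    proof -
      have "\<bar>p x\<bar> \<le> \<rho> x + L / real (Suc n)" "\<bar>q x\<bar> \<le> \<rho> x + L / real (Suc n)"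
        using p q that by (auto simp: C_def)
      then show ?thesis using mid[of "p x" 0 "\<rho> x + L / real (Suc n)" "q x"] by (simp del: of_nat_Suc)
    qed
    fix \<beta> \<gamma> \<eta> assume wp: "weak_partial B i \<beta> \<gamma>" and \<eta>: "\<eta> \<in> test_functions B"
    then have \<beta>: "\<beta> \<in> Linf B" by (auto simp: weak_partial_def)
    have "(LINT x|?M. \<beta> x * ((p x + q x) / 2) * \<eta> x) = (LINT x|?M. (\<beta> x * p x * \<eta> x + \<beta> x * q x * \<eta> x) / 2)"
      by (intro Bochner_Integration.integral_cong) (auto simp: field_simps)
    also have "\<dots> = ((LINT x|?M. \<beta> x * p x * \<eta> x) + (LINT x|?M. \<beta> x * q x * \<eta> x)) / 2"
      using int[OF \<beta> CL[OF p] \<eta>] int[OF \<beta> CL[OF q] \<eta>] by simp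
    finally have eq: "(LINT x|?M. \<beta> x * ((p x + q x) / 2) * \<eta> x) = ((LINT x|?M. \<beta> x * p x * \<eta> x) + (LINT x|?M. \<beta> x * q x * \<eta> x)) / 2" .
    have "\<bar>(LINT x|?M. \<beta> x * p x * \<eta> x) + K \<beta> \<gamma> \<eta>\<bar> \<le> E \<beta> \<gamma> \<eta> / real (Suc n)"
      "\<bar>(LINT x|?M. \<beta> x * q x * \<eta> x) + K \<beta> \<gamma> \<eta>\<bar> \<le> E \<beta> \<gamma> \<eta> / real (Suc n)"
      using p q wp \<eta> unfolding C_def by blast+
    then show "\<bar>(LINT x|?M. \<beta> x * ((p x + q x) / 2) * \<eta> x) + K \<beta> \<gamma> \<eta>\<bar> \<le> E \<beta> \<gamma> \<eta> / real (Suc n)"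
      unfolding eq by (rule mid)
  qed
  obtain p g where p: "\<And>n. p n \<in> C n" and g: "g \<in> borel_measurable ?M"
    and lim: "AE x in ?M. (\<lambda>n. p n x) \<longlonglongrightarrow> g x"
    by (rule convex_sets_AE_limit[of C "R + L"])
      (rule C1, rule C2, erule C3, erule (1) C4, erule (1) C5, rule that)
  have L0: "(\<lambda>n. c / real (Suc n)) \<longlonglongrightarrow> 0" for c
    using LIMSEQ_Suc[OF lim_const_over_n[of c]] .
  have g\<rho>: "AE x in ?M. \<bar>g x\<bar> \<le> \<rho> x"
    using lim AE_space
  proof eventually_elim
    case (elim x)
    have "(\<lambda>n. \<rho> x + L / real (Suc n)) \<longlonglongrightarrow> \<rho> x + 0"
      by (intro tendsto_add tendsto_const L0)
    moreover have "(\<lambda>n. \<bar>p n x\<bar>) \<longlonglongrightarrow> \<bar>g x\<bar>" using elim by (intro tendsto_rabs)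
    moreover have "\<bar>p n x\<bar> \<le> \<rho> x + L / real (Suc n)" for n
      using p[of n] elim by (auto simp: C_def)
    ultimately show ?case using LIMSEQ_le[of "\<lambda>n. \<bar>p n x\<bar>" "\<bar>g x\<bar>"] by fastforce
  qed
  have "AE x in ?M. norm (g x) \<le> R"
    using g\<rho> by eventually_elim (use \<rho> order_trans in auto)
  then have gL: "g \<in> Linf B" using g by (auto simp: Linf_def)
  have "weak_partial B i (\<lambda>x. \<beta> x * f x) (\<lambda>x. \<gamma> x * f x + \<beta> x * g x)" if wp: "weak_partial B i \<beta> \<gamma>" for \<beta> \<gamma>
    unfolding weak_partial_def
  proof (intro conjI ballI)
    have \<beta>: "\<beta> \<in> Linf B" "\<gamma> \<in> Linf B" using wp by (auto simp: weak_partial_def)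
    show "(\<lambda>x. \<beta> x * f x) \<in> Linf B" "(\<lambda>x. \<gamma> x * f x + \<beta> x * g x) \<in> Linf B"
      using \<beta> f gL by (auto intro: Linf_mult Linf_add)
    fix \<eta> assume \<eta>: "\<eta> \<in> test_functions B"
    \<comment> \<open>Almost everywhere convergence with the uniform bound \<open>R + L\<close>
      passes to the integrals, and the defect bound tends to 0.\<close>
    have "(\<lambda>n. LINT x|?M. \<beta> x * p n x * \<eta> x) \<longlonglongrightarrow> (LINT x|?M. \<beta> x * g x * \<eta> x)"
    proof (rule integral_dominated_convergence)
      show "(\<lambda>x. \<beta> x * g x * \<eta> x) \<in> borel_measurable ?M" "(\<lambda>x. \<beta> x * p n x * \<eta> x) \<in> borel_measurable ?M" for n
        using int[OF \<beta>(1) gL \<eta>] int[OF \<beta>(1) CL[OF p] \<eta>] by auto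
      show "integrable ?M (\<lambda>x. (R + L) * \<bar>\<beta> x * \<eta> x\<bar>)"
        using \<beta> \<eta> by (intro integrable_mult_right integrable_abs Linf_integrable Linf_mult) (auto intro: Linf_test)
      show "AE x in ?M. (\<lambda>n. \<beta> x * p n x * \<eta> x) \<longlonglongrightarrow> \<beta> x * g x * \<eta> x"
        using lim by eventually_elim (intro tendsto_intros)
      have "norm (\<beta> x * p n x * \<eta> x) \<le> (R + L) * \<bar>\<beta> x * \<eta> x\<bar>" if "x \<in> B" for x n
      proof -
        have "L / real (Suc n) \<le> L" using L by (simp add: divide_le_eq mult_le_cancel_left1)
        then have "\<bar>p n x\<bar> \<le> R + L" using p[of n] that \<rho>[of x] by (force simp: C_def)
        then have "\<bar>p n x\<bar> * \<bar>\<beta> x * \<eta> x\<bar> \<le> (R + L) * \<bar>\<beta> x * \<eta> x\<bar>"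
          by (intro mult_right_mono) auto
        then show ?thesis by (simp add: abs_mult mult.commute mult.left_commute)
      qed
      then show "AE x in ?M. norm (\<beta> x * p n x * \<eta> x) \<le> (R + L) * \<bar>\<beta> x * \<eta> x\<bar>" for n
        by (intro AE_I2) simp
    qed
    then have "(\<lambda>n. \<bar>(LINT x|?M. \<beta> x * p n x * \<eta> x) + K \<beta> \<gamma> \<eta>\<bar>) \<longlonglongrightarrow> \<bar>(LINT x|?M. \<beta> x * g x * \<eta> x) + K \<beta> \<gamma> \<eta>\<bar>"
      by (intro tendsto_intros)
    moreover have "\<bar>(LINT x|?M. \<beta> x * p n x * \<eta> x) + K \<beta> \<gamma> \<eta>\<bar> \<le> E \<beta> \<gamma> \<eta> / real (Suc n)" for n
      using p[of n] wp \<eta> unfolding C_def by blast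
    ultimately have "\<bar>(LINT x|?M. \<beta> x * g x * \<eta> x) + K \<beta> \<gamma> \<eta>\<bar> \<le> 0"
      using LIMSEQ_le[OF _ L0[of "E \<beta> \<gamma> \<eta>"]] by blast
    then show "(LINT x|?M. \<beta> x * f x * frechet_derivative \<eta> (at x) i) = - (LINT x|?M. (\<gamma> x * f x + \<beta> x * g x) * \<eta> x)"
      using int[OF \<beta>(1) gL \<eta>] int[OF \<beta>(2) f \<eta>] by (simp add: K_def distrib_right)
  qed
  then show ?thesis using g g\<rho> that by blast
qed

end

section \<open>The phase field\<close>

text \<open>On one side this is the triangle inequality for \<open>infdist\<close>. Across, the
  segment meets the frontier at a point that splits its length, and each part bounds one of the two
  distances.\<close>

lemma signed_distance_Lipschitz: "\<bar>signed_distance S x - signed_distance S y\<bar> \<le> norm (x - y)"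
proof -
  have cross: "\<bar>signed_distance S x - signed_distance S y\<bar> \<le> dist x y" if "x \<in> S" "y \<notin> S" for x y
  proof -
    have "closed_segment x y \<inter> S \<noteq> {}" "closed_segment x y - S \<noteq> {}"
      using that ends_in_segment[of x y] by auto
    then have "closed_segment x y \<inter> frontier S \<noteq> {}"
      by (intro connected_Int_frontier) auto
    then obtain z where z: "z \<in> closed_segment x y" "z \<in> frontier S" by blast
    have "dist x y = dist x z + dist z y"
      using z(1) by (simp add: between flip: between_mem_segment)
    moreover have "infdist x (frontier S) \<le> dist x z" "infdist y (frontier S) \<le> dist y z"
      using z(2) by (auto intro: infdist_le)
    ultimately show ?thesis
      using that infdist_nonneg[of x "frontier S"] infdist_nonneg[of y "frontier S"]
      by (simp add: signed_distance_def dist_commute)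
  qed
  show ?thesis
    using cross[of x y] cross[of y x] infdist_triangle_abs[of x "frontier S" y]
    by (cases "x \<in> S"; cases "y \<in> S") (auto simp: signed_distance_def dist_norm norm_minus_commute abs_minus_commute)
qed

text \<open>Mean value theorem with tanh' = (1 - tanh)(1 + tanh): the first factor is below 2, the
  second increases. It is kept because 1 + tanh equals \<open>2 * (1 - \<phi>)\<close> for the phase
  field.\<close>

lemma tanh_diff_le:
  fixes s t :: real
  shows "\<bar>tanh s - tanh t\<bar> \<le> 2 * (1 + tanh (max s t)) * \<bar>s - t\<bar>" "\<bar>tanh s - tanh t\<bar> \<le> \<bar>s - t\<bar>"
proof -
  have *: "tanh t - tanh s \<le> 2 * (1 + tanh t) * (t - s) \<and> tanh t - tanh s \<le> t - s" if "s < t" for s t :: real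
  proof -
    have "\<exists>z>s. z < t \<and> tanh t - tanh s = (t - s) * (1 - tanh z ^ 2)"
      using that by (intro MVT2) (auto intro!: derivative_eq_intros)
    then obtain z where z: "z < t" "tanh t - tanh s = (t - s) * (1 - tanh z ^ 2)" by auto
    have "1 - tanh z ^ 2 = (1 - tanh z) * (1 + tanh z)" by (simp add: power2_eq_square algebra_simps)
    also have "\<dots> \<le> 2 * (1 + tanh t)"
      using z(1) tanh_real_gt_neg1[of z] tanh_real_lt_1[of z] by (intro mult_mono) auto
    finally have "(t - s) * (1 - tanh z ^ 2) \<le> (t - s) * (2 * (1 + tanh t))"
      using that by (intro mult_left_mono) auto
    moreover have "(t - s) * (1 - tanh z ^ 2) \<le> (t - s) * 1"
      using that by (intro mult_left_mono) auto
    ultimately show ?thesis using z(2) by (simp add: mult.commute)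
  qed
  have m: "s < t \<Longrightarrow> \<bar>tanh s - tanh t\<bar> = tanh t - tanh s" for s t :: real by simp
  consider "s < t" | "s = t" | "t < s" by linarith
  then show "\<bar>tanh s - tanh t\<bar> \<le> 2 * (1 + tanh (max s t)) * \<bar>s - t\<bar>" "\<bar>tanh s - tanh t\<bar> \<le> \<bar>s - t\<bar>"
    using *[of s t] *[of t s] m[of s t] m[of t s] by (cases; simp add: max_def abs_minus_commute)+
qed

lemma phase_field_bounds: "0 < phase_field \<epsilon> S x" "phase_field \<epsilon> S x < 1"
  using tanh_real_lt_1[of "3 * signed_distance S x / \<epsilon>"] tanh_real_gt_neg1[of "3 * signed_distance S x / \<epsilon>"]
  by (auto simp: phase_field_def)

text \<open>The second estimate is the integrated form of the gradient bound
  \<open>6 / \<epsilon> * (1 - \<phi>)\<close>. Its error accounts for the variation of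
  \<open>1 - \<phi>\<close> over the ball, at most \<open>3 / \<epsilon> * \<delta>\<close>,
  multiplied by \<open>6 / \<epsilon>\<close>.\<close>

lemma phase_field_Lipschitz:
  assumes \<epsilon>: "\<epsilon> > 0"
  shows "\<bar>phase_field \<epsilon> S x - phase_field \<epsilon> S y\<bar> \<le> 3 / \<epsilon> * norm (x - y)"
    and "x \<in> cball z \<delta> \<Longrightarrow> y \<in> cball z \<delta> \<Longrightarrow> \<bar>phase_field \<epsilon> S x - phase_field \<epsilon> S y\<bar>
      \<le> (6 / \<epsilon> * (1 - phase_field \<epsilon> S z) + 18 / \<epsilon>\<^sup>2 * \<delta>) * norm (x - y)"
proof -
  define s where "s x = 3 * signed_distance S x / \<epsilon>" for x
  have \<phi>: "phase_field \<epsilon> S x = (1 - tanh (s x)) / 2" for x by (simp add: phase_field_def s_def)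
  have sl: "\<bar>s x - s y\<bar> \<le> 3 / \<epsilon> * norm (x - y)" for x y
  proof -
    have "s x - s y = 3 / \<epsilon> * (signed_distance S x - signed_distance S y)"
      by (simp add: s_def diff_divide_distrib right_diff_distrib)
    then have "\<bar>s x - s y\<bar> = 3 / \<epsilon> * \<bar>signed_distance S x - signed_distance S y\<bar>"
      using \<epsilon> by (simp only: abs_mult) simp
    also have "\<dots> \<le> 3 / \<epsilon> * norm (x - y)"
      using signed_distance_Lipschitz[of S x y] \<epsilon> by (intro mult_left_mono) auto
    finally show ?thesis .
  qed
  have d: "\<bar>phase_field \<epsilon> S x - phase_field \<epsilon> S y\<bar> = \<bar>tanh (s x) - tanh (s y)\<bar> / 2" for x y
    unfolding \<phi> by (simp add: abs_minus_commute flip: diff_divide_distrib)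
  show lip: "\<bar>phase_field \<epsilon> S x - phase_field \<epsilon> S y\<bar> \<le> 3 / \<epsilon> * norm (x - y)" for x y
  proof -
    have "\<bar>tanh (s x) - tanh (s y)\<bar> / 2 \<le> \<bar>s x - s y\<bar>"
      using tanh_diff_le(2)[of "s x" "s y"] by argo
    then show ?thesis unfolding d using sl by (rule order_trans)
  qed
  assume xy: "x \<in> cball z \<delta>" "y \<in> cball z \<delta>"
  have near: "1 + tanh (s w) \<le> 2 * (1 - phase_field \<epsilon> S z) + 6 / \<epsilon> * \<delta>" if "w \<in> cball z \<delta>" for w
  proof -
    have "3 / \<epsilon> * norm (w - z) \<le> 3 / \<epsilon> * \<delta>"
      using that \<epsilon> by (intro mult_left_mono) (auto simp: dist_norm norm_minus_commute)
    then have "\<bar>phase_field \<epsilon> S w - phase_field \<epsilon> S z\<bar> \<le> 3 / \<epsilon> * \<delta>"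
      using lip[of w z] by linarith
    moreover have "1 + tanh (s w) = 2 * (1 - phase_field \<epsilon> S w)" by (simp add: \<phi> field_simps)
    ultimately show ?thesis by simp
  qed
  have "\<bar>phase_field \<epsilon> S x - phase_field \<epsilon> S y\<bar> = \<bar>tanh (s x) - tanh (s y)\<bar> / 2"
    by (rule d)
  also have "\<dots> \<le> (1 + tanh (max (s x) (s y))) * \<bar>s x - s y\<bar>"
    using tanh_diff_le(1)[of "s x" "s y"] by (simp add: field_simps)
  also have "\<dots> \<le> (2 * (1 - phase_field \<epsilon> S z) + 6 / \<epsilon> * \<delta>) * (3 / \<epsilon> * norm (x - y))"
  proof (rule mult_mono)
    show le: "1 + tanh (max (s x) (s y)) \<le> 2 * (1 - phase_field \<epsilon> S z) + 6 / \<epsilon> * \<delta>"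
      using near[OF xy(1)] near[OF xy(2)] by (simp add: max_def)
    show "0 \<le> 2 * (1 - phase_field \<epsilon> S z) + 6 / \<epsilon> * \<delta>"
      using le tanh_real_gt_neg1[of "max (s x) (s y)"] by linarith
  qed (use sl in auto)
  also have "\<dots> = (6 / \<epsilon> * (1 - phase_field \<epsilon> S z) + 18 / \<epsilon>\<^sup>2 * \<delta>) * norm (x - y)"
    using \<epsilon> by (simp add: field_simps power2_eq_square)
  finally show "\<bar>phase_field \<epsilon> S x - phase_field \<epsilon> S y\<bar>
      \<le> (6 / \<epsilon> * (1 - phase_field \<epsilon> S z) + 18 / \<epsilon>\<^sup>2 * \<delta>) * norm (x - y)" .
qed

section \<open>Square-integrable functions\<close>

text \<open>Completeness of Lebesgue measure; it transfers measurability from an explicit gradient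
  to the chosen representative.\<close>

lemma borel_measurable_lebesgue_on_AE:
  fixes f g :: "'a::euclidean_space \<Rightarrow> 'b::euclidean_space"
  assumes S: "S \<in> sets lebesgue" and f: "f \<in> borel_measurable (lebesgue_on S)"
    and ae: "AE x in lebesgue_on S. f x = g x"
  shows "g \<in> borel_measurable (lebesgue_on S)"
proof -
  have "AE x in lebesgue. (if x \<in> S then f x else 0) = (if x \<in> S then g x else 0)"
    using ae S by (auto simp: AE_restrict_space_iff elim!: eventually_mono)
  then have "(\<lambda>x. if x \<in> S then g x else 0) \<in> borel_measurable lebesgue"
    using borel_measurable_if_I[OF f S] by (rule borel_measurable_AE[rotated])
  then show ?thesis by (rule borel_measurable_if_D)
qed

lemma norm_power2_eq_sum:
  fixes x :: "'a::euclidean_space"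
  shows "(norm x)\<^sup>2 = (\<Sum>i\<in>Basis. (x \<bullet> i)\<^sup>2)"
proof -
  have "(norm x)\<^sup>2 = x \<bullet> x" by (rule power2_norm_eq_inner)
  also have "\<dots> = (\<Sum>i\<in>Basis. (x \<bullet> i) * (x \<bullet> i))" by (rule euclidean_inner)
  finally show ?thesis by (simp add: power2_eq_square)
qed

lemma L2_measurable: "f \<in> L2 B \<Longrightarrow> f \<in> borel_measurable (lebesgue_on B)"
  by (simp add: L2_def)

lemma L2_square_integrable:
  fixes f :: "'a::euclidean_space \<Rightarrow> real"
  shows "f \<in> L2 B \<Longrightarrow> integrable (lebesgue_on B) (\<lambda>x. (f x)\<^sup>2)"
  by (simp add: L2_def)

lemma L2_mult_integrable:
  fixes f g :: "'a::euclidean_space \<Rightarrow> real"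
  assumes "f \<in> L2 B" "g \<in> L2 B"
  shows "integrable (lebesgue_on B) (\<lambda>x. f x * g x)"
proof (rule Bochner_Integration.integrable_bound)
  show "integrable (lebesgue_on B) (\<lambda>x. (f x)\<^sup>2 + (g x)\<^sup>2)"
    using assms by (simp add: L2_def)
  show "(\<lambda>x. f x * g x) \<in> borel_measurable (lebesgue_on B)"
    using assms by (intro borel_measurable_times L2_measurable)
  have "\<bar>a * b\<bar> \<le> a\<^sup>2 + b\<^sup>2" for a b :: real
  proof -
    have "2 * \<bar>a * b\<bar> \<le> a\<^sup>2 + b\<^sup>2"
      using sum_squares_bound[of "\<bar>a\<bar>" "\<bar>b\<bar>"] by (simp add: abs_mult mult.assoc)
    then show ?thesis using abs_ge_zero[of "a * b"] by linarith
  qed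
  then show "AE x in lebesgue_on B. norm (f x * g x) \<le> norm ((f x)\<^sup>2 + (g x)\<^sup>2)"
    by simp
qed

lemma L2_add:
  fixes f g :: "'a::euclidean_space \<Rightarrow> real"
  assumes "f \<in> L2 B" "g \<in> L2 B"
  shows "(\<lambda>x. f x + g x) \<in> L2 B"
  using assms L2_mult_integrable[OF assms]
  by (auto simp: L2_def power2_sum mult.assoc)

lemma L2_Linf_mult:
  fixes f g :: "'a::euclidean_space \<Rightarrow> real"
  assumes c: "c \<in> Linf B" and f: "f \<in> L2 B"
  shows "(\<lambda>x. c x * f x) \<in> L2 B"
proof -
  obtain M where M: "M \<ge> 0" "AE x in lebesgue_on B. norm (c x) \<le> M" using Linf_bound[OF c] .
  have [measurable]: "c \<in> borel_measurable (lebesgue_on B)" "f \<in> borel_measurable (lebesgue_on B)"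
    using c f by (auto simp: L2_def Linf_def)
  have "integrable (lebesgue_on B) (\<lambda>x. (c x * f x)\<^sup>2)"
  proof (rule Bochner_Integration.integrable_bound)
    show "integrable (lebesgue_on B) (\<lambda>x. M\<^sup>2 * (f x)\<^sup>2)"
      using f by (simp add: L2_def)
    show "AE x in lebesgue_on B. norm ((c x * f x)\<^sup>2) \<le> norm (M\<^sup>2 * (f x)\<^sup>2)"
      using M(2)
    proof eventually_elim
      case (elim x)
      then have "(c x)\<^sup>2 \<le> M\<^sup>2" using M(1) by (simp add: abs_le_square_iff[symmetric])
      then show ?case by (simp add: power_mult_distrib mult_right_mono)
    qed
  qed measurable
  then show ?thesis by (simp add: L2_def)
qed

lemma L2_cmult:
  fixes f :: "'a::euclidean_space \<Rightarrow> real"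
  shows "f \<in> L2 B \<Longrightarrow> (\<lambda>x. c * f x) \<in> L2 B"
  by (auto simp: L2_def power_mult_distrib)

lemma L2_diff:
  fixes f g :: "'a::euclidean_space \<Rightarrow> real"
  assumes "f \<in> L2 B" "g \<in> L2 B"
  shows "(\<lambda>x. f x - g x) \<in> L2 B"
  using L2_add[OF assms(1) L2_cmult[OF assms(2), of "-1"]] by simp

lemma L2_component:
  fixes f :: "'a::euclidean_space \<Rightarrow> 'b::euclidean_space"
  assumes f: "f \<in> L2 B" and i: "i \<in> Basis"
  shows "(\<lambda>x. f x \<bullet> i) \<in> L2 B"
proof -
  have [measurable]: "f \<in> borel_measurable (lebesgue_on B)" using f by (rule L2_measurable)
  have "integrable (lebesgue_on B) (\<lambda>x. (f x \<bullet> i)\<^sup>2)"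
  proof (rule Bochner_Integration.integrable_bound)
    show "integrable (lebesgue_on B) (\<lambda>x. (norm (f x))\<^sup>2)" using f by (simp add: L2_def)
    show "AE x in lebesgue_on B. norm ((f x \<bullet> i)\<^sup>2) \<le> norm ((norm (f x))\<^sup>2)"
      using Basis_le_norm[OF i] by (simp add: abs_le_square_iff[symmetric])
  qed measurable
  then show ?thesis by (simp add: L2_def)
qed

lemma L2_if_components:
  fixes f :: "'a::euclidean_space \<Rightarrow> 'b::euclidean_space"
  assumes "\<And>i. i \<in> Basis \<Longrightarrow> (\<lambda>x. f x \<bullet> i) \<in> L2 B"
  shows "f \<in> L2 B"
proof -
  have "f \<in> borel_measurable (lebesgue_on B)"
    using assms by (intro borel_measurable_euclidean_space[THEN iffD2]) (auto simp: L2_def)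
  then show ?thesis
    using assms unfolding L2_def norm_power2_eq_sum by (auto intro!: Bochner_Integration.integrable_sum simp: L2_def)
qed

text \<open>Cauchy-Schwarz: the integral of (f - t g)^2 is a nonnegative quadratic in t, evaluated
  at its minimiser I/G when G > 0.\<close>

lemma integral_mult_power2_le:
  fixes f g :: "'a::euclidean_space \<Rightarrow> real"
  assumes f: "f \<in> L2 B" and g: "g \<in> L2 B"
  shows "(LINT x|lebesgue_on B. f x * g x)\<^sup>2 \<le> (LINT x|lebesgue_on B. (f x)\<^sup>2) * (LINT x|lebesgue_on B. (g x)\<^sup>2)"
proof -
  let ?I = "LINT x|lebesgue_on B. f x * g x"
  let ?F = "LINT x|lebesgue_on B. (f x)\<^sup>2"
  let ?G = "LINT x|lebesgue_on B. (g x)\<^sup>2"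
  have q: "0 \<le> ?F - 2 * t * ?I + t\<^sup>2 * ?G" for t
  proof -
    have "0 \<le> (LINT x|lebesgue_on B. (f x - t * g x)\<^sup>2)" by (intro integral_nonneg_AE) auto
    also have "\<dots> = (LINT x|lebesgue_on B. (f x)\<^sup>2 - 2 * t * (f x * g x) + t\<^sup>2 * (g x)\<^sup>2)"
      by (intro Bochner_Integration.integral_cong) (auto simp: power2_eq_square algebra_simps)
    also have "\<dots> = ?F - 2 * t * ?I + t\<^sup>2 * ?G"
      using L2_mult_integrable[OF f g] L2_square_integrable[OF f] L2_square_integrable[OF g] by simp
    finally show ?thesis .
  qed
  have G: "?G \<ge> 0" by (intro integral_nonneg_AE) auto
  show ?thesis
  proof (cases "?G = 0")
    case True
    have "?I = 0"
    \<comment> \<open>For G = 0 the quadratic is affine in t; a nonzero slope would let it reach -1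
      at the chosen t.\<close>
    proof (rule ccontr)
      assume "?I \<noteq> 0"
      then show False using q[of "(?F + 1) / (2 * ?I)"] True by (simp add: field_simps)
    qed
    then show ?thesis using True by simp
  next
    case False
    then have "?G > 0" using G by (simp only: less_le) simp
    moreover have "0 \<le> F - 2 * (I / G) * I + (I / G)\<^sup>2 * G \<Longrightarrow> I\<^sup>2 \<le> F * G" if "G > 0" for F G I :: real
      using that by (simp add: field_simps power2_eq_square)
    ultimately show ?thesis using q[of "?I / ?G"] by blast
  qed
qed

text \<open>Membership is part of the notion because a non-integrable square has integral 0 by
  convention and would fake convergence.\<close>

definition L2_tendsto ::
    "'a::euclidean_space set \<Rightarrow> (nat \<Rightarrow> 'a \<Rightarrow> real) \<Rightarrow> ('a \<Rightarrow> real) \<Rightarrow> bool" where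
  "L2_tendsto B p q \<longleftrightarrow> (\<forall>k. p k \<in> L2 B) \<and> q \<in> L2 B \<and>
     (\<lambda>k. LINT x|lebesgue_on B. (p k x - q x)\<^sup>2) \<longlonglongrightarrow> 0"

lemma integral_mult_tendsto_0:
  fixes f g :: "nat \<Rightarrow> 'a::euclidean_space \<Rightarrow> real"
  assumes f: "\<And>k. f k \<in> L2 B" and g: "\<And>k. g k \<in> L2 B"
    and lim: "(\<lambda>k. LINT x|lebesgue_on B. (f k x)\<^sup>2) \<longlonglongrightarrow> 0"
    and bd: "\<And>k. (LINT x|lebesgue_on B. (g k x)\<^sup>2) \<le> A"
  shows "(\<lambda>k. LINT x|lebesgue_on B. f k x * g k x) \<longlonglongrightarrow> 0"
proof -
  have "(\<lambda>k. (LINT x|lebesgue_on B. f k x * g k x)\<^sup>2) \<longlonglongrightarrow> 0"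
  proof (rule tendsto_sandwich[OF _ _ tendsto_const])
    have "(\<lambda>k. (LINT x|lebesgue_on B. (f k x)\<^sup>2) * A) \<longlonglongrightarrow> 0 * A"
      by (intro tendsto_mult lim tendsto_const)
    then show "(\<lambda>k. (LINT x|lebesgue_on B. (f k x)\<^sup>2) * A) \<longlonglongrightarrow> 0" by simp
    have "(LINT x|lebesgue_on B. f k x * g k x)\<^sup>2 \<le> (LINT x|lebesgue_on B. (f k x)\<^sup>2) * A" for k
      by (rule order_trans[OF integral_mult_power2_le[OF f g] mult_left_mono[OF bd]])
        (auto intro: integral_nonneg_AE)
    then show "\<forall>\<^sub>F k in sequentially. (LINT x|lebesgue_on B. f k x * g k x)\<^sup>2 \<le> (LINT x|lebesgue_on B. (f k x)\<^sup>2) * A"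
      by simp
  qed auto
  from tendsto_real_sqrt[OF this] show ?thesis
    by (simp add: tendsto_rabs_zero_iff)
qed

text \<open>The difference expands into two terms with one small factor and one with two; each
  vanishes by Cauchy-Schwarz. The quadratic one needs a bound on the second factor, which
  convergence supplies.\<close>

lemma L2_tendsto_integral:
  fixes c :: "'a::euclidean_space \<Rightarrow> real"
  assumes c: "c \<in> Linf B" and p: "L2_tendsto B p q" and p': "L2_tendsto B p' q'"
  shows "(\<lambda>k. LINT x|lebesgue_on B. c x * p k x * p' k x) \<longlonglongrightarrow> (LINT x|lebesgue_on B. c x * q x * q' x)"
proof -
  let ?M = "lebesgue_on B"
  obtain M where M: "M \<ge> 0" "AE x in ?M. norm (c x) \<le> M" using Linf_bound[OF c] .
  have L: "p k \<in> L2 B" "p' k \<in> L2 B" "q \<in> L2 B" "q' \<in> L2 B" for k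
    using p p' by (auto simp: L2_tendsto_def)
  have lim: "(\<lambda>k. LINT x|?M. (p k x - q x)\<^sup>2) \<longlonglongrightarrow> 0" "(\<lambda>k. LINT x|?M. (p' k x - q' x)\<^sup>2) \<longlonglongrightarrow> 0"
    using p p' by (auto simp: L2_tendsto_def)
  have d: "(\<lambda>x. p k x - q x) \<in> L2 B" "(\<lambda>x. p' k x - q' x) \<in> L2 B"
     "(\<lambda>x. c x * q x) \<in> L2 B" "(\<lambda>x. c x * q' x) \<in> L2 B" "(\<lambda>x. c x * (p' k x - q' x)) \<in> L2 B" for k
    using L c by (auto intro!: L2_diff L2_Linf_mult[OF c])
  have 1: "(\<lambda>k. LINT x|?M. (p k x - q x) * (c x * q' x)) \<longlonglongrightarrow> 0"
    by (rule integral_mult_tendsto_0[OF d(1) d(4) lim(1) order_refl])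
  have 2: "(\<lambda>k. LINT x|?M. (p' k x - q' x) * (c x * q x)) \<longlonglongrightarrow> 0"
    by (rule integral_mult_tendsto_0[OF d(2) d(3) lim(2) order_refl])
  obtain A where A: "\<And>k. (LINT x|?M. (p' k x - q' x)\<^sup>2) \<le> A"
    using convergent_imp_Bseq[OF convergentI[OF lim(2)]] by (force simp: Bseq_def)
  have 3: "(\<lambda>k. LINT x|?M. (p k x - q x) * (c x * (p' k x - q' x))) \<longlonglongrightarrow> 0"
  proof (rule integral_mult_tendsto_0[OF d(1) d(5) lim(1)])
    fix k
    have "(LINT x|?M. (c x * (p' k x - q' x))\<^sup>2) \<le> (LINT x|?M. M\<^sup>2 * (p' k x - q' x)\<^sup>2)"
    proof (rule integral_mono_AE)
      show "AE x in ?M. (c x * (p' k x - q' x))\<^sup>2 \<le> M\<^sup>2 * (p' k x - q' x)\<^sup>2"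
        using M(2)
      proof eventually_elim
        case (elim x)
        then have "(c x)\<^sup>2 \<le> M\<^sup>2" using M(1) by (simp add: abs_le_square_iff[symmetric])
        then show ?case by (simp add: power_mult_distrib mult_right_mono)
      qed
    qed (use L2_square_integrable[OF d(5)[of k]] L2_square_integrable[OF d(2)[of k]] in auto)
    also have "\<dots> \<le> M\<^sup>2 * A" using A[of k] by (simp add: mult_left_mono)
    finally show "(LINT x|?M. (c x * (p' k x - q' x))\<^sup>2) \<le> M\<^sup>2 * A" .
  qed
  have eq: "(LINT x|?M. c x * p k x * p' k x) = (LINT x|?M. (p k x - q x) * (c x * (p' k x - q' x))) +
      (LINT x|?M. (p k x - q x) * (c x * q' x)) + (LINT x|?M. (p' k x - q' x) * (c x * q x)) + (LINT x|?M. q x * (c x * q' x))" for k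
  proof -
    have "(LINT x|?M. c x * p k x * p' k x) = (LINT x|?M. (p k x - q x) * (c x * (p' k x - q' x)) +
      (p k x - q x) * (c x * q' x) + (p' k x - q' x) * (c x * q x) + q x * (c x * q' x))"
      by (intro Bochner_Integration.integral_cong) (auto simp: algebra_simps)
    then show ?thesis
      using L2_mult_integrable[OF d(1)[of k] d(5)[of k]] L2_mult_integrable[OF d(1)[of k] d(4)]
        L2_mult_integrable[OF d(2)[of k] d(3)] L2_mult_integrable[OF L(3) d(4)]
      by (simp only: Bochner_Integration.integral_add Bochner_Integration.integrable_add)
  qed
  have "(\<lambda>k. LINT x|?M. c x * p k x * p' k x) \<longlonglongrightarrow> 0 + 0 + 0 + (LINT x|?M. q x * (c x * q' x))"
    unfolding eq by (intro tendsto_add 1 2 3 tendsto_const)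
  then show ?thesis by (simp add: ac_simps)
qed

lemma integrable_imp_locally_integrable:
  fixes f :: "'a::euclidean_space \<Rightarrow> 'b::euclidean_space"
  assumes B: "B \<in> sets lebesgue" and f: "integrable (lebesgue_on B) f"
  shows "locally_integrable B f"
  unfolding locally_integrable_def
proof (intro allI impI)
  fix K assume K: "compact K" "K \<subseteq> B"
  have Ks: "K \<in> sets lebesgue" using K(1) by (simp add: compact_imp_closed)
  have "integrable lebesgue (\<lambda>x. indicator B x *\<^sub>R f x)"
    using f B by (subst (asm) integrable_restrict_space) auto
  then have "integrable lebesgue (\<lambda>x. indicator K x *\<^sub>R (indicator B x *\<^sub>R f x))"
    by (rule integrable_mult_indicator[OF Ks])
  moreover have "(\<lambda>x. indicator K x *\<^sub>R (indicator B x *\<^sub>R f x)) = (\<lambda>x. indicator K x *\<^sub>R f x)"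
    using K(2) by (auto simp: indicator_def fun_eq_iff)
  ultimately show "integrable (lebesgue_on K) f"
    using Ks by (subst integrable_restrict_space) auto
qed

section \<open>Weak gradients on a bounded open set and integration by parts in
  \<open>H10\<close>\<close>

context bounded_open_set
begin

lemma Linf_L2: "f \<in> Linf B \<Longrightarrow> f \<in> L2 B" for f :: "'a \<Rightarrow> real"
  using Linf_integrable[OF Linf_mult, of f f] by (simp add: L2_def Linf_def power2_eq_square)

lemma L2_integrable:
  fixes f :: "'a \<Rightarrow> real"
  assumes "f \<in> L2 B"
  shows "integrable (lebesgue_on B) f"
  using L2_mult_integrable[OF assms Linf_L2[OF Linf_const[of 1]]] by simp

lemma integrable_if_components:
  fixes f :: "'a \<Rightarrow> 'a"
  assumes "\<And>i. i \<in> Basis \<Longrightarrow> integrable (lebesgue_on B) (\<lambda>x. f x \<bullet> i)"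
  shows "integrable (lebesgue_on B) f"
proof -
  have "integrable (lebesgue_on B) (\<lambda>x. \<Sum>i\<in>Basis. (f x \<bullet> i) *\<^sub>R i)"
    using assms by (intro Bochner_Integration.integrable_sum) auto
  then show ?thesis by (simp add: euclidean_representation)
qed

lemma is_weak_gradI:
  fixes f :: "'a \<Rightarrow> real" and g :: "'a \<Rightarrow> 'a"
  assumes "integrable (lebesgue_on B) f" "\<And>i. i \<in> Basis \<Longrightarrow> integrable (lebesgue_on B) (\<lambda>x. g x \<bullet> i)"
    and "\<And>\<eta> i. \<eta> \<in> test_functions B \<Longrightarrow> i \<in> Basis \<Longrightarrow>
      (LINT x|lebesgue_on B. f x * frechet_derivative \<eta> (at x) i) = - (LINT x|lebesgue_on B. (g x \<bullet> i) * \<eta> x)"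
  shows "is_weak_grad B f g"
  unfolding is_weak_grad_def
  using assms by (auto intro!: integrable_imp_locally_integrable[OF sets_B] integrable_if_components)

text \<open>The weak derivative of \<open>\<beta>\<close> tested with the product of two test
  functions. The symmetric form has two limits: \<open>\<psi>\<close> tending to \<open>u\<close>
  with \<open>\<eta>\<close> fixed gives a product rule, and both tending to \<open>u\<close> gives
  the integral identity for \<open>u * u\<close>.\<close>

lemma weak_partial_test_product:
  assumes wp: "weak_partial B i \<beta> \<gamma>" and i: "i \<in> Basis"
    and \<psi>: "\<psi> \<in> test_functions B" and \<eta>: "\<eta> \<in> test_functions B"
  shows "(LINT x|lebesgue_on B. \<beta> x * \<psi> x * frechet_derivative \<eta> (at x) i) +
      (LINT x|lebesgue_on B. \<beta> x * \<eta> x * frechet_derivative \<psi> (at x) i) =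
      - (LINT x|lebesgue_on B. \<gamma> x * \<psi> x * \<eta> x)"
proof -
  have \<beta>: "\<beta> \<in> Linf B" using wp by (simp add: weak_partial_def)
  have D: "frechet_derivative (\<lambda>x. \<psi> x * \<eta> x) (at x) i =
      \<psi> x * frechet_derivative \<eta> (at x) i + frechet_derivative \<psi> (at x) i * \<eta> x" for x
    by (simp add: frechet_derivative_mult smoothD(1)[OF test_functions_smooth[OF \<psi>]] smoothD(1)[OF test_functions_smooth[OF \<eta>]])
  have "integrable (lebesgue_on B) (\<lambda>x. \<beta> x * \<psi> x * frechet_derivative \<eta> (at x) i)"
    "integrable (lebesgue_on B) (\<lambda>x. \<beta> x * \<eta> x * frechet_derivative \<psi> (at x) i)"
    using Linf_test[OF \<psi>] Linf_test[OF \<eta>] Linf_test_partial[OF \<psi> i] Linf_test_partial[OF \<eta> i] \<beta>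
    by (auto intro!: Linf_integrable Linf_mult)
  then have "(LINT x|lebesgue_on B. \<beta> x * \<psi> x * frechet_derivative \<eta> (at x) i) +
      (LINT x|lebesgue_on B. \<beta> x * \<eta> x * frechet_derivative \<psi> (at x) i) =
      (LINT x|lebesgue_on B. \<beta> x * \<psi> x * frechet_derivative \<eta> (at x) i + \<beta> x * \<eta> x * frechet_derivative \<psi> (at x) i)"
    by simp
  also have "\<dots> = (LINT x|lebesgue_on B. \<beta> x * frechet_derivative (\<lambda>x. \<psi> x * \<eta> x) (at x) i)"
    unfolding D by (intro Bochner_Integration.integral_cong) (auto simp: algebra_simps)
  also have "\<dots> = - (LINT x|lebesgue_on B. \<gamma> x * (\<psi> x * \<eta> x))"
    using wp test_functions_mult[OF \<eta> \<psi>] by (simp add: weak_partial_def)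
  finally show ?thesis by (simp add: mult.assoc)
qed

lemma is_weak_grad_test:
  assumes \<psi>: "\<psi> \<in> test_functions B"
  shows "is_weak_grad B \<psi> (\<lambda>x. \<Sum>i\<in>Basis. frechet_derivative \<psi> (at x) i *\<^sub>R i)"
proof (rule is_weak_gradI)
  show "integrable (lebesgue_on B) \<psi>" using \<psi> by (intro Linf_integrable Linf_test)
  fix i :: 'a assume i: "i \<in> Basis"
  show "integrable (lebesgue_on B) (\<lambda>x. (\<Sum>i\<in>Basis. frechet_derivative \<psi> (at x) i *\<^sub>R i) \<bullet> i)"
    using i \<psi> by (simp add: Linf_integrable Linf_test_partial)
  fix \<eta> assume \<eta>: "\<eta> \<in> test_functions B"
  \<comment> \<open>The coefficient 1, whose weak derivative is 0, reduces the product identity to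
    integration by parts.\<close>
  show "(LINT x|lebesgue_on B. \<psi> x * frechet_derivative \<eta> (at x) i) =
      - (LINT x|lebesgue_on B. ((\<Sum>i\<in>Basis. frechet_derivative \<psi> (at x) i *\<^sub>R i) \<bullet> i) * \<eta> x)"
    using weak_partial_test_product[OF weak_partial_const[OF i, of 1] i \<psi> \<eta>] i
    by (simp add: mult.commute)
qed

lemma weak_partial_AE_cong:
  assumes wp: "weak_partial B i \<beta> \<gamma>" and ae: "AE x in lebesgue_on B. \<gamma>' x = \<gamma> x"
  shows "weak_partial B i \<beta> \<gamma>'"
proof -
  have \<gamma>: "\<gamma> \<in> Linf B" using wp by (simp add: weak_partial_def)
  have m: "\<gamma>' \<in> borel_measurable (lebesgue_on B)"
    using ae by (intro borel_measurable_lebesgue_on_AE[OF sets_B Linf_measurable[OF \<gamma>]]) (auto elim!: eventually_mono)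
  obtain M where "AE x in lebesgue_on B. norm (\<gamma> x) \<le> M" using Linf_bound[OF \<gamma>] .
  with ae have "AE x in lebesgue_on B. norm (\<gamma>' x) \<le> M" by eventually_elim simp
  with m have "\<gamma>' \<in> Linf B" by (auto simp: Linf_def)
  moreover have "(LINT x|lebesgue_on B. \<gamma>' x * \<eta> x) = (LINT x|lebesgue_on B. \<gamma> x * \<eta> x)" if "\<eta> \<in> test_functions B" for \<eta>
    using m Linf_measurable[OF \<gamma>] test_functions_measurable[OF that] ae
    by (intro integral_cong_AE) (auto elim!: eventually_mono)
  ultimately show ?thesis using wp by (simp add: weak_partial_def)
qed

lemma W1inf_weak_partial:
  fixes \<beta> :: "'a \<Rightarrow> real"
  assumes \<beta>: "\<beta> \<in> W1inf B" and i: "i \<in> Basis"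
  shows "weak_partial B i \<beta> (\<lambda>x. weak_grad B \<beta> x \<bullet> i)"
proof -
  obtain g where g: "g \<in> Linf B" "is_weak_grad B \<beta> g" using \<beta> by (auto simp: W1inf_def)
  obtain M where "AE x in lebesgue_on B. norm (g x) \<le> M" using Linf_bound[OF g(1)] .
  then have "AE x in lebesgue_on B. norm (g x \<bullet> i) \<le> M"
    by eventually_elim (use Basis_le_norm[OF i] order_trans in auto)
  then have "(\<lambda>x. g x \<bullet> i) \<in> Linf B" using Linf_measurable[OF g(1)] by (auto simp: Linf_def)
  then have "weak_partial B i \<beta> (\<lambda>x. g x \<bullet> i)"
    using \<beta> g(2) i by (simp add: weak_partial_def is_weak_grad_def W1inf_def)
  then show ?thesis
    by (rule weak_partial_AE_cong) (use weak_grad_AE_eq(2)[OF open_B g(2)] in \<open>auto elim!: eventually_mono\<close>)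
qed

text \<open>The derivatives found direction by direction are assembled into one vector field. It is
  a weak gradient, so the bound and the product rule pass to \<open>weak_grad\<close> almost
  everywhere.\<close>

lemma Lipschitz_weak_grad:
  fixes f \<rho> :: "'a \<Rightarrow> real"
  assumes bd: "\<And>x. \<bar>f x\<bar> \<le> A"
    and lip: "\<And>x y. \<bar>f x - f y\<bar> \<le> L * norm (x - y)"
    and loc: "\<And>z \<delta> x y. \<delta> > 0 \<Longrightarrow> x \<in> cball z \<delta> \<Longrightarrow> y \<in> cball z \<delta> \<Longrightarrow>
      \<bar>f x - f y\<bar> \<le> (\<rho> z + L * \<delta>) * norm (x - y)"
    and \<rho>: "\<And>x. \<rho> x \<le> R"
  shows "AE x in lebesgue_on B. \<forall>i\<in>Basis. \<bar>weak_grad B f x \<bullet> i\<bar> \<le> \<rho> x"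
    and "\<And>i. i \<in> Basis \<Longrightarrow> weak_partial B i f (\<lambda>x. weak_grad B f x \<bullet> i)"
    and "\<And>i \<beta> \<gamma>. i \<in> Basis \<Longrightarrow> weak_partial B i \<beta> \<gamma> \<Longrightarrow>
      weak_partial B i (\<lambda>x. \<beta> x * f x) (\<lambda>x. \<gamma> x * f x + \<beta> x * (weak_grad B f x \<bullet> i))"
proof -
  have "\<forall>i\<in>Basis. \<exists>g. g \<in> borel_measurable (lebesgue_on B) \<and> (AE x in lebesgue_on B. \<bar>g x\<bar> \<le> \<rho> x) \<and>
    (\<forall>\<beta> \<gamma>. weak_partial B i \<beta> \<gamma> \<longrightarrow> weak_partial B i (\<lambda>x. \<beta> x * f x) (\<lambda>x. \<gamma> x * f x + \<beta> x * g x))"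
  proof
    fix i :: 'a assume i: "i \<in> Basis"
    show "\<exists>g. g \<in> borel_measurable (lebesgue_on B) \<and> (AE x in lebesgue_on B. \<bar>g x\<bar> \<le> \<rho> x) \<and>
      (\<forall>\<beta> \<gamma>. weak_partial B i \<beta> \<gamma> \<longrightarrow> weak_partial B i (\<lambda>x. \<beta> x * f x) (\<lambda>x. \<gamma> x * f x + \<beta> x * g x))"
      by (rule Lipschitz_weak_partial[OF i bd lip loc \<rho>]) blast+
  qed
  from bchoice[OF this] obtain g where
    "\<forall>i\<in>Basis. g i \<in> borel_measurable (lebesgue_on B) \<and> (AE x in lebesgue_on B. \<bar>g i x\<bar> \<le> \<rho> x) \<and>
      (\<forall>\<beta> \<gamma>. weak_partial B i \<beta> \<gamma> \<longrightarrow> weak_partial B i (\<lambda>x. \<beta> x * f x) (\<lambda>x. \<gamma> x * f x + \<beta> x * g i x))" ..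
  then have g: "i \<in> Basis \<Longrightarrow> AE x in lebesgue_on B. \<bar>g i x\<bar> \<le> \<rho> x"
    "i \<in> Basis \<Longrightarrow> weak_partial B i \<beta> \<gamma> \<Longrightarrow> weak_partial B i (\<lambda>x. \<beta> x * f x) (\<lambda>x. \<gamma> x * f x + \<beta> x * g i x)" for i \<beta> \<gamma>
    by auto
  have fg: "weak_partial B i f (g i)" if "i \<in> Basis" for i
    using g(2)[OF that weak_partial_const[OF that, of 1]] by simp
  have "is_weak_grad B f (\<lambda>x. \<Sum>i\<in>Basis. g i x *\<^sub>R i)"
  proof (rule is_weak_gradI)
    obtain j :: 'a where "j \<in> Basis" using nonempty_Basis by blast
    then show "integrable (lebesgue_on B) f"
      using fg by (auto simp: weak_partial_def intro: Linf_integrable)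
  qed (use fg in \<open>auto simp: weak_partial_def Linf_integrable\<close>)
  from weak_grad_AE_eq(2)[OF open_B this]
  have "AE x in lebesgue_on B. \<forall>i\<in>Basis. weak_grad B f x \<bullet> i = g i x"
    by eventually_elim simp
  then have ae: "AE x in lebesgue_on B. weak_grad B f x \<bullet> i = g i x" if "i \<in> Basis" for i
    by eventually_elim (use that in blast)
  have "AE x in lebesgue_on B. \<bar>weak_grad B f x \<bullet> i\<bar> \<le> \<rho> x" if "i \<in> Basis" for i
    using ae[OF that] g(1)[OF that] by eventually_elim simp
  then show "AE x in lebesgue_on B. \<forall>i\<in>Basis. \<bar>weak_grad B f x \<bullet> i\<bar> \<le> \<rho> x"
    by (intro AE_finite_allI) auto
  show "weak_partial B i f (\<lambda>x. weak_grad B f x \<bullet> i)" if "i \<in> Basis" for i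
    using fg[OF that] ae[OF that] by (rule weak_partial_AE_cong)
  show "weak_partial B i (\<lambda>x. \<beta> x * f x) (\<lambda>x. \<gamma> x * f x + \<beta> x * (weak_grad B f x \<bullet> i))"
    if i: "i \<in> Basis" and "weak_partial B i \<beta> \<gamma>" for i \<beta> \<gamma>
    by (rule weak_partial_AE_cong[OF g(2)[OF that]]) (use ae[OF i] in \<open>auto elim!: eventually_mono\<close>)
qed

text \<open>\<open>H1_norm\<close> involves a chosen gradient of the difference
  \<open>\<psi> k - u\<close>. It agrees almost everywhere with the difference of the explicit
  gradients, so the squared norm dominates the L2 errors of the functions and of each partial
  derivative.\<close>

lemma H10_approx:
  assumes u: "u \<in> H10 B"
  obtains \<psi> where "\<And>k. \<psi> k \<in> test_functions B" "u \<in> L2 B" "weak_grad B u \<in> L2 B"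
    "is_weak_grad B u (weak_grad B u)" "L2_tendsto B \<psi> u"
    "\<And>i. i \<in> Basis \<Longrightarrow> L2_tendsto B (\<lambda>k x. frechet_derivative (\<psi> k) (at x) i) (\<lambda>x. weak_grad B u x \<bullet> i)"
proof -
  let ?M = "lebesgue_on B" and ?U = "weak_grad B u"
  obtain \<psi> where \<psi>: "\<And>k. \<psi> k \<in> test_functions B" and lim: "(\<lambda>k. H1_norm B (\<lambda>x. \<psi> k x - u x)) \<longlonglongrightarrow> 0"
    using u by (auto simp: H10_def)
  obtain g where uL: "u \<in> L2 B" and g: "g \<in> L2 B" "is_weak_grad B u g"
    using u by (auto simp: H10_def H1_def)
  note U = weak_grad_AE_eq[OF open_B g(2)]
  have Um: "?U \<in> borel_measurable ?M"
    using U(2) by (intro borel_measurable_lebesgue_on_AE[OF sets_B L2_measurable[OF g(1)]]) (auto elim!: eventually_mono)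
  have "integrable ?M (\<lambda>x. (norm (?U x))\<^sup>2)"
  proof (rule integrable_cong_AE_imp)
    show "integrable ?M (\<lambda>x. (norm (g x))\<^sup>2)" using g(1) by (simp add: L2_def)
    show "AE x in ?M. (norm (g x))\<^sup>2 = (norm (?U x))\<^sup>2" using U(2) by eventually_elim simp
  qed (use Um in simp)
  with Um have UL: "?U \<in> L2 B" by (simp add: L2_def)
  define G where "G k x = (\<Sum>i\<in>Basis. frechet_derivative (\<psi> k) (at x) i *\<^sub>R i)" for k x
  have Gi: "G k x \<bullet> i = frechet_derivative (\<psi> k) (at x) i" if "i \<in> Basis" for k x i
    using that by (simp add: G_def)
  have GL: "(\<lambda>x. G k x \<bullet> i) \<in> L2 B" if "i \<in> Basis" for k i
    unfolding Gi[OF that] using \<psi> that by (intro Linf_L2 Linf_test_partial)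
  have \<psi>L: "\<psi> k \<in> L2 B" for k using \<psi> by (intro Linf_L2 Linf_test)
  have UiL: "(\<lambda>x. ?U x \<bullet> i) \<in> L2 B" if "i \<in> Basis" for i using UL that by (rule L2_component)
  have dL: "(\<lambda>x. G k x - ?U x) \<in> L2 B" for k
    by (rule L2_if_components) (simp add: inner_diff_left L2_diff GL UiL)
  have wg: "is_weak_grad B (\<lambda>x. \<psi> k x - u x) (\<lambda>x. G k x - ?U x)" for k
  proof (rule is_weak_gradI)
    show "integrable ?M (\<lambda>x. \<psi> k x - u x)" using \<psi>L uL by (intro L2_integrable L2_diff)
    fix i :: 'a assume i: "i \<in> Basis"
    show "integrable ?M (\<lambda>x. (G k x - ?U x) \<bullet> i)"
      using GL[OF i] UiL[OF i] by (simp add: inner_diff_left L2_integrable)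
    fix \<eta> assume \<eta>: "\<eta> \<in> test_functions B"
    have \<eta>L: "\<eta> \<in> L2 B" "(\<lambda>x. frechet_derivative \<eta> (at x) i) \<in> L2 B"
      using \<eta> i by (auto intro: Linf_L2 Linf_test Linf_test_partial)
    have "(LINT x|?M. \<psi> k x * frechet_derivative \<eta> (at x) i) = - (LINT x|?M. (G k x \<bullet> i) * \<eta> x)"
      using is_weak_grad_test[OF \<psi>[of k]] \<eta> i unfolding is_weak_grad_def G_def by simp
    moreover have "(LINT x|?M. u x * frechet_derivative \<eta> (at x) i) = - (LINT x|?M. (?U x \<bullet> i) * \<eta> x)"
      using U(1) \<eta> i unfolding is_weak_grad_def by simp
    ultimately show "(LINT x|?M. (\<psi> k x - u x) * frechet_derivative \<eta> (at x) i) = - (LINT x|?M. ((G k x - ?U x) \<bullet> i) * \<eta> x)"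
      using L2_mult_integrable[OF \<psi>L[of k] \<eta>L(2)] L2_mult_integrable[OF uL \<eta>L(2)]
        L2_mult_integrable[OF GL[OF i, of k] \<eta>L(1)] L2_mult_integrable[OF UiL[OF i] \<eta>L(1)]
      by (simp add: left_diff_distrib inner_diff_left)
  qed
  define N where "N k = (LINT x|?M. (\<psi> k x - u x)\<^sup>2 + (norm (G k x - ?U x))\<^sup>2)" for k
  have Nint: "integrable ?M (\<lambda>x. (\<psi> k x - u x)\<^sup>2 + (norm (G k x - ?U x))\<^sup>2)" for k
    using dL[of k] L2_square_integrable[OF L2_diff[OF \<psi>L uL], of k] by (simp add: L2_def)
  have "(H1_norm B (\<lambda>x. \<psi> k x - u x))\<^sup>2 = N k" for k
  proof -
    have ae: "AE x in ?M. weak_grad B (\<lambda>x. \<psi> k x - u x) x = G k x - ?U x"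
      by (rule weak_grad_AE_eq(2)[OF open_B wg])
    have "(LINT x|?M. (\<psi> k x - u x)\<^sup>2 + (norm (weak_grad B (\<lambda>x. \<psi> k x - u x) x))\<^sup>2) = N k"
      unfolding N_def
    proof (rule integral_cong_AE)
      show "(\<lambda>x. (\<psi> k x - u x)\<^sup>2 + (norm (G k x - ?U x))\<^sup>2) \<in> borel_measurable ?M"
        using Nint[of k] by simp
      then show "(\<lambda>x. (\<psi> k x - u x)\<^sup>2 + (norm (weak_grad B (\<lambda>x. \<psi> k x - u x) x))\<^sup>2) \<in> borel_measurable ?M"
        by (rule borel_measurable_lebesgue_on_AE[OF sets_B]) (use ae in \<open>auto elim!: eventually_mono\<close>)
    qed (use ae in \<open>auto elim!: eventually_mono\<close>)
    moreover have "N k \<ge> 0" unfolding N_def by (intro integral_nonneg_AE) auto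
    ultimately show ?thesis by (simp add: H1_norm_def)
  qed
  then have N: "N \<longlonglongrightarrow> 0" using tendsto_power[OF lim, of 2] by simp
  have "(\<lambda>k. LINT x|?M. (\<psi> k x - u x)\<^sup>2) \<longlonglongrightarrow> 0"
  proof (rule tendsto_sandwich[OF _ _ tendsto_const N])
    show "\<forall>\<^sub>F k in sequentially. (LINT x|?M. (\<psi> k x - u x)\<^sup>2) \<le> N k"
      unfolding N_def using Nint L2_square_integrable[OF L2_diff[OF \<psi>L uL]] by (intro always_eventually allI integral_mono) auto
  qed (auto intro!: always_eventually integral_nonneg_AE)
  then have c1: "L2_tendsto B \<psi> u" using \<psi>L uL by (simp add: L2_tendsto_def)
  have c2: "L2_tendsto B (\<lambda>k x. frechet_derivative (\<psi> k) (at x) i) (\<lambda>x. ?U x \<bullet> i)" if i: "i \<in> Basis" for i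
  proof -
    have "(\<lambda>k. LINT x|?M. (G k x \<bullet> i - ?U x \<bullet> i)\<^sup>2) \<longlonglongrightarrow> 0"
    proof (rule tendsto_sandwich[OF _ _ tendsto_const N])
      have "(G k x \<bullet> i - ?U x \<bullet> i)\<^sup>2 \<le> (\<psi> k x - u x)\<^sup>2 + (norm (G k x - ?U x))\<^sup>2" for k x
      proof -
        have "\<bar>(G k x - ?U x) \<bullet> i\<bar> \<le> norm (G k x - ?U x)" using i by (rule Basis_le_norm)
        then have "(G k x \<bullet> i - ?U x \<bullet> i)\<^sup>2 \<le> (norm (G k x - ?U x))\<^sup>2"
          by (simp add: inner_diff_left abs_le_square_iff[symmetric])
        then show ?thesis by (simp add: add_increasing)
      qed
      then show "\<forall>\<^sub>F k in sequentially. (LINT x|?M. (G k x \<bullet> i - ?U x \<bullet> i)\<^sup>2) \<le> N k"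
        unfolding N_def using Nint L2_square_integrable[OF L2_diff[OF GL[OF i] UiL[OF i]]]
        by (intro always_eventually allI integral_mono) auto
    qed (auto intro!: always_eventually integral_nonneg_AE)
    then show ?thesis using GL[OF i] UiL[OF i] i by (simp add: L2_tendsto_def Gi)
  qed
  show ?thesis using that[OF \<psi> uL UL U(1) c1 c2] .
qed

lemma L2_tendsto_const: "q \<in> L2 B \<Longrightarrow> L2_tendsto B (\<lambda>k. q) q"
  by (simp add: L2_tendsto_def)

lemma weak_partial_H10_mult:
  assumes wp: "weak_partial B i \<beta> \<gamma>" and i: "i \<in> Basis" and u: "u \<in> H10 B" and \<eta>: "\<eta> \<in> test_functions B"
  shows "(LINT x|lebesgue_on B. \<beta> x * u x * frechet_derivative \<eta> (at x) i) =
      - (LINT x|lebesgue_on B. (\<beta> x * (weak_grad B u x \<bullet> i) + \<gamma> x * u x) * \<eta> x)"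
proof -
  let ?M = "lebesgue_on B"
  obtain \<psi> where \<psi>: "\<And>k. \<psi> k \<in> test_functions B" "u \<in> L2 B" "weak_grad B u \<in> L2 B" "L2_tendsto B \<psi> u"
    "L2_tendsto B (\<lambda>k x. frechet_derivative (\<psi> k) (at x) i) (\<lambda>x. weak_grad B u x \<bullet> i)"
    using H10_approx[OF u] i by metis
  have \<beta>: "\<beta> \<in> Linf B" "\<gamma> \<in> Linf B" using wp by (auto simp: weak_partial_def)
  have \<eta>L: "\<eta> \<in> L2 B" "(\<lambda>x. frechet_derivative \<eta> (at x) i) \<in> L2 B"
    using \<eta> i by (auto intro: Linf_L2 Linf_test Linf_test_partial)
  have "(\<lambda>k. (LINT x|?M. \<beta> x * \<psi> k x * frechet_derivative \<eta> (at x) i) + (LINT x|?M. \<beta> x * \<eta> x * frechet_derivative (\<psi> k) (at x) i))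
      \<longlonglongrightarrow> (LINT x|?M. \<beta> x * u x * frechet_derivative \<eta> (at x) i) + (LINT x|?M. \<beta> x * \<eta> x * (weak_grad B u x \<bullet> i))"
    by (intro tendsto_add L2_tendsto_integral \<beta> \<psi> L2_tendsto_const \<eta>L)
  moreover have "(\<lambda>k. - (LINT x|?M. \<gamma> x * \<psi> k x * \<eta> x)) \<longlonglongrightarrow> - (LINT x|?M. \<gamma> x * u x * \<eta> x)"
    by (intro tendsto_minus L2_tendsto_integral \<beta> \<psi> L2_tendsto_const \<eta>L)
  ultimately have eq: "(LINT x|?M. \<beta> x * u x * frechet_derivative \<eta> (at x) i) + (LINT x|?M. \<beta> x * \<eta> x * (weak_grad B u x \<bullet> i)) =
      - (LINT x|?M. \<gamma> x * u x * \<eta> x)"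
    unfolding weak_partial_test_product[OF wp i \<psi>(1) \<eta>] by (rule LIMSEQ_unique)
  have "integrable ?M (\<lambda>x. \<beta> x * \<eta> x * (weak_grad B u x \<bullet> i))" "integrable ?M (\<lambda>x. \<gamma> x * u x * \<eta> x)"
    using \<beta> \<eta>L \<psi>(2) L2_component[OF \<psi>(3) i] by (auto intro!: L2_mult_integrable L2_Linf_mult)
  then have "(LINT x|?M. (\<beta> x * (weak_grad B u x \<bullet> i) + \<gamma> x * u x) * \<eta> x) =
      (LINT x|?M. \<beta> x * \<eta> x * (weak_grad B u x \<bullet> i)) + (LINT x|?M. \<gamma> x * u x * \<eta> x)"
    by (subst Bochner_Integration.integral_add[symmetric]) (auto simp: algebra_simps)
  with eq show ?thesis by simp
qed

text \<open>The approximants have compact support, so no boundary term arises; with both factors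
  equal, the two derivative terms coincide.\<close>

lemma weak_partial_H10_square:
  assumes wp: "weak_partial B i \<beta> \<gamma>" and i: "i \<in> Basis" and u: "u \<in> H10 B"
  shows "2 * (LINT x|lebesgue_on B. \<beta> x * u x * (weak_grad B u x \<bullet> i)) = - (LINT x|lebesgue_on B. \<gamma> x * u x * u x)"
proof -
  let ?M = "lebesgue_on B"
  obtain \<psi> where \<psi>: "\<And>k. \<psi> k \<in> test_functions B" "L2_tendsto B \<psi> u"
    "L2_tendsto B (\<lambda>k x. frechet_derivative (\<psi> k) (at x) i) (\<lambda>x. weak_grad B u x \<bullet> i)"
    using H10_approx[OF u] i by metis
  have \<beta>: "\<beta> \<in> Linf B" "\<gamma> \<in> Linf B" using wp by (auto simp: weak_partial_def)
  have "(\<lambda>k. (LINT x|?M. \<beta> x * \<psi> k x * frechet_derivative (\<psi> k) (at x) i) + (LINT x|?M. \<beta> x * \<psi> k x * frechet_derivative (\<psi> k) (at x) i))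
      \<longlonglongrightarrow> (LINT x|?M. \<beta> x * u x * (weak_grad B u x \<bullet> i)) + (LINT x|?M. \<beta> x * u x * (weak_grad B u x \<bullet> i))"
    by (intro tendsto_add L2_tendsto_integral \<beta> \<psi>)
  moreover have "(\<lambda>k. - (LINT x|?M. \<gamma> x * \<psi> k x * \<psi> k x)) \<longlonglongrightarrow> - (LINT x|?M. \<gamma> x * u x * u x)"
    by (intro tendsto_minus L2_tendsto_integral \<beta> \<psi>)
  ultimately show ?thesis
    unfolding weak_partial_test_product[OF wp i \<psi>(1) \<psi>(1)] by (simp add: LIMSEQ_unique)
qed

end

section \<open>Coercivity\<close>

text \<open>Here \<open>p\<close>, \<open>u\<close>, \<open>U\<close> and \<open>g\<close> are the values of \<open>\<phi>\<close>, \<open>u\<close> and their gradients at one point.\<close>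

lemma completed_square:
  fixes U g :: "'a::real_inner" and p u :: real
  defines "w \<equiv> p *\<^sub>R U + u *\<^sub>R g"
  shows "w \<bullet> (w + u *\<^sub>R g) + 1/4 * (norm g)\<^sup>2 * u * u = (norm (p *\<^sub>R U + (3/2 * u) *\<^sub>R g))\<^sup>2"
proof -
  \<comment> \<open>Adding a quarter of \<open>u\<^sup>2 * (norm g)\<^sup>2\<close> to the form in
    \<open>w\<close> gives the square of \<open>w + (u / 2) *\<^sub>R g\<close>, and 1 + 1/2 is the
    coefficient 3/2.\<close>
  have "p *\<^sub>R U + (3/2 * u) *\<^sub>R g = w + (u / 2) *\<^sub>R g"
    by (simp add: w_def flip: scaleR_add_left)
  then show ?thesis
    unfolding power2_norm_eq_inner
    by (simp add: inner_add_left inner_add_right inner_commute[of g w] field_simps)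
qed

text \<open>Subtract the gradient term from the completed square and use (a + b)^2 <= 2 a^2 + 2 b^2;
  the constant is 9/2 = 2 (3/2)^2.\<close>

lemma weighted_gradient_bound:
  fixes U g :: "'a::real_normed_vector" and p q u K :: real
  assumes g: "norm g \<le> K * q" and K: "K \<ge> 0"
  shows "p\<^sup>2 * (norm U)\<^sup>2 \<le> 2 * (norm (p *\<^sub>R U + (3/2 * u) *\<^sub>R g))\<^sup>2 + 9/2 * K\<^sup>2 * (q\<^sup>2 * u\<^sup>2)"
proof -
  let ?v = "p *\<^sub>R U + (3/2 * u) *\<^sub>R g"
  have "norm (p *\<^sub>R U) \<le> norm ?v + norm ((3/2 * u) *\<^sub>R g)"
    using norm_triangle_ineq4[of ?v "(3/2 * u) *\<^sub>R g"] by simp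
  also have "norm ((3/2 * u) *\<^sub>R g) \<le> 3/2 * \<bar>u\<bar> * (K * q)"
    using g by (simp add: abs_mult mult_left_mono)
  finally have "(norm (p *\<^sub>R U))\<^sup>2 \<le> (norm ?v + 3/2 * \<bar>u\<bar> * (K * q))\<^sup>2"
    by (intro power_mono) auto
  also have "\<dots> \<le> 2 * (norm ?v)\<^sup>2 + 2 * (3/2 * \<bar>u\<bar> * (K * q))\<^sup>2"
    using sum_squares_bound[of "norm ?v" "3/2 * \<bar>u\<bar> * (K * q)"] by (simp add: power2_sum)
  also have "\<dots> = 2 * (norm ?v)\<^sup>2 + 9/2 * K\<^sup>2 * (q\<^sup>2 * u\<^sup>2)"
    by (simp add: power_mult_distrib power_divide)
  finally show ?thesis by (simp add: power_mult_distrib)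
qed

lemma bounded_domain_bounded_open_set: "bounded_domain B \<Longrightarrow> bounded_open_set B"
  by (simp add: bounded_domain_def bounded_open_set_def)

context bounded_open_set
begin

text \<open>Only boundedness, the gradient bound and the product rule are asked of
  \<open>\<phi>\<close>. The denominator exceeds both 2, needed for the completed square, and
  \<open>9/2 * K\<^sup>2 * \<epsilon>\<^sup>2 + 1\<close>, needed for the penalty term
  \<open>Y\<close>.\<close>

lemma a_form_coercive:
  fixes \<phi> D m :: "'a \<Rightarrow> real" and b :: "'a \<Rightarrow> 'a" and \<epsilon> d K :: real
  assumes \<phi>: "\<phi> \<in> Linf B"
    and g: "AE x in lebesgue_on B. norm (weak_grad B \<phi> x) \<le> K * (1 - \<phi> x)" and K: "K \<ge> 0"
    and mult: "\<And>i \<beta> \<gamma>. i \<in> Basis \<Longrightarrow> weak_partial B i \<beta> \<gamma> \<Longrightarrow>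
      weak_partial B i (\<lambda>x. \<beta> x * \<phi> x) (\<lambda>x. \<gamma> x * \<phi> x + \<beta> x * (weak_grad B \<phi> x \<bullet> i))"
    and \<epsilon>: "\<epsilon> > 0" and D: "D \<in> Linf B" and d: "d > 0" "\<And>x. x \<in> B \<Longrightarrow> d \<le> D x"
    and b: "\<And>i. i \<in> Basis \<Longrightarrow> (\<lambda>x. b x \<bullet> i) \<in> W1inf B" and m: "m \<in> Linf B"
    and div: "AE x in lebesgue_on B. m x - 1/2 * weak_div B b x \<ge> 0"
    and u: "u \<in> H10 B"
  shows "a_form B \<epsilon> \<phi> D b m u u \<ge> d / (9/2 * K\<^sup>2 * \<epsilon>\<^sup>2 + 2) * (phase_norm B \<epsilon> \<phi> u)\<^sup>2"
proof -
  let ?M = "lebesgue_on B" and ?U = "weak_grad B u" and ?g = "weak_grad B \<phi>" and ?W = "weak_grad B (\<lambda>y. \<phi> y * u y)"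
  have uL: "u \<in> L2 B" and UL: "?U \<in> L2 B" using H10_approx[OF u] by metis+
  have UiL: "(\<lambda>x. ?U x \<bullet> i) \<in> L2 B" if "i \<in> Basis" for i using UL that by (rule L2_component)
  have \<phi>p: "weak_partial B i \<phi> (\<lambda>x. ?g x \<bullet> i)" if "i \<in> Basis" for i
    using mult[OF that weak_partial_const[OF that, of 1]] by simp
  have gi: "(\<lambda>x. ?g x \<bullet> i) \<in> Linf B" if "i \<in> Basis" for i
    using \<phi>p[OF that] by (simp add: weak_partial_def)
  have W: "AE x in ?M. ?W x = \<phi> x *\<^sub>R ?U x + u x *\<^sub>R ?g x"
  proof (rule weak_grad_AE_eq(2)[OF open_B], rule is_weak_gradI)
    show "integrable ?M (\<lambda>x. \<phi> x * u x)" using \<phi> uL by (intro L2_integrable L2_Linf_mult)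
    fix i :: 'a assume i: "i \<in> Basis"
    have "(\<lambda>x. \<phi> x * (?U x \<bullet> i)) \<in> L2 B" "(\<lambda>x. (?g x \<bullet> i) * u x) \<in> L2 B"
      using \<phi> UiL[OF i] gi[OF i] uL by (auto intro: L2_Linf_mult)
    then show "integrable ?M (\<lambda>x. (\<phi> x *\<^sub>R ?U x + u x *\<^sub>R ?g x) \<bullet> i)"
      using L2_integrable by (simp add: inner_add_left mult.commute)
    fix \<eta> assume "\<eta> \<in> test_functions B"
    then show "(LINT x|?M. \<phi> x * u x * frechet_derivative \<eta> (at x) i) =
        - (LINT x|?M. ((\<phi> x *\<^sub>R ?U x + u x *\<^sub>R ?g x) \<bullet> i) * \<eta> x)"
      using weak_partial_H10_mult[OF \<phi>p[OF i] i u] by (simp add: inner_add_left mult.commute)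
  qed
  define V where "V x = \<phi> x *\<^sub>R ?U x + (3/2 * u x) *\<^sub>R ?g x" for x
  define Y where "Y x = 1 / \<epsilon>\<^sup>2 * ((1 - \<phi> x) * u x)\<^sup>2" for x
  have VL: "V \<in> L2 B"
  proof (rule L2_if_components)
    fix i :: 'a assume i: "i \<in> Basis"
    have "(\<lambda>x. \<phi> x * (?U x \<bullet> i)) \<in> L2 B" "(\<lambda>x. (?g x \<bullet> i) * u x) \<in> L2 B"
      using \<phi> UiL[OF i] gi[OF i] uL by (auto intro: L2_Linf_mult)
    from L2_add[OF this(1) L2_cmult[OF this(2), of "3/2"]]
    show "(\<lambda>x. V x \<bullet> i) \<in> L2 B" by (simp add: V_def inner_add_left ac_simps)
  qed
  have \<phi>1: "(\<lambda>x. 1 - \<phi> x) \<in> Linf B"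
    using Linf_add[OF Linf_const[of 1] Linf_mult[OF Linf_const[of "-1"] \<phi>]] by simp
  have Yint: "integrable ?M Y"
    unfolding Y_def by (intro integrable_mult_right L2_square_integrable L2_Linf_mult \<phi>1 uL)
  have Vint: "integrable ?M (\<lambda>x. (norm (V x))\<^sup>2)" using VL by (simp add: L2_def)
  obtain A where A: "A \<ge> 0" "AE x in ?M. norm (D x) \<le> A" using Linf_bound[OF D] .
  define J1 where "J1 x = D x * ((norm (V x))\<^sup>2 + Y x)" for x
  have J1int: "integrable ?M J1"
  proof (rule Bochner_Integration.integrable_bound)
    show "integrable ?M (\<lambda>x. A * ((norm (V x))\<^sup>2 + Y x))" using Vint Yint by simp
    show "J1 \<in> borel_measurable ?M"
      unfolding J1_def using Vint Yint Linf_measurable[OF D]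
      by (intro borel_measurable_times borel_measurable_add) auto
    show "AE x in ?M. norm (J1 x) \<le> norm (A * ((norm (V x))\<^sup>2 + Y x))"
      using A(2) by eventually_elim (auto simp: J1_def abs_mult intro!: mult_right_mono)
  qed
  define \<gamma> where "\<gamma> i x = weak_grad B (\<lambda>y. b y \<bullet> i) x \<bullet> i" for i x
  have bp: "weak_partial B i (\<lambda>x. b x \<bullet> i) (\<gamma> i)" if "i \<in> Basis" for i
    unfolding \<gamma>_def by (rule W1inf_weak_partial[OF b[OF that] that])
  have bL: "(\<lambda>x. b x \<bullet> i) \<in> Linf B" "\<gamma> i \<in> Linf B" if "i \<in> Basis" for i
    using bp[OF that] by (auto simp: weak_partial_def)
  let ?T = "\<lambda>i x. (b x \<bullet> i) * \<phi> x * \<phi> x * u x * (?U x \<bullet> i) + (b x \<bullet> i) * \<phi> x * (?g x \<bullet> i) * u x * u x"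
  have Tint: "integrable ?M (\<lambda>x. (b x \<bullet> i) * \<phi> x * \<phi> x * u x * (?U x \<bullet> i))"
    "integrable ?M (\<lambda>x. (b x \<bullet> i) * \<phi> x * (?g x \<bullet> i) * u x * u x)"
    "integrable ?M (\<lambda>x. \<gamma> i x * \<phi> x * \<phi> x * u x * u x)" if "i \<in> Basis" for i
    using bL[OF that] \<phi> gi[OF that] uL UiL[OF that]
    by - (intro L2_mult_integrable L2_Linf_mult Linf_mult; assumption)+
  \<comment> \<open>Two product rules starting from \<open>b x \<bullet> i\<close> differentiate the
    coefficient \<open>(b x \<bullet> i) * \<phi> x * \<phi> x\<close>; its two equal terms
    containing the gradient of \<open>\<phi>\<close>, once halved, cancel the second summand of
    \<open>?T\<close>.\<close>
  have T: "(LINT x|?M. ?T i x) = (LINT x|?M. - (1/2) * (\<gamma> i x * \<phi> x * \<phi> x * u x * u x))" if i: "i \<in> Basis" for i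
  proof -
    have "2 * (LINT x|?M. (b x \<bullet> i) * \<phi> x * \<phi> x * u x * (?U x \<bullet> i)) =
        - (LINT x|?M. ((\<gamma> i x * \<phi> x + (b x \<bullet> i) * (?g x \<bullet> i)) * \<phi> x + (b x \<bullet> i) * \<phi> x * (?g x \<bullet> i)) * u x * u x)"
      by (rule weak_partial_H10_square[OF mult[OF i mult[OF i bp[OF i]]] i u])
    also have "(LINT x|?M. ((\<gamma> i x * \<phi> x + (b x \<bullet> i) * (?g x \<bullet> i)) * \<phi> x + (b x \<bullet> i) * \<phi> x * (?g x \<bullet> i)) * u x * u x) =
        (LINT x|?M. \<gamma> i x * \<phi> x * \<phi> x * u x * u x + 2 * ((b x \<bullet> i) * \<phi> x * (?g x \<bullet> i) * u x * u x))"
      by (intro Bochner_Integration.integral_cong) (auto simp: algebra_simps)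
    finally show ?thesis using Tint[OF i] by simp
  qed
  define J2 where "J2 x = (\<Sum>i\<in>Basis. ?T i x) + m x * (\<phi> x * \<phi> x) * u x * u x" for x
  have mint: "integrable ?M (\<lambda>x. m x * (\<phi> x * \<phi> x) * u x * u x)"
    using m \<phi> uL by (intro L2_mult_integrable L2_Linf_mult Linf_mult)
  have J2int: "integrable ?M J2"
    unfolding J2_def using Tint mint
    by (intro Bochner_Integration.integrable_add Bochner_Integration.integrable_sum)
  have "(LINT x|?M. J2 x) = (\<Sum>i\<in>Basis. LINT x|?M. ?T i x) + (LINT x|?M. m x * (\<phi> x * \<phi> x) * u x * u x)"
    unfolding J2_def using Tint mint
    by (subst Bochner_Integration.integral_add) (auto intro!: Bochner_Integration.integrable_sum Bochner_Integration.integral_sum)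
  also have "\<dots> = (LINT x|?M. (\<Sum>i\<in>Basis. - (1/2) * (\<gamma> i x * \<phi> x * \<phi> x * u x * u x)) + m x * (\<phi> x * \<phi> x) * u x * u x)"
  proof -
    have "(\<Sum>i\<in>Basis. LINT x|?M. ?T i x) = (\<Sum>i\<in>Basis. LINT x|?M. - (1/2) * (\<gamma> i x * \<phi> x * \<phi> x * u x * u x))"
      by (rule sum.cong[OF refl T])
    then show ?thesis using Tint(3) mint by simp
  qed
  also have "\<dots> \<ge> 0"
  proof (rule integral_nonneg_AE)
    show "AE x in ?M. 0 \<le> (\<Sum>i\<in>Basis. - (1/2) * (\<gamma> i x * \<phi> x * \<phi> x * u x * u x)) + m x * (\<phi> x * \<phi> x) * u x * u x"
      using div
    proof eventually_elim
      case (elim x)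
      have "(\<Sum>i\<in>Basis. - (1/2) * (\<gamma> i x * \<phi> x * \<phi> x * u x * u x)) = (\<Sum>i\<in>Basis. \<gamma> i x * (- (1/2) * (\<phi> x * u x)\<^sup>2))"
        by (intro sum.cong) (auto simp: power2_eq_square)
      also have "\<dots> = - (1/2) * weak_div B b x * (\<phi> x * u x)\<^sup>2"
        unfolding sum_distrib_right[symmetric] by (simp add: weak_div_def \<gamma>_def)
      finally have "(\<Sum>i\<in>Basis. - (1/2) * (\<gamma> i x * \<phi> x * \<phi> x * u x * u x)) + m x * (\<phi> x * \<phi> x) * u x * u x =
          (m x - 1/2 * weak_div B b x) * (\<phi> x * u x)\<^sup>2"
        by (simp add: algebra_simps power2_eq_square)
      then show ?case using elim by simp
    qed
  qed
  finally have J2: "(LINT x|?M. J2 x) \<ge> 0" .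
  \<comment> \<open>With the gradient of the product expanded almost everywhere, the integrand
    splits into the diffusive part \<open>J1\<close> and the transport and reaction part
    \<open>J2\<close>.\<close>
  have "a_form B \<epsilon> \<phi> D b m u u = (LINT x|?M. J1 x + J2 x)"
    unfolding a_form_def
  proof (rule integral_cong_AE)
    let ?I = "\<lambda>x. D x * (?W x \<bullet> (?W x + u x *\<^sub>R ?g x)) + D x / \<epsilon>\<^sup>2 * (1 - \<phi> x)\<^sup>2 * u x * u x +
      D x / 4 * (norm (?g x))\<^sup>2 * u x * u x + \<phi> x * (b x \<bullet> ?W x) * u x + (\<phi> x)\<^sup>2 * m x * u x * u x"
    show ae: "AE x in ?M. ?I x = J1 x + J2 x"
      using W
    proof eventually_elim
      case (elim x)
      let ?w = "\<phi> x *\<^sub>R ?U x + u x *\<^sub>R ?g x"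
      have "D x * (?w \<bullet> (?w + u x *\<^sub>R ?g x)) + D x / 4 * (norm (?g x))\<^sup>2 * u x * u x = D x * (norm (V x))\<^sup>2"
        unfolding V_def completed_square[symmetric] by (simp add: algebra_simps)
      moreover have "D x / \<epsilon>\<^sup>2 * (1 - \<phi> x)\<^sup>2 * u x * u x = D x * Y x"
        by (simp add: Y_def power2_eq_square algebra_simps)
      moreover have "\<phi> x * (b x \<bullet> ?w) * u x = (\<Sum>i\<in>Basis. ?T i x)"
        by (subst euclidean_inner)
          (auto simp: sum_distrib_left sum_distrib_right inner_add_left algebra_simps intro!: sum.cong)
      ultimately show ?case
        unfolding elim by (simp add: J1_def J2_def distrib_left power2_eq_square ac_simps)
    qed
    show J: "(\<lambda>x. J1 x + J2 x) \<in> borel_measurable ?M" using J1int J2int by simp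
    show "?I \<in> borel_measurable ?M"
      by (rule borel_measurable_lebesgue_on_AE[OF sets_B J]) (use ae in \<open>auto elim!: eventually_mono\<close>)
  qed
  also have "\<dots> \<ge> (LINT x|?M. J1 x)" using J1int J2int J2 by simp
  finally have a: "(LINT x|?M. J1 x) \<le> a_form B \<epsilon> \<phi> D b m u u" .
  define N where "N x = (\<phi> x)\<^sup>2 * (norm (?U x))\<^sup>2 + 1 / \<epsilon>\<^sup>2 * (1 - \<phi> x)\<^sup>2 * \<bar>u x\<bar>\<^sup>2" for x
  have Nint: "integrable ?M N"
  proof -
    have "(\<lambda>x. \<phi> x *\<^sub>R ?U x) \<in> L2 B"
      by (rule L2_if_components) (simp add: L2_Linf_mult \<phi> UiL)
    then have "integrable ?M (\<lambda>x. (\<phi> x)\<^sup>2 * (norm (?U x))\<^sup>2)"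
      by (simp add: L2_def power_mult_distrib)
    then show ?thesis using Yint unfolding N_def Y_def by (simp add: power_mult_distrib mult.assoc)
  qed
  have N0: "(LINT x|?M. N x) \<ge> 0" unfolding N_def by (intro integral_nonneg_AE) auto
  define c where "c = 9/2 * K\<^sup>2 * \<epsilon>\<^sup>2 + 2"
  have c: "c \<ge> 2" unfolding c_def by simp
  have "d / c * (LINT x|?M. N x) = (LINT x|?M. d / c * N x)" by simp
  also have "\<dots> \<le> (LINT x|?M. J1 x)"
  proof (rule integral_mono_AE)
    show "AE x in ?M. d / c * N x \<le> J1 x"
      using g AE_space
    proof eventually_elim
      case (elim x)
      have N: "N x = (\<phi> x)\<^sup>2 * (norm (?U x))\<^sup>2 + Y x"
        by (simp add: N_def Y_def power_mult_distrib mult.assoc)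
      have q: "(1 - \<phi> x)\<^sup>2 * (u x)\<^sup>2 = \<epsilon>\<^sup>2 * Y x"
        using \<epsilon> by (simp add: Y_def power_mult_distrib)
      have Y0: "Y x \<ge> 0" by (simp add: Y_def)
      have "N x \<le> 2 * (norm (V x))\<^sup>2 + 9/2 * K\<^sup>2 * (\<epsilon>\<^sup>2 * Y x) + Y x"
        unfolding N V_def q[symmetric] by (intro add_right_mono weighted_gradient_bound elim K)
      also have "\<dots> \<le> c * (norm (V x))\<^sup>2 + c * Y x"
        using Y0 mult_right_mono[OF c, of "(norm (V x))\<^sup>2"] by (simp add: c_def algebra_simps)
      finally have "d / c * N x \<le> d / c * (c * ((norm (V x))\<^sup>2 + Y x))"
        using d(1) c by (intro mult_left_mono) (auto simp: distrib_left)
      also have "\<dots> = d * ((norm (V x))\<^sup>2 + Y x)" using c by simp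
      also have "\<dots> \<le> J1 x"
        unfolding J1_def using d(2)[of x] elim Y0 by (intro mult_right_mono) auto
      finally show ?case .
    qed
  qed (use Nint J1int in auto)
  finally have "d / c * (LINT x|?M. N x) \<le> a_form B \<epsilon> \<phi> D b m u u" using a by linarith
  moreover have "(phase_norm B \<epsilon> \<phi> u)\<^sup>2 = (LINT x|?M. N x)"
    using N0 by (simp add: phase_norm_def N_def)
  ultimately show ?thesis by (simp add: c_def)
qed

end

theorem theorem5p6:
  fixes \<Omega> B :: "(real ^ 'n) set"
    and \<epsilon> d :: real
    and \<phi> D m :: "real ^ 'n \<Rightarrow> real"
    and b :: "real ^ 'n \<Rightarrow> real ^ 'n"
  assumes "bounded_domain \<Omega>" and "Ck_boundary 1 \<Omega>"
    and "bounded_domain B" and "\<Omega> \<subset> B"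
    and "\<epsilon> > 0"
    and "\<phi> = phase_field \<epsilon> \<Omega>"
    and "D \<in> borel_measurable (lebesgue_on B)" and "bounded (D ` B)"
    and "d > 0" and "\<And>x. x \<in> B \<Longrightarrow> d \<le> D x"
    and "\<And>i. i \<in> Basis \<Longrightarrow> (\<lambda>x. b x \<bullet> i) \<in> W1inf B"
    and "m \<in> Linf B"
    and "AE x in lebesgue_on B. m x - 1/2 * weak_div B b x \<ge> 0"
  shows "\<exists>C>0. \<forall>u\<in>H10 B. a_form B \<epsilon> \<phi> D b m u u \<ge> C * (phase_norm B \<epsilon> \<phi> u)\<^sup>2"
proof -
  interpret bounded_open_set B using assms(3) by (rule bounded_domain_bounded_open_set)
  \<comment> \<open>One constant plays two roles: global Lipschitz constant, at least
    \<open>3 / \<epsilon>\<close>, and error rate of the local estimate, at least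
    \<open>18 / \<epsilon>\<^sup>2\<close>.\<close>
  define L where "L = 3 / \<epsilon> + 18 / \<epsilon>\<^sup>2"
  define \<rho> where "\<rho> x = 6 / \<epsilon> * (1 - \<phi> x)" for x
  have L: "3 / \<epsilon> \<le> L" "18 / \<epsilon>\<^sup>2 \<le> L" using \<open>\<epsilon> > 0\<close> by (auto simp: L_def)
  have \<phi>b: "0 < \<phi> x" "\<phi> x < 1" for x using phase_field_bounds[of \<epsilon> \<Omega> x] assms(6) by auto
  have bd: "\<bar>\<phi> x\<bar> \<le> 1" for x using \<phi>b[of x] by simp
  have lip: "\<bar>\<phi> x - \<phi> y\<bar> \<le> L * norm (x - y)" for x y
    using phase_field_Lipschitz(1)[OF \<open>\<epsilon> > 0\<close>, of \<Omega> x y] mult_right_mono[OF L(1), of "norm (x - y)"] assms(6) by simp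
  have loc: "\<bar>\<phi> x - \<phi> y\<bar> \<le> (\<rho> z + L * \<delta>) * norm (x - y)"
    if "\<delta> > 0" "x \<in> cball z \<delta>" "y \<in> cball z \<delta>" for z \<delta> x y
  proof -
    have "\<bar>\<phi> x - \<phi> y\<bar> \<le> (\<rho> z + 18 / \<epsilon>\<^sup>2 * \<delta>) * norm (x - y)"
      unfolding \<rho>_def assms(6) by (rule phase_field_Lipschitz(2)[OF \<open>\<epsilon> > 0\<close> that(2,3)])
    also have "\<dots> \<le> (\<rho> z + L * \<delta>) * norm (x - y)"
      using L(2) that(1) by (intro mult_right_mono add_left_mono) auto
    finally show ?thesis .
  qed
  have \<rho>: "\<rho> x \<le> 6 / \<epsilon>" for x
    using mult_left_mono[of "1 - \<phi> x" 1 "6 / \<epsilon>"] \<phi>b(1)[of x] \<open>\<epsilon> > 0\<close> by (simp add: \<rho>_def)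
  have wg: "AE x in lebesgue_on B. \<forall>i\<in>Basis. \<bar>weak_grad B \<phi> x \<bullet> i\<bar> \<le> \<rho> x"
    "\<And>i. i \<in> Basis \<Longrightarrow> weak_partial B i \<phi> (\<lambda>x. weak_grad B \<phi> x \<bullet> i)"
    "\<And>i \<beta> \<gamma>. i \<in> Basis \<Longrightarrow> weak_partial B i \<beta> \<gamma> \<Longrightarrow>
      weak_partial B i (\<lambda>x. \<beta> x * \<phi> x) (\<lambda>x. \<gamma> x * \<phi> x + \<beta> x * (weak_grad B \<phi> x \<bullet> i))"
    using Lipschitz_weak_grad[of \<phi> 1 L \<rho> "6 / \<epsilon>"] bd lip loc \<rho> by blast+
  \<comment> \<open>The gradient bound is known per component; bounding the Euclidean norm by the l1
    norm costs the factor of the dimension.\<close>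
  define K where "K = real DIM(real ^ 'n) * (6 / \<epsilon>)"
  have K: "K \<ge> 0" using \<open>\<epsilon> > 0\<close> by (simp add: K_def)
  have g: "AE x in lebesgue_on B. norm (weak_grad B \<phi> x) \<le> K * (1 - \<phi> x)"
    using wg(1)
  proof eventually_elim
    case (elim x)
    have "norm (weak_grad B \<phi> x) \<le> (\<Sum>i\<in>Basis. \<bar>weak_grad B \<phi> x \<bullet> i\<bar>)" by (rule norm_le_l1)
    also have "\<dots> \<le> (\<Sum>i\<in>(Basis::(real^'n) set). \<rho> x)" using elim by (intro sum_mono) auto
    also have "\<dots> = K * (1 - \<phi> x)" by (simp add: K_def \<rho>_def)
    finally show ?case .
  qed
  have \<phi>L: "\<phi> \<in> Linf B"
  proof -
    obtain j :: "real ^ 'n" where "j \<in> Basis" using nonempty_Basis by blast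
    from wg(2)[OF this] show ?thesis by (simp add: weak_partial_def)
  qed
  have DL: "D \<in> Linf B"
  proof -
    obtain A where "\<And>x. x \<in> B \<Longrightarrow> norm (D x) \<le> A" using assms(8) by (auto simp: bounded_iff)
    with assms(7) show ?thesis by (rule LinfI_bounded)
  qed
  have "a_form B \<epsilon> \<phi> D b m u u \<ge> d / (9/2 * K\<^sup>2 * \<epsilon>\<^sup>2 + 2) * (phase_norm B \<epsilon> \<phi> u)\<^sup>2" if "u \<in> H10 B" for u
    by (rule a_form_coercive[where K = K])
      (rule \<phi>L g K wg(3) \<open>\<epsilon> > 0\<close> DL \<open>d > 0\<close> assms(10-13) that | assumption)+
  moreover have "d / (9/2 * K\<^sup>2 * \<epsilon>\<^sup>2 + 2) > 0"
    using \<open>d > 0\<close> by (intro divide_pos_pos add_nonneg_pos) auto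
  ultimately show ?thesis by blast
qed

end
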